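(* Let $\mathcal A$ be a (totally sign-skew-symmetric) cluster algebra associated with a cluster pattern $\{({\bf x}_t,\widetilde B_t)\mid t\in\mathbb T_n\}$ of seeds of rank $n$ in the field $\mathbb F$ of rational functions in $m$ variables over $\mathbb Q$, and let $\mathbb A=(\mathbb F, \{{\bf x}_t\}_{t\in\mathbb T_n})$ be the corresponding positive ${\bf A}$-space. Fix a cluster ${\bf x}_{t_0}$. Then: (i) If $u$ is a cluster monomial and $u\notin \{{\bf x}_{t_0}^{\bf h}\mid {\bf h}\in\mathbb N^m\}$, then the Laurent expansion of $u$ with respect to ${\bf x}_{t_0}$ is a linear combination of proper Laurent monomials in ${\bf x}_{t_0}$. (ii) The cluster monomials of $\mathcal A$ are linearly independent over $\mathbb Z$.
   Context: Fix integers $0<n\le m$, let $\mathbb F$ be the field of rational functions in $m$ variables over $\mathbb Q$, $\mathbb N=\mathbb Z_{\ge0}$, $[1,n]=\{1,\ldots,n\}$, $[a]_+=\max\{a,0\}$. Matrix mutation: for an integer matrix $A=(a_{ij})$ of size $p\times q$ and $1\le k\le\min\{p,q\}$, $\mu_k(A)=(a'_{ij})$ with $a'_{ij}=-a_{ij}$ if $i=k$ or $j=k$, and $a'_{ij}=a_{ij}+[a_{ik}]_+[a_{kj}]_+-[-a_{ik}]_+[-a_{kj}]_+$ otherwise. An $n\times n$ integer matrix $B=(b_{ij})$ is sign-skew-symmetric if for all $i,j$ either $b_{ij}=b_{ji}=0$ or $b_{ij}b_{ji}<0$; it is totally sign-skew-symmetric if it is sign-skew-symmetric and every matrix obtained from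 it by a sequence of mutations is sign-skew-symmetric. A seed of rank $n$ in $\mathbb F$ is a pair $({\bf x},\widetilde B)$, where ${\bf x}=(x_1,\ldots,x_m)$ is an ordered set of free generators of $\mathbb F$ over $\mathbb Q$ and $\widetilde B=(b_{ij})$ is an $m\times n$ integer matrix whose top $n\times n$ submatrix $B$ is totally sign-skew-symmetric. ${\bf x}$ is the cluster and its elements are the cluster variables; $x_1,\dots,x_n$ are unfrozen and $x_{n+1},\dots,x_m$ are frozen. The ${\bf A}$-mutation in direction $k\in[1,n]$ is $({\bf x}',\widetilde B')=\mu_k({\bf x},\widetilde B)$ with $\widetilde B'=\mu_k(\widetilde B)$, $x_i'=x_i$ for $i\ne k$, and $x_k'=x_k^{-1}\bigl(\prod_{j=1}^m x_j^{[b_{jk}]_+}+\prod_{j=1}^m x_j^{[-b_{jk}]_+}\bigr)$. $\mathbb T_n$ is the $n$-regular tree with edges labeled by $1,\dots,n$ so that the $n$ edges at each vertex have different labels. A cluster pattern is an assignment of a seed $({\bf x}_t,\widetilde B_t)$ to each vertex $t$ of $\mathbb T_n$ such that $({\bf x}_{t'},\widetilde B_{t'})=\mu_k({\bf x}_t,\widetilde B_t)$ whenever $t,t'$ are joined by an edge labeled $k$. The cluster algebra is $\mathcal A=\mathbb Z[x_{1;t},\ldots,x_{n;t},x_{n+1;t}^{\pm1},\ldots,x_{m;t}^{\pm1}\mid t\in\mathbb T_n]\subseteq\mathbb F$. By the Laurent phenomenon (Fomin–Zelevinsky), every cluster variable lies in $\mathbb Z[x_{1;t}^{\pm1},\ldots,x_{m;t}^{\pm1}]$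 for each $t\in\mathbb T_n$. The positive ${\bf A}$-space of the pattern is the pair $\mathbb A=(\mathbb F,\{{\bf x}_t\}_{t\in\mathbb T_n})$. A cluster monomial is a monomial ${\bf x}_t^{\bf h}=x_{1;t}^{h_1}\cdots x_{m;t}^{h_m}$, ${\bf h}\in\mathbb N^m$, in cluster variables from one cluster ${\bf x}_t$. The Laurent expansion of $u$ with respect to ${\bf x}_{t_0}$ is its expression in $\mathbb Z[x_{1;t_0}^{\pm1},\ldots,x_{m;t_0}^{\pm1}]$. A Laurent monomial $x_{1;t_0}^{h_1}\cdots x_{m;t_0}^{h_m}$ is proper if $h_i<0$ for some $i\in\{1,\dots,m\}$. *)

theory Defs
  imports
    "HOL-Library.Poly_Mapping"
    "Jordan_Normal_Form.Matrix"
begin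

text \<open>
  Indices start at 0: a cluster is a vector with entries \<open>0, \<dots>, m - 1\<close>, the unfrozen
  ones being those with index below \<open>n\<close>, and mutation directions and edge labels range
  over \<open>{..<n}\<close>.
\<close>

section \<open>Rational function fields\<close>

definition is_subring :: "'f::field set \<Rightarrow> bool" where
  "is_subring R \<longleftrightarrow> 1 \<in> R \<and> (\<forall>a\<in>R. \<forall>b\<in>R. a - b \<in> R \<and> a * b \<in> R)"

definition is_subfield :: "'f::field set \<Rightarrow> bool" where
  "is_subfield K \<longleftrightarrow> is_subring K \<and> (\<forall>a\<in>K. inverse a \<in> K)"

definition monomial :: "'f::field vec \<Rightarrow> (nat \<Rightarrow>\<^sub>0 nat) \<Rightarrow> 'f" where
  "monomial x h = (\<Prod>i<dim_vec x. (x $ i) ^ Poly_Mapping.lookup h i)"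

text \<open>
  A polynomial over the rationals is an element of \<open>(nat \<Rightarrow>\<^sub>0 nat) \<Rightarrow>\<^sub>0 rat\<close>: it maps exponent
  vectors to coefficients.
\<close>

definition poly_in_vars :: "nat \<Rightarrow> ((nat \<Rightarrow>\<^sub>0 nat) \<Rightarrow>\<^sub>0 rat) \<Rightarrow> bool" where
  "poly_in_vars m p \<longleftrightarrow> (\<forall>h\<in>Poly_Mapping.keys p. Poly_Mapping.keys h \<subseteq> {..<m})"

definition poly_value :: "'f::field_char_0 vec \<Rightarrow> ((nat \<Rightarrow>\<^sub>0 nat) \<Rightarrow>\<^sub>0 rat) \<Rightarrow> 'f" where
  "poly_value x p =
     (\<Sum>h\<in>Poly_Mapping.keys p. of_rat (Poly_Mapping.lookup p h) * monomial x h)"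

definition algebraically_independent :: "'f::field_char_0 vec \<Rightarrow> bool" where
  "algebraically_independent x \<longleftrightarrow>
     (\<forall>p. poly_in_vars (dim_vec x) p \<and> poly_value x p = 0 \<longrightarrow> p = 0)"

text \<open>
  The least subfield containing the entries of \<open>x\<close> automatically contains the rationals,
  since the ambient field has characteristic 0.
\<close>

definition free_generators :: "nat \<Rightarrow> 'f::field_char_0 set \<Rightarrow> 'f vec \<Rightarrow> bool" where
  "free_generators m F x \<longleftrightarrow>
     x \<in> carrier_vec m \<and> algebraically_independent x \<and> is_subfield hull (set\<^sub>v x) = F"

text \<open>
  The field of rational functions in \<open>m\<close> variables over the rationals, up to isomorphism,
  as a subfield of some field of characteristic 0.
\<close>

definition rational_function_field :: "nat \<Rightarrow> 'f::field_char_0 set \<Rightarrow> bool" where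
  "rational_function_field m F \<longleftrightarrow> (\<exists>x. free_generators m F x)"

section \<open>Seeds and mutation\<close>

abbreviation pos_part :: "int \<Rightarrow> int" where
  "pos_part a \<equiv> max a 0"

definition mat_mutation :: "nat \<Rightarrow> int mat \<Rightarrow> int mat" where
  "mat_mutation k A = mat (dim_row A) (dim_col A) (\<lambda>(i, j).
     if i = k \<or> j = k then - A $$ (i, j)
     else A $$ (i, j) + pos_part (A $$ (i, k)) * pos_part (A $$ (k, j))
                      - pos_part (- A $$ (i, k)) * pos_part (- A $$ (k, j)))"

definition sign_skew_symmetric :: "nat \<Rightarrow> int mat \<Rightarrow> bool" where
  "sign_skew_symmetric n B \<longleftrightarrow> B \<in> carrier_mat n n \<and>
     (\<forall>i<n. \<forall>j<n. (B $$ (i, j) = 0 \<and> B $$ (j, i) = 0) \<or> B $$ (i, j) * B $$ (j, i) < 0)"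

definition totally_sign_skew_symmetric :: "nat \<Rightarrow> int mat \<Rightarrow> bool" where
  "totally_sign_skew_symmetric n B \<longleftrightarrow>
     (\<forall>ks. set ks \<subseteq> {..<n} \<longrightarrow> sign_skew_symmetric n (fold mat_mutation ks B))"

definition top_submatrix :: "nat \<Rightarrow> int mat \<Rightarrow> int mat" where
  "top_submatrix n B = mat n n (\<lambda>(i, j). B $$ (i, j))"

type_synonym 'f seed = "'f vec \<times> int mat"

definition is_seed :: "nat \<Rightarrow> nat \<Rightarrow> 'f::field_char_0 set \<Rightarrow> 'f seed \<Rightarrow> bool" where
  "is_seed n m F s \<longleftrightarrow> free_generators m F (fst s) \<and> snd s \<in> carrier_mat m n \<and>
     totally_sign_skew_symmetric n (top_submatrix n (snd s))"

definition cluster_mutation :: "nat \<Rightarrow> 'f::field seed \<Rightarrow> 'f vec" where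
  "cluster_mutation k s = (case s of (x, B) \<Rightarrow>
     vec (dim_vec x) (\<lambda>i.
       if i = k
       then inverse (x $ k) * ((\<Prod>j<dim_vec x. (x $ j) powi pos_part (B $$ (j, k)))
                             + (\<Prod>j<dim_vec x. (x $ j) powi pos_part (- B $$ (j, k))))
       else x $ i))"

definition seed_mutation :: "nat \<Rightarrow> 'f::field seed \<Rightarrow> 'f seed" where
  "seed_mutation k s = (cluster_mutation k s, mat_mutation k (snd s))"

section \<open>The labeled regular tree and cluster patterns\<close>

definition simple_path :: "'v set \<Rightarrow> ('v \<Rightarrow> 'v \<Rightarrow> bool) \<Rightarrow> 'v \<Rightarrow> 'v list \<Rightarrow> 'v \<Rightarrow> bool" where
  "simple_path V adj s p t \<longleftrightarrow> p \<noteq> [] \<and> hd p = s \<and> last p = t \<and>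
     set p \<subseteq> V \<and> distinct p \<and> successively adj p"

text \<open>
  A simple undirected graph in which any two vertices are joined by exactly one path.
\<close>

definition is_tree :: "'v set \<Rightarrow> ('v \<Rightarrow> 'v \<Rightarrow> bool) \<Rightarrow> bool" where
  "is_tree V adj \<longleftrightarrow> V \<noteq> {} \<and>
     (\<forall>s\<in>V. \<forall>t\<in>V. adj s t \<longrightarrow> s \<noteq> t \<and> adj t s) \<and>
     (\<forall>s\<in>V. \<forall>t\<in>V. \<exists>!p. simple_path V adj s p t)"

text \<open>
  \<open>lab s t\<close> is the label of the edge joining \<open>s\<close> and \<open>t\<close>. The bijectivity condition says
  both that the tree is \<open>n\<close>-regular and that the labels at each vertex are distinct.
\<close>

definition labeled_regular_tree ::
    "nat \<Rightarrow> 'v set \<Rightarrow> ('v \<Rightarrow> 'v \<Rightarrow> bool) \<Rightarrow> ('v \<Rightarrow> 'v \<Rightarrow> nat) \<Rightarrow> bool" where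
  "labeled_regular_tree n V adj lab \<longleftrightarrow> is_tree V adj \<and>
     (\<forall>s\<in>V. \<forall>t\<in>V. adj s t \<longrightarrow> lab s t = lab t s) \<and>
     (\<forall>t\<in>V. bij_betw (lab t) {s\<in>V. adj t s} {..<n})"

definition cluster_pattern ::
    "nat \<Rightarrow> nat \<Rightarrow> 'f::field_char_0 set \<Rightarrow> 'v set \<Rightarrow> ('v \<Rightarrow> 'v \<Rightarrow> bool) \<Rightarrow> ('v \<Rightarrow> 'v \<Rightarrow> nat) \<Rightarrow>
     ('v \<Rightarrow> 'f seed) \<Rightarrow> bool" where
  "cluster_pattern n m F V adj lab S \<longleftrightarrow> (\<forall>t\<in>V. is_seed n m F (S t)) \<and>
     (\<forall>s\<in>V. \<forall>t\<in>V. adj s t \<longrightarrow> S t = seed_mutation (lab s t) (S s))"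

abbreviation cluster :: "('v \<Rightarrow> 'f seed) \<Rightarrow> 'v \<Rightarrow> 'f vec" where
  "cluster S t \<equiv> fst (S t)"

definition cluster_algebra ::
    "nat \<Rightarrow> nat \<Rightarrow> 'v set \<Rightarrow> ('v \<Rightarrow> 'f::field seed) \<Rightarrow> 'f set" where
  "cluster_algebra n m V S = is_subring hull
     ({cluster S t $ i | t i. t \<in> V \<and> i < m} \<union>
      {inverse (cluster S t $ i) | t i. t \<in> V \<and> n \<le> i \<and> i < m})"

section \<open>Cluster monomials and Laurent expansions\<close>

definition monomials_in :: "'f::field vec \<Rightarrow> 'f set" where
  "monomials_in x = {monomial x h | h. Poly_Mapping.keys h \<subseteq> {..<dim_vec x}}"

definition cluster_monomials :: "'v set \<Rightarrow> ('v \<Rightarrow> 'f::field seed) \<Rightarrow> 'f set" where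
  "cluster_monomials V S = (\<Union>t\<in>V. monomials_in (cluster S t))"

definition laurent_monomial :: "'f::field vec \<Rightarrow> (nat \<Rightarrow>\<^sub>0 int) \<Rightarrow> 'f" where
  "laurent_monomial x h = (\<Prod>i<dim_vec x. (x $ i) powi Poly_Mapping.lookup h i)"

text \<open>
  Such a \<open>c\<close> lists the coefficients of an expression of \<open>u\<close> as an integral Laurent polynomial
  in \<open>x\<close>; it is unique when \<open>x\<close> is algebraically independent.
\<close>

definition laurent_expansion ::
    "'f::field vec \<Rightarrow> 'f \<Rightarrow> ((nat \<Rightarrow>\<^sub>0 int) \<Rightarrow>\<^sub>0 int) \<Rightarrow> bool" where
  "laurent_expansion x u c \<longleftrightarrow>
     (\<forall>h\<in>Poly_Mapping.keys c. Poly_Mapping.keys h \<subseteq> {..<dim_vec x}) \<and>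
     u = (\<Sum>h\<in>Poly_Mapping.keys c. of_int (Poly_Mapping.lookup c h) * laurent_monomial x h)"

definition proper_exponent :: "nat \<Rightarrow> (nat \<Rightarrow>\<^sub>0 int) \<Rightarrow> bool" where
  "proper_exponent m h \<longleftrightarrow> (\<exists>i<m. Poly_Mapping.lookup h i < 0)"

text \<open>\<open>U\<close> is a subset of \<open>A\<close> that is linearly independent over the integers.\<close>

definition int_linearly_independent_in :: "'f::field set \<Rightarrow> 'f set \<Rightarrow> bool" where
  "int_linearly_independent_in A U \<longleftrightarrow>
     U \<subseteq> A \<and> \<not> Modules.module.dependent (\<lambda>(c::int) v. of_int c * v) U"

end

(*
The Laurent phenomenon and the proper Laurent property are proved for an auxiliary pattern with principal
coefficients and then specialized, setting the extra coefficients to 1. In the auxiliary pattern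
the columns of the exchange matrix extend to a basis, so exchange polynomials of commuting directions
are coprime, and the upper bound of a seed (the elements that are Laurent polynomials in its cluster
and in all adjacent clusters) is invariant under mutation.

Let x be the k-th variable of a cluster and z a variable of another cluster. Let d(z) be the value at z of
the tropical point which is -1 at x and 0 at the other variables of the cluster of x. If d(z) < 0, then
z / x still lies in the upper bound, so x is invertible in the Laurent ring of the cluster of z; this forces
x to be a member of that cluster. Otherwise d is nonnegative on that cluster while a cluster monomial
u divisible by x has d(u) < 0. Since u is subtraction-free, d(u) is the maximum of d over the Laurent
monomials of u, so each of them has a negative exponent.
*)
theory Submission
  imports Defs "HOL-Computational_Algebra.Fraction_Field"
begin

section \<open>Laurent polynomials and their gradings\<close>

text \<open>The given columns may be linearly dependent; then two exchange polynomials can share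
  factors, or even coincide, and the upper bound argument breaks down. One new coefficient per
  direction gives columns with prescribable weights, a property that mutation keeps. Clusters are
  functions on all of \<open>nat\<close> with injective evaluation, so frozen and added variables
  need no bookkeeping. Membership in the Laurent ring of a neighbouring cluster becomes divisibility
  of homogeneous components by powers of the exchange polynomial; cancellation is done by gradings,
  without unique factorization. An invertible cluster variable belongs to the other cluster for this
  reason: a subtraction-free unit is one monomial with coefficient 1; its exponents are nonnegative,
  since it is Laurent in each neighbouring cluster too, and vanish at frozen indices; each of its
  factors is then again a unit seen from the other side, and comparing exponents leaves a single
  variable. Tropical values are maxima, so the point with value -1 at x measures the denominator
  exponent of x.\<close>

type_synonym laurent = "(nat \<Rightarrow>\<^sub>0 int) \<Rightarrow>\<^sub>0 int"

abbreviation mon :: "(nat \<Rightarrow>\<^sub>0 int) \<Rightarrow> laurent" where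
  "mon v \<equiv> Poly_Mapping.single v 1"

abbreviation basis_vec :: "nat \<Rightarrow> nat \<Rightarrow>\<^sub>0 int" where
  "basis_vec i \<equiv> Poly_Mapping.single i 1"

definition meval :: "(nat \<Rightarrow> 'a::field) \<Rightarrow> (nat \<Rightarrow>\<^sub>0 int) \<Rightarrow> 'a" where
  "meval x v = (\<Prod>i\<in>Poly_Mapping.keys v. x i powi Poly_Mapping.lookup v i)"

definition leval :: "(nat \<Rightarrow> 'a::field) \<Rightarrow> laurent \<Rightarrow> 'a" where
  "leval x f = (\<Sum>v\<in>Poly_Mapping.keys f. of_int (Poly_Mapping.lookup f v) * meval x v)"

text \<open>One linear functional in two roles: a grading of the Laurent ring, and a tropical point
  listing the values of the initial variables.\<close>

definition weight :: "(nat \<Rightarrow> int) \<Rightarrow> (nat \<Rightarrow>\<^sub>0 int) \<Rightarrow> int" where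
  "weight g v = (\<Sum>i\<in>Poly_Mapping.keys v. g i * Poly_Mapping.lookup v i)"

definition gpart :: "(nat \<Rightarrow> int) \<Rightarrow> int \<Rightarrow> laurent \<Rightarrow> laurent" where
  "gpart g r f = Poly_Mapping.mapp (\<lambda>v c. if weight g v = r then c else 0) f"

definition homogeneous :: "(nat \<Rightarrow> int) \<Rightarrow> int \<Rightarrow> laurent \<Rightarrow> bool" where
  "homogeneous g d f \<longleftrightarrow> (\<forall>v\<in>Poly_Mapping.keys f. weight g v = d)"

abbreviation coord :: "nat \<Rightarrow> nat \<Rightarrow> int" where
  "coord k \<equiv> (\<lambda>i. if i = k then 1 else 0)"

lemma weight_superset:
  assumes "finite I" "Poly_Mapping.keys v \<subseteq> I"
  shows "weight g v = (\<Sum>i\<in>I. g i * Poly_Mapping.lookup v i)"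
  unfolding weight_def
  by (rule sum.mono_neutral_left) (use assms in \<open>auto simp: in_keys_iff\<close>)

lemma weight_add [simp]: "weight g (v + w) = weight g v + weight g w"
proof -
  let ?I = "Poly_Mapping.keys v \<union> Poly_Mapping.keys w"
  have "Poly_Mapping.keys (v + w) \<subseteq> ?I" by (rule keys_add)
  then show ?thesis
    by (subst (1 2 3) weight_superset[of ?I]) (auto simp: lookup_add algebra_simps sum.distrib)
qed

lemma weight_zero [simp]: "weight g 0 = 0"
  by (simp add: weight_def)

lemma weight_single [simp]: "weight g (Poly_Mapping.single i c) = g i * c"
  by (simp add: weight_def)

lemma weight_uminus [simp]: "weight g (- v) = - weight g v"
  by (simp add: weight_def sum_negf)

lemma weight_diff [simp]: "weight g (v - w) = weight g v - weight g w"
proof -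
  have "weight g (v - w + w) = weight g (v - w) + weight g w" by (rule weight_add)
  then show ?thesis by simp
qed

lemma weight_coord [simp]: "weight (coord k) v = Poly_Mapping.lookup v k"
proof -
  have "weight (coord k) v = (\<Sum>i\<in>insert k (Poly_Mapping.keys v). coord k i * Poly_Mapping.lookup v i)"
    by (rule weight_superset) auto
  also have "\<dots> = (\<Sum>i\<in>insert k (Poly_Mapping.keys v). if i = k then Poly_Mapping.lookup v i else 0)"
    by (rule sum.cong) auto
  also have "\<dots> = Poly_Mapping.lookup v k"
    by simp
  finally show ?thesis .
qed

lemma weight_lin:
  "weight (\<lambda>i. g i + c * h i) v = weight g v + c * weight h v"
  by (simp add: weight_def algebra_simps sum.distrib sum_distrib_left)

section \<open>Evaluation of monomials and Laurent polynomials\<close>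

lemma meval_superset:
  assumes "finite I" "Poly_Mapping.keys v \<subseteq> I"
  shows "meval x v = (\<Prod>i\<in>I. x i powi Poly_Mapping.lookup v i)"
  unfolding meval_def
  by (rule prod.mono_neutral_left) (use assms in \<open>auto simp: in_keys_iff\<close>)

lemma meval_zero [simp]: "meval x 0 = 1"
  by (simp add: meval_def)

lemma meval_single [simp]: "meval x (Poly_Mapping.single i c) = x i powi c"
  by (simp add: meval_def)

lemma meval_nonzero: "(\<And>i. x i \<noteq> 0) \<Longrightarrow> meval x v \<noteq> 0"
  by (simp add: meval_def)

lemma meval_add:
  assumes "\<And>i. x i \<noteq> 0"
  shows "meval x (v + w) = meval x v * meval x w"
proof -
  let ?I = "Poly_Mapping.keys v \<union> Poly_Mapping.keys w"
  have "Poly_Mapping.keys (v + w) \<subseteq> ?I" by (rule keys_add)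
  then show ?thesis
    by (subst (1 2 3) meval_superset[of ?I])
       (auto simp: lookup_add power_int_add assms prod.distrib)
qed

lemma meval_uminus: "meval x (- v) = inverse (meval x v)"
  by (simp add: meval_def power_int_minus prod_inversef[symmetric] o_def)

lemma meval_diff:
  assumes "\<And>i. x i \<noteq> 0"
  shows "meval x (v - w) = meval x v / meval x w"
  using meval_add[OF assms, where v = "v - w" and w = w] meval_nonzero[OF assms, where v = w] by simp

lemma meval_cong:
  assumes "\<And>i. i \<in> Poly_Mapping.keys v \<Longrightarrow> x i = y i"
  shows "meval x v = meval y v"
  unfolding meval_def by (rule prod.cong) (auto simp: assms)

text \<open>Reduces statements about products to products of monomials: a factor is expanded, the
  sum is distributed, and the equation is folded back.\<close>

lemma laurent_sum_monomials:
  "f = (\<Sum>v\<in>Poly_Mapping.keys f. Poly_Mapping.single v (Poly_Mapping.lookup f v))"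
  by (rule poly_mapping_eqI)
     (auto simp: lookup_sum lookup_single when_def in_keys_iff)

lemma leval_superset:
  assumes "finite I" "Poly_Mapping.keys f \<subseteq> I"
  shows "leval x f = (\<Sum>v\<in>I. of_int (Poly_Mapping.lookup f v) * meval x v)"
  unfolding leval_def
  by (rule sum.mono_neutral_left) (use assms in \<open>auto simp: in_keys_iff\<close>)

lemma leval_add [simp]: "leval x (f + g) = leval x f + leval x g"
proof -
  let ?I = "Poly_Mapping.keys f \<union> Poly_Mapping.keys g"
  have "Poly_Mapping.keys (f + g) \<subseteq> ?I" by (rule keys_add)
  then show ?thesis
    by (subst (1 2 3) leval_superset[of ?I]) (auto simp: lookup_add algebra_simps sum.distrib)
qed

lemma leval_zero [simp]: "leval x 0 = 0"
  by (simp add: leval_def)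

lemma leval_single [simp]: "leval x (Poly_Mapping.single v c) = of_int c * meval x v"
  by (simp add: leval_def)

lemma leval_one [simp]: "leval x 1 = 1"
  using leval_single[of x 0 1] by simp

lemma leval_sum: "leval x (sum F I) = (\<Sum>i\<in>I. leval x (F i))"
  by (induction I rule: infinite_finite_induct) auto

lemma leval_uminus [simp]: "leval x (- f) = - leval x f"
  using leval_add[of x f "- f"] by (simp add: add_eq_0_iff)

lemma leval_diff [simp]: "leval x (f - g) = leval x f - leval x g"
  using leval_add[of x f "- g"] by simp

lemma leval_single_mult:
  assumes "\<And>i. x i \<noteq> 0"
  shows "leval x (Poly_Mapping.single v c * f) = of_int c * meval x v * leval x f"
proof -
  have "leval x (Poly_Mapping.single v c * (\<Sum>w\<in>Poly_Mapping.keys f. Poly_Mapping.single w (Poly_Mapping.lookup f w)))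
     = of_int c * meval x v * leval x (\<Sum>w\<in>Poly_Mapping.keys f. Poly_Mapping.single w (Poly_Mapping.lookup f w))"
    by (simp add: sum_distrib_left mult_single leval_sum meval_add[OF assms] algebra_simps)
  then show ?thesis by (simp flip: laurent_sum_monomials)
qed

lemma leval_mult:
  assumes "\<And>i. x i \<noteq> 0"
  shows "leval x (f * g) = leval x f * leval x g"
proof -
  have "leval x ((\<Sum>w\<in>Poly_Mapping.keys f. Poly_Mapping.single w (Poly_Mapping.lookup f w)) * g)
     = leval x (\<Sum>w\<in>Poly_Mapping.keys f. Poly_Mapping.single w (Poly_Mapping.lookup f w)) * leval x g"
    by (simp add: sum_distrib_right leval_sum leval_single_mult[OF assms])
  then show ?thesis by (simp flip: laurent_sum_monomials)
qed

lemma leval_power: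
  assumes "\<And>i. x i \<noteq> 0"
  shows "leval x (f ^ r) = leval x f ^ r"
  by (induction r) (auto simp: leval_mult[OF assms])

lemma leval_prod:
  assumes "\<And>i. x i \<noteq> 0"
  shows "leval x (prod F I) = (\<Prod>i\<in>I. leval x (F i))"
  by (induction I rule: infinite_finite_induct) (auto simp: leval_mult[OF assms])

lemma leval_cong:
  assumes "\<And>v i. v \<in> Poly_Mapping.keys f \<Longrightarrow> i \<in> Poly_Mapping.keys v \<Longrightarrow> x i = y i"
  shows "leval x f = leval y f"
  unfolding leval_def
  by (rule sum.cong) (auto intro!: meval_cong assms)

section \<open>Homogeneous components\<close>

lemma lookup_gpart:
  "Poly_Mapping.lookup (gpart g r f) v = (if weight g v = r then Poly_Mapping.lookup f v else 0)"
  by (auto simp: gpart_def lookup_mapp when_def in_keys_iff)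

lemma keys_gpart: "Poly_Mapping.keys (gpart g r f) = {v \<in> Poly_Mapping.keys f. weight g v = r}"
  by (auto simp: in_keys_iff lookup_gpart split: if_splits)

lemma homogeneous_gpart: "homogeneous g r (gpart g r f)"
  by (simp add: homogeneous_def keys_gpart)

lemma gpart_add: "gpart g r (f + h) = gpart g r f + gpart g r h"
  by (rule poly_mapping_eqI) (simp add: lookup_gpart lookup_add)

lemma gpart_zero [simp]: "gpart g r 0 = 0"
  by (rule poly_mapping_eqI) (simp add: lookup_gpart)

lemma gpart_sum: "gpart g r (sum F I) = (\<Sum>i\<in>I. gpart g r (F i))"
  by (induction I rule: infinite_finite_induct) (auto simp: gpart_add)

lemma gpart_single:
  "gpart g r (Poly_Mapping.single v c) = (if weight g v = r then Poly_Mapping.single v c else 0)"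
  by (rule poly_mapping_eqI) (auto simp: lookup_gpart lookup_single when_def)

lemma homogeneous_iff_gpart: "homogeneous g r f \<longleftrightarrow> gpart g r f = f"
proof
  assume "homogeneous g r f"
  then show "gpart g r f = f"
    by (intro poly_mapping_eqI) (auto simp: lookup_gpart homogeneous_def in_keys_iff)
qed (metis homogeneous_gpart)

lemma gpart_homogeneous: "homogeneous g d f \<Longrightarrow> gpart g r f = (if r = d then f else 0)"
  by (rule poly_mapping_eqI) (auto simp: lookup_gpart homogeneous_def in_keys_iff)

lemma gpart_single_mult:
  "gpart g r (Poly_Mapping.single v c * f) = Poly_Mapping.single v c * gpart g (r - weight g v) f"
proof -
  have "gpart g r (Poly_Mapping.single v c * (\<Sum>w\<in>Poly_Mapping.keys f. Poly_Mapping.single w (Poly_Mapping.lookup f w)))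
     = Poly_Mapping.single v c * gpart g (r - weight g v)
        (\<Sum>w\<in>Poly_Mapping.keys f. Poly_Mapping.single w (Poly_Mapping.lookup f w))"
    unfolding sum_distrib_left gpart_sum
    by (rule sum.cong) (auto simp: mult_single gpart_single)
  then show ?thesis by (simp flip: laurent_sum_monomials)
qed

text \<open>A homogeneous factor only shifts degrees, so divisibility by it can be tested component
  by component.\<close>

lemma gpart_homogeneous_mult:
  assumes "homogeneous g d q"
  shows "gpart g r (q * f) = q * gpart g (r - d) f"
proof -
  have "gpart g r ((\<Sum>w\<in>Poly_Mapping.keys q. Poly_Mapping.single w (Poly_Mapping.lookup q w)) * f)
     = (\<Sum>w\<in>Poly_Mapping.keys q. Poly_Mapping.single w (Poly_Mapping.lookup q w)) * gpart g (r - d) f"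
    unfolding sum_distrib_right gpart_sum
    by (rule sum.cong) (use assms in \<open>auto simp: gpart_single_mult homogeneous_def\<close>)
  then show ?thesis by (simp flip: laurent_sum_monomials)
qed

lemma homogeneous_mult:
  assumes "homogeneous g d q" "homogeneous g e f"
  shows "homogeneous g (d + e) (q * f)"
  using gpart_homogeneous_mult[OF assms(1), of "d + e" f] assms(2)
  by (simp add: homogeneous_iff_gpart)

lemma homogeneous_one [simp]: "homogeneous g 0 1"
  by (simp add: homogeneous_def)

lemma homogeneous_single: "homogeneous g (weight g v) (Poly_Mapping.single v c)"
  by (simp add: homogeneous_def)

lemma homogeneous_add:
  "homogeneous g d f \<Longrightarrow> homogeneous g d h \<Longrightarrow> homogeneous g d (f + h)"
  by (simp add: homogeneous_iff_gpart gpart_add)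

lemma homogeneous_power_zero: "homogeneous g 0 f \<Longrightarrow> homogeneous g 0 (f ^ r)"
  by (induction r) (auto intro: homogeneous_mult[where d = 0 and e = 0, simplified])

lemma sum_gpart:
  assumes "finite R" "weight g ` Poly_Mapping.keys f \<subseteq> R"
  shows "f = (\<Sum>r\<in>R. gpart g r f)"
proof (rule poly_mapping_eqI)
  fix v
  show "Poly_Mapping.lookup f v = Poly_Mapping.lookup (\<Sum>r\<in>R. gpart g r f) v"
  proof (cases "v \<in> Poly_Mapping.keys f")
    case True
    then have "weight g v \<in> R" using assms(2) by auto
    then show ?thesis using assms(1) by (simp add: lookup_sum lookup_gpart)
  next
    case False
    then show ?thesis by (auto simp: lookup_sum lookup_gpart in_keys_iff intro!: sum.neutral)
  qed
qed

lemma gpart_eq_0_all: "(\<And>r. gpart g r f = 0) \<Longrightarrow> f = 0"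
  using sum_gpart[of "weight g ` Poly_Mapping.keys f" g f] by simp

lemma dvd_of_gparts:
  assumes "\<And>r. q dvd gpart g r f"
  shows "q dvd f"
  by (subst sum_gpart[of "weight g ` Poly_Mapping.keys f" g f]) (auto intro: dvd_sum assms)

lemma gpart_below:
  obtains r0 where "\<And>r. r < r0 \<Longrightarrow> gpart g r f = 0"
proof -
  define R where "R = insert 0 (weight g ` Poly_Mapping.keys f)"
  have "gpart g r f = 0" if "r < Min R" for r
  proof -
    have "\<not> (\<exists>v\<in>Poly_Mapping.keys f. weight g v = r)"
    proof
      assume "\<exists>v\<in>Poly_Mapping.keys f. weight g v = r"
      then have "r \<in> R" by (auto simp: R_def)
      then have "Min R \<le> r" by (simp add: R_def)
      with that show False by simp
    qed
    then have "Poly_Mapping.keys (gpart g r f) = {}" by (auto simp: keys_gpart)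
    then show ?thesis by simp
  qed
  then show thesis using that by blast
qed

text \<open>Induction on the degree, from below: the lowest part of \<open>f\<close> only meets \<open>e\<close>.\<close>

lemma dvd_gparts_cancel:
  assumes e: "homogeneous g 0 e" and m: "homogeneous g c m" "0 < c"
    and cancel: "\<And>r h. D r dvd e * h \<Longrightarrow> D r dvd h"
    and mono: "\<And>r s. r \<le> s \<Longrightarrow> D s dvd D r"
    and dvd: "\<And>r. D r dvd gpart g r ((e + m) * f)"
  shows "D r dvd gpart g r f"
proof -
  obtain r0 where r0: "\<And>r. r < r0 \<Longrightarrow> gpart g r f = 0" using gpart_below by blast
  have "D r dvd gpart g r f" if "r < r0 + int N" for N r
    using that
  proof (induction N arbitrary: r)
    case 0
    then show ?case by (simp add: r0)
  next
    case (Suc N)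
    have "r - c < r0 + int N" using Suc.prems m(2) by simp
    then have "D (r - c) dvd gpart g (r - c) f" by (rule Suc.IH)
    \<comment> \<open>Lower degrees carry the stronger divisor, so the induction hypothesis at r - c
      is more than enough at r.\<close>
    moreover have "D r dvd D (r - c)" using mono m(2) by simp
    ultimately have 1: "D r dvd m * gpart g (r - c) f"
      by (meson dvd_mult dvd_trans)
    have "gpart g r ((e + m) * f) = e * gpart g r f + m * gpart g (r - c) f"
      using gpart_homogeneous_mult[OF e, of r f] gpart_homogeneous_mult[OF m(1), of r f]
      by (simp add: distrib_right gpart_add)
    then have "D r dvd e * gpart g r f"
      using dvd[of r] 1 by (simp add: dvd_add_left_iff)
    then show ?case by (rule cancel)
  qed
  \<comment> \<open>The chosen bound exceeds r whether r lies above or below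
    \<open>r0\<close>.\<close>
  from this[of r "nat (r - r0) + 1"] show ?thesis by linarith
qed

section \<open>Divisibility up to monomial units\<close>

lemma mon_mult_uminus [simp]: "mon v * mon (- v) = 1" "mon (- v) * mon v = 1"
  by (simp_all add: mult_single)

lemma dvd_mon_mult: "q dvd mon v * f \<longleftrightarrow> q dvd f"
proof
  assume "q dvd mon v * f"
  then have "q dvd mon (- v) * (mon v * f)" by (rule dvd_mult)
  then show "q dvd f" by (simp flip: mult.assoc)
qed simp

lemma mon_mult_dvd: "mon v * q dvd f \<longleftrightarrow> q dvd f"
proof
  assume "q dvd f"
  then obtain h where h: "f = q * h" ..
  have "mon v * q * (mon (- v) * h) = mon v * mon (- v) * (q * h)" by (simp only: ac_simps)
  then have "f = mon v * q * (mon (- v) * h)" using h by simp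
  then show "mon v * q dvd f" ..
qed (meson dvd_mult_right)

lemma mon_power: "mon v ^ r = mon (frag_cmul (int r) v)"
  by (induction r) (auto simp: mult_single frag_cmul_distrib add.commute)

text \<open>A grading that vanishes on v but not on w separates the two binomials:
  \<open>1 + mon v\<close> is homogeneous of degree 0, while \<open>1 + mon w\<close> has lowest
  component 1. This takes the place of coprimality.\<close>

lemma binomial_cancel:
  assumes "weight g v = 0" "0 < weight g w"
    and dvd: "(1 + mon v) ^ a dvd (1 + mon w) * f"
  shows "(1 + mon v) ^ a dvd f"
proof -
  have "homogeneous g 0 (1 + mon v)"
    using homogeneous_single[of g v 1] assms(1) by (simp add: homogeneous_add)
  then have q: "homogeneous g 0 ((1 + mon v) ^ a)" by (rule homogeneous_power_zero)
  have "(1 + mon v) ^ a dvd gpart g r f" for r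
  proof (rule dvd_gparts_cancel[where e = 1 and m = "mon w" and g = g])
    fix r
    obtain h where "(1 + mon w) * f = (1 + mon v) ^ a * h" using dvd ..
    then have "gpart g r ((1 + mon w) * f) = (1 + mon v) ^ a * gpart g r h"
      using gpart_homogeneous_mult[OF q, of r h] by simp
    then show "(1 + mon v) ^ a dvd gpart g r ((1 + mon w) * f)" by simp
  qed (use assms homogeneous_single in auto)
  then show ?thesis by (rule dvd_of_gparts)
qed

section \<open>Mutation of a single variable\<close>

definition pos_vec :: "(nat \<Rightarrow>\<^sub>0 int) \<Rightarrow> nat \<Rightarrow>\<^sub>0 int" where
  "pos_vec v = Poly_Mapping.map (\<lambda>c. max c 0) v"

definition exch :: "(nat \<Rightarrow>\<^sub>0 int) \<Rightarrow> laurent" where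
  "exch v = mon (pos_vec v) + mon (pos_vec (- v))"

definition mutate_vars :: "nat \<Rightarrow> (nat \<Rightarrow>\<^sub>0 int) \<Rightarrow> (nat \<Rightarrow> 'a::field) \<Rightarrow> nat \<Rightarrow> 'a" where
  "mutate_vars k v x = x(k := leval x (exch v) / x k)"

text \<open>Algebraic independence in the form needed here: an identity between values is an
  identity of Laurent polynomials, in variables indexed by all of \<open>nat\<close>.\<close>

definition free_vars :: "(nat \<Rightarrow> 'a::field) \<Rightarrow> bool" where
  "free_vars x \<longleftrightarrow> (\<forall>i. x i \<noteq> 0) \<and> inj (leval x)"

lemma lookup_pos_vec [simp]: "Poly_Mapping.lookup (pos_vec v) i = max (Poly_Mapping.lookup v i) 0"
  by (simp add: pos_vec_def map.rep_eq when_def)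

lemma pos_vec_diff: "pos_vec v - pos_vec (- v) = v"
  by (rule poly_mapping_eqI) (auto simp: lookup_minus)

lemma exch_uminus [simp]: "exch (- v) = exch v"
  by (simp add: exch_def add.commute)

text \<open>Up to a unit the exchange polynomial is a binomial with constant term 1, the form in
  which powers of it can be cancelled.\<close>

lemma exch_factor: "exch v = mon (pos_vec (- v)) * (1 + mon v)"
proof -
  have "pos_vec (- v) + v = pos_vec v" using pos_vec_diff[of v] by (metis diff_add_cancel add.commute)
  then show ?thesis by (simp add: exch_def distrib_left mult_single add.commute)
qed

lemma exch_neq_0 [simp]: "exch v \<noteq> 0"
proof
  assume "exch v = 0"
  then have "Poly_Mapping.lookup (exch v) (pos_vec v) = 0" by simp
  then show False by (auto simp: exch_def lookup_add lookup_single when_def split: if_splits)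
qed

text \<open>The diagonal entry vanishes, so x_k does not occur in its own exchange
  polynomial.\<close>

lemma homogeneous_exch:
  assumes "Poly_Mapping.lookup v k = 0"
  shows "homogeneous (coord k) 0 (exch v)"
  unfolding exch_def using assms by (intro homogeneous_add) (auto simp: homogeneous_def)

lemma free_varsD: "free_vars x \<Longrightarrow> x i \<noteq> 0" "free_vars x \<Longrightarrow> leval x f = leval x h \<longleftrightarrow> f = h"
  "free_vars x \<Longrightarrow> leval x f = 0 \<longleftrightarrow> f = 0"
  unfolding free_vars_def by (auto dest: injD) (metis injD leval_zero)

lemma leval_exch_neq_0: "free_vars x \<Longrightarrow> leval x (exch v) \<noteq> 0"
  by (simp add: free_varsD)

lemma leval_update_free:
  assumes "homogeneous (coord k) 0 f"
  shows "leval (x(k := z)) f = leval x f"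
  by (rule leval_cong) (use assms in \<open>auto simp: homogeneous_def in_keys_iff\<close>)

lemma mutate_vars_nonzero: "free_vars x \<Longrightarrow> mutate_vars k v x i \<noteq> 0"
  by (simp add: mutate_vars_def free_varsD)

lemma meval_update:
  assumes "\<And>i. x i \<noteq> 0" "z \<noteq> 0"
  shows "meval (x(k := z)) u = meval x u * (z / x k) powi Poly_Mapping.lookup u k"
proof -
  let ?I = "insert k (Poly_Mapping.keys u)"
  have "meval (x(k := z)) u = (\<Prod>i\<in>?I. (x(k := z)) i powi Poly_Mapping.lookup u i)"
    by (rule meval_superset) auto
  also have "\<dots> = z powi Poly_Mapping.lookup u k * (\<Prod>i\<in>?I - {k}. x i powi Poly_Mapping.lookup u i)"
    by (subst prod.remove[of _ k]) (auto intro!: prod.cong)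
  also have "\<dots> = (z / x k) powi Poly_Mapping.lookup u k *
      (x k powi Poly_Mapping.lookup u k * (\<Prod>i\<in>?I - {k}. x i powi Poly_Mapping.lookup u i))"
    using assms by (simp add: power_int_divide_distrib)
  also have "x k powi Poly_Mapping.lookup u k * (\<Prod>i\<in>?I - {k}. x i powi Poly_Mapping.lookup u i)
      = (\<Prod>i\<in>?I. x i powi Poly_Mapping.lookup u i)"
    by (subst prod.remove[of ?I k]) auto
  also have "\<dots> = meval x u" by (rule meval_superset[symmetric]) auto
  finally show ?thesis by (metis mult.commute)
qed

text \<open>With P the exchange polynomial, the new variable is x_k times P / x_k^2; degree r in x_k
  collects the r-th power of this ratio.\<close>

lemma leval_mutate_homogeneous:
  assumes x: "free_vars x" and h: "homogeneous (coord k) r f"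
  shows "leval (mutate_vars k v x) f = leval x f * (leval x (exch v) / (x k)\<^sup>2) powi r"
proof -
  define z where "z = leval x (exch v) / x k"
  have "z \<noteq> 0" using x by (simp add: z_def free_varsD)
  then have "leval (x(k := z)) f
      = (\<Sum>u\<in>Poly_Mapping.keys f. of_int (Poly_Mapping.lookup f u) *
          (meval x u * (z / x k) powi Poly_Mapping.lookup u k))"
    unfolding leval_def
    by (intro sum.cong refl) (subst meval_update, use x in \<open>auto simp: free_varsD\<close>)
  also have "\<dots> = (\<Sum>u\<in>Poly_Mapping.keys f. of_int (Poly_Mapping.lookup f u) *
          meval x u * (leval x (exch v) / (x k)\<^sup>2) powi r)"
    using h by (intro sum.cong) (auto simp: homogeneous_def power2_eq_square z_def)
  finally have "leval (x(k := z)) f = leval x f * (leval x (exch v) / (x k)\<^sup>2) powi r"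
    unfolding leval_def[of x f] sum_distrib_right .
  then show ?thesis by (simp only: mutate_vars_def z_def)
qed

lemma leval_mutate_clear:
  assumes x: "free_vars x" and h: "homogeneous (coord k) r f" and N: "r + int N \<ge> 0"
  shows "leval x (exch v) ^ N * leval (mutate_vars k v x) f
       = leval x (mon (Poly_Mapping.single k (- 2 * r)) * exch v ^ nat (r + int N) * f)"
proof -
  have P: "leval x (exch v) \<noteq> 0" and xk: "x k \<noteq> 0" using x by (simp_all add: free_varsD)
  have "leval x (exch v) ^ nat (r + int N) = leval x (exch v) powi (r + int N)"
    using N by (simp add: power_int_def)
  also have "\<dots> = leval x (exch v) powi r * leval x (exch v) ^ N"
    using P by (simp add: power_int_add)
  finally have 1: "leval x (exch v) ^ nat (r + int N) = leval x (exch v) powi r * leval x (exch v) ^ N" .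
  have 2: "((x k)\<^sup>2) powi r = x k powi (2 * r)"
    by (simp add: power_int_mult)
  have "x k powi (- 2 * r) = inverse (x k powi (2 * r))"
    by (metis mult_minus_left power_int_minus)
  then show ?thesis
    unfolding leval_mutate_homogeneous[OF x h]
    using xk by (simp add: leval_mult leval_power free_varsD[OF x] 1 power_int_divide_distrib 2 field_simps)
qed

text \<open>N bounds the pole order of f in x_k. Degree r of f goes to degree -r of h, so different
  components never mix and f can be recovered from h.\<close>

lemma mutate_vars_clear_denominators:
  assumes x: "free_vars x" and v: "Poly_Mapping.lookup v k = 0"
  obtains N h where "leval x (exch v) ^ N * leval (mutate_vars k v x) f = leval x h"
    and "\<And>r. r + int N < 0 \<Longrightarrow> gpart (coord k) r f = 0"
    and "\<And>r. gpart (coord k) (- r) h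
           = mon (Poly_Mapping.single k (- 2 * r)) * exch v ^ nat (r + int N) * gpart (coord k) r f"
proof -
  obtain r0 where r0: "\<And>r. r < r0 \<Longrightarrow> gpart (coord k) r f = 0" using gpart_below by blast
  define N where "N = nat (- r0)"
  have N: "gpart (coord k) r f = 0" if "r + int N < 0" for r
    using that unfolding N_def by (intro r0) linarith
  define R where "R = weight (coord k) ` Poly_Mapping.keys f"
  define F where "F r = mon (Poly_Mapping.single k (- 2 * r)) * exch v ^ nat (r + int N) * gpart (coord k) r f" for r
  define h where "h = sum F R"
  have fin: "finite R" by (simp add: R_def)
  have hom: "homogeneous (coord k) (- r) (F r)" for r
  proof -
    have "homogeneous (coord k) (- 2 * r + 0 + r) (F r)"
      unfolding F_def
    proof (intro homogeneous_mult homogeneous_gpart homogeneous_power_zero homogeneous_exch v)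
      show "homogeneous (coord k) (- 2 * r) (mon (Poly_Mapping.single k (- 2 * r)))"
        by (simp add: homogeneous_def)
    qed
    then show ?thesis by simp
  qed
  have "leval x (exch v) ^ N * leval (mutate_vars k v x) (gpart (coord k) r f) = leval x (F r)" for r
  proof (cases "r + int N < 0")
    case True
    then show ?thesis by (simp add: N F_def)
  next
    case False
    then show ?thesis
      unfolding F_def using leval_mutate_clear[OF x homogeneous_gpart[of "coord k" r f], of N v] by simp
  qed
  then have 1: "leval x (exch v) ^ N * leval (mutate_vars k v x) f = leval x h"
    by (subst sum_gpart[OF fin, of "coord k" f])
       (auto simp: R_def h_def leval_sum sum_distrib_left)
  have 2: "gpart (coord k) (- r) h = F r" for r
  proof -
    have "gpart (coord k) (- r) h = (\<Sum>s\<in>R. if s = r then F s else 0)"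
      unfolding h_def gpart_sum
      by (intro sum.cong refl) (auto simp: gpart_homogeneous[OF hom])
    also have "\<dots> = (if r \<in> R then F r else 0)" using fin by simp
    also have "\<dots> = F r"
    proof (cases "r \<in> R")
      case False
      then have "Poly_Mapping.keys (gpart (coord k) r f) = {}" by (auto simp: R_def keys_gpart)
      then show ?thesis by (simp add: F_def)
    qed simp
    finally show ?thesis .
  qed
  show thesis by (rule that[OF 1 N 2[unfolded F_def]])
qed

text \<open>If f evaluates to 0, the cleared h is 0, and each component of f is a component of h
  divided by a nonzero factor.\<close>

lemma free_vars_mutate:
  assumes x: "free_vars x" and v: "Poly_Mapping.lookup v k = 0"
  shows "free_vars (mutate_vars k v x)"
proof -
  have nz: "mutate_vars k v x i \<noteq> 0" for i using mutate_vars_nonzero[OF x] .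
  have "f = 0" if f: "leval (mutate_vars k v x) f = 0" for f
  proof -
    obtain N h where h: "leval x (exch v) ^ N * leval (mutate_vars k v x) f = leval x h"
      "\<And>r. r + int N < 0 \<Longrightarrow> gpart (coord k) r f = 0"
      "\<And>r. gpart (coord k) (- r) h
           = mon (Poly_Mapping.single k (- 2 * r)) * exch v ^ nat (r + int N) * gpart (coord k) r f"
      using mutate_vars_clear_denominators[OF x v] by metis
    have "h = 0" using h(1) f free_varsD(3)[OF x, of h] by simp
    then have "gpart (coord k) r f = 0" for r using h(3)[of r] by simp
    then show ?thesis by (rule gpart_eq_0_all)
  qed
  then have "inj (leval (mutate_vars k v x))"
    by (intro injI) (metis leval_diff right_minus_eq)
  with nz show ?thesis by (simp add: free_vars_def)
qed

text \<open>Since x_k = P / x_k', only negative powers of x_k create denominators: the component of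
  degree -r acquires P^r below, which must divide out. All later membership questions go through
  this criterion.\<close>

lemma in_mutate_range_iff:
  assumes x: "free_vars x" and v: "Poly_Mapping.lookup v k = 0"
  shows "leval x f \<in> range (leval (mutate_vars k v x)) \<longleftrightarrow>
         (\<forall>r. exch v ^ r dvd gpart (coord k) (- int r) f)"
proof
  let ?x' = "mutate_vars k v x"
  assume "leval x f \<in> range (leval ?x')"
  then obtain f' where f': "leval x f = leval ?x' f'" by blast
  obtain N h where h: "leval x (exch v) ^ N * leval ?x' f' = leval x h"
    "\<And>r. gpart (coord k) (- r) h
         = mon (Poly_Mapping.single k (- 2 * r)) * exch v ^ nat (r + int N) * gpart (coord k) r f'"
    using mutate_vars_clear_denominators[OF x v] by metis
  have "leval x (exch v ^ N * f) = leval x h"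
    using h(1) f' by (simp add: leval_mult leval_power free_varsD[OF x])
  then have eq: "exch v ^ N * f = h" using free_varsD(2)[OF x] by blast
  show "\<forall>r. exch v ^ r dvd gpart (coord k) (- int r) f"
  proof
    fix r
    have "homogeneous (coord k) 0 (exch v ^ N)"
      by (intro homogeneous_power_zero homogeneous_exch v)
    then have "exch v ^ N * gpart (coord k) (- int r) f = gpart (coord k) (- int r) h"
      by (simp add: gpart_homogeneous_mult flip: eq)
    also have "\<dots> = exch v ^ N * (exch v ^ r *
        (mon (Poly_Mapping.single k (- 2 * int r)) * gpart (coord k) (int r) f'))"
      unfolding h(2) by (simp add: power_add nat_add_distrib ac_simps)
    finally show "exch v ^ r dvd gpart (coord k) (- int r) f" by simp
  qed
next
  let ?x' = "mutate_vars k v x"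
  assume dvd: "\<forall>r. exch v ^ r dvd gpart (coord k) (- int r) f"
  have x': "free_vars ?x'" by (rule free_vars_mutate[OF x v])
  have P: "leval x (exch v) \<noteq> 0" and xk: "x k \<noteq> 0" using x by (simp_all add: free_varsD)
  have "\<exists>h. leval x (gpart (coord k) r f) = leval ?x' h" for r
  proof (cases "r \<le> 0")
    case True
    define s where "s = nat (- r)"
    have r: "r = - int s" using True by (simp add: s_def)
    obtain g where g: "gpart (coord k) r f = exch v ^ s * g" using dvd r by auto
    \<comment> \<open>The quotient g need not be homogeneous, but its component of degree r is a
      quotient as well.\<close>
    define g' where "g' = gpart (coord k) r g"
    have hom: "homogeneous (coord k) 0 (exch v ^ s)"
      by (intro homogeneous_power_zero homogeneous_exch v)
    have "gpart (coord k) r f = gpart (coord k) r (gpart (coord k) r f)"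
      using homogeneous_gpart homogeneous_iff_gpart by metis
    also have "\<dots> = exch v ^ s * g'"
      unfolding g g'_def gpart_homogeneous_mult[OF hom] by simp
    finally have eq: "gpart (coord k) r f = exch v ^ s * g'" .
    have hg: "homogeneous (coord k) r g'" by (simp add: g'_def homogeneous_gpart)
    have "leval x (exch v) ^ s * leval ?x' g' = leval x (mon (Poly_Mapping.single k (- 2 * r)) * g')"
      using leval_mutate_clear[OF x hg, of s v] r by simp
    also have "\<dots> = x k ^ (2 * s) * leval x g'"
      using r by (simp add: leval_mult free_varsD[OF x] flip: power_int_of_nat)
    finally have 1: "leval x (exch v) ^ s * leval ?x' g' = x k ^ (2 * s) * leval x g'" .
    have "leval ?x' (mon (Poly_Mapping.single k (2 * int s)) * g')
        = ?x' k ^ (2 * s) * leval ?x' g'"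
      by (simp add: leval_mult free_varsD[OF x'] flip: power_int_of_nat)
    also have "\<dots> = leval x (exch v) ^ s / x k ^ (2 * s) * (leval x (exch v) ^ s * leval ?x' g')"
      by (simp add: mutate_vars_def power_divide mult_2 power_add)
    also have "\<dots> = leval x (exch v) ^ s * leval x g'"
      unfolding 1 using xk by simp
    also have "\<dots> = leval x (gpart (coord k) r f)"
      unfolding eq by (simp add: leval_mult leval_power free_varsD[OF x])
    finally show ?thesis by metis
  next
    case False
    define s where "s = nat r"
    have r: "r = int s" using False by (simp add: s_def)
    let ?g = "gpart (coord k) r f"
    \<comment> \<open>Renaming x_k to x_k' turns a factor x_k^r into x_k'^r, whereas its true value
      is P^r x_k'^(-r); the correcting factor is P^r x_k'^(-2r).\<close>
    let ?h = "mon (Poly_Mapping.single k (- 2 * r)) * exch v ^ s * ?g"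
    have Px: "leval ?x' (exch v) = leval x (exch v)"
      unfolding mutate_vars_def by (rule leval_update_free[OF homogeneous_exch[OF v]])
    have "leval ?x' ?g = leval x ?g * (leval x (exch v) / (x k)\<^sup>2) ^ s"
      using leval_mutate_homogeneous[OF x homogeneous_gpart] r by simp
    moreover have "?x' k powi (- 2 * r) = inverse (?x' k ^ (2 * s))"
      using r by (metis mult_minus_left of_nat_mult of_nat_numeral power_int_minus power_int_of_nat)
    ultimately have "leval ?x' ?h
       = inverse (?x' k ^ (2 * s)) * leval x (exch v) ^ s * (leval x ?g * (leval x (exch v) / (x k)\<^sup>2) ^ s)"
      using Px by (simp add: leval_mult leval_power free_varsD[OF x'])
    also have "\<dots> = leval x ?g"
      using P xk by (simp add: mutate_vars_def power_divide field_simps flip: power_mult power_add)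
        (simp add: mult_2_right power_add)
    finally show ?thesis by metis
  qed
  then obtain H where H: "\<And>r. leval x (gpart (coord k) r f) = leval ?x' (H r)" by metis
  have "leval x f = (\<Sum>r\<in>weight (coord k) ` Poly_Mapping.keys f. leval x (gpart (coord k) r f))"
    by (subst sum_gpart[of "weight (coord k) ` Poly_Mapping.keys f" "coord k" f])
       (auto simp: leval_sum)
  also have "\<dots> = leval ?x' (\<Sum>r\<in>weight (coord k) ` Poly_Mapping.keys f. H r)"
    by (simp add: H leval_sum)
  finally show "leval x f \<in> range (leval ?x')" by blast
qed

lemma mutate_vars_involutive:
  assumes x: "free_vars x" and v: "Poly_Mapping.lookup v k = 0"
  shows "mutate_vars k (- v) (mutate_vars k v x) = x"
proof -
  have "leval (mutate_vars k v x) (exch v) = leval x (exch v)"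
    unfolding mutate_vars_def by (rule leval_update_free[OF homogeneous_exch[OF v]])
  then show ?thesis
    using x by (auto simp: mutate_vars_def[of k "-v"] fun_eq_iff) (auto simp: mutate_vars_def free_varsD)
qed

section \<open>Subrings\<close>

context
  fixes W :: "'a::field set"
  assumes W: "is_subring W"
begin

lemma subring_one: "1 \<in> W" and subring_diff: "a \<in> W \<Longrightarrow> b \<in> W \<Longrightarrow> a - b \<in> W"
  and subring_mult: "a \<in> W \<Longrightarrow> b \<in> W \<Longrightarrow> a * b \<in> W"
  using W by (auto simp: is_subring_def)

lemma subring_zero: "0 \<in> W"
  using subring_diff[OF subring_one subring_one] by simp

lemma subring_uminus: "a \<in> W \<Longrightarrow> - a \<in> W"
  using subring_diff[OF subring_zero, of a] by simp

lemma subring_add: "a \<in> W \<Longrightarrow> b \<in> W \<Longrightarrow> a + b \<in> W"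
  using subring_diff[of a "- b"] subring_uminus[of b] by simp

lemma subring_sum: "(\<And>i. i \<in> I \<Longrightarrow> F i \<in> W) \<Longrightarrow> sum F I \<in> W"
  by (induction I rule: infinite_finite_induct) (auto simp: subring_zero subring_add)

lemma subring_prod: "(\<And>i. i \<in> I \<Longrightarrow> F i \<in> W) \<Longrightarrow> prod F I \<in> W"
  by (induction I rule: infinite_finite_induct) (auto simp: subring_one subring_mult)

lemma subring_power: "a \<in> W \<Longrightarrow> a ^ r \<in> W"
  by (induction r) (auto simp: subring_one subring_mult)

lemma subring_of_nat: "of_nat r \<in> W"
  by (induction r) (auto simp: subring_zero subring_one subring_add)

lemma subring_of_int: "of_int r \<in> W"
  by (cases r rule: int_cases2) (auto intro: subring_of_nat subring_uminus)

lemma subring_meval: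
  assumes "\<And>i. Poly_Mapping.lookup u i > 0 \<Longrightarrow> x i \<in> W"
    and "\<And>i. Poly_Mapping.lookup u i < 0 \<Longrightarrow> inverse (x i) \<in> W"
  shows "meval x u \<in> W"
  unfolding meval_def
proof (intro subring_prod)
  fix i
  consider "Poly_Mapping.lookup u i > 0" | "Poly_Mapping.lookup u i < 0" | "Poly_Mapping.lookup u i = 0"
    by linarith
  then show "x i powi Poly_Mapping.lookup u i \<in> W"
    by cases (auto simp: power_int_def subring_one intro!: subring_power assms)
qed

lemma subring_leval:
  assumes "\<And>u. u \<in> Poly_Mapping.keys f \<Longrightarrow> meval x u \<in> W"
  shows "leval x f \<in> W"
  unfolding leval_def by (intro subring_sum subring_mult subring_of_int assms)

text \<open>Localization at the powers of p, realized inside the ambient field; used to reach a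
  Laurent ring up to denominators that are cancelled afterwards.\<close>

lemma subring_localization: "is_subring {y. \<exists>N. p ^ N * y \<in> W}" if p: "p \<in> W"
  unfolding is_subring_def
proof (intro conjI ballI)
  show "1 \<in> {y. \<exists>N. p ^ N * y \<in> W}" by (auto intro!: exI[of _ 0] simp: subring_one)
  fix a b
  assume "a \<in> {y. \<exists>N. p ^ N * y \<in> W}" "b \<in> {y. \<exists>N. p ^ N * y \<in> W}"
  then obtain M N where M: "p ^ M * a \<in> W" and N: "p ^ N * b \<in> W" by auto
  have "p ^ (M + N) * (a - b) = p ^ N * (p ^ M * a) - p ^ M * (p ^ N * b)"
    by (simp add: power_add algebra_simps)
  moreover have "\<dots> \<in> W" by (intro subring_diff subring_mult subring_power M N p)
  ultimately show "a - b \<in> {y. \<exists>N. p ^ N * y \<in> W}" by (metis mem_Collect_eq)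
  have "p ^ (M + N) * (a * b) = (p ^ M * a) * (p ^ N * b)"
    by (simp add: power_add algebra_simps)
  moreover have "\<dots> \<in> W" by (intro subring_mult M N)
  ultimately show "a * b \<in> {y. \<exists>N. p ^ N * y \<in> W}" by (metis mem_Collect_eq)
qed

end

lemma is_subring_range_leval:
  assumes "\<And>i. x i \<noteq> 0"
  shows "is_subring (range (leval x))"
  unfolding is_subring_def
proof (intro conjI ballI)
  show "1 \<in> range (leval x)" by (metis leval_one rangeI)
  fix a b
  assume "a \<in> range (leval x)" "b \<in> range (leval x)"
  then obtain f h where "a = leval x f" "b = leval x h" by blast
  then have "a - b = leval x (f - h)" "a * b = leval x (f * h)"
    by (simp_all add: leval_mult assms)
  then show "a - b \<in> range (leval x)" "a * b \<in> range (leval x)" by blast+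
qed

lemma meval_in_range: "meval x u \<in> range (leval x)"
  by (rule range_eqI[of _ _ "mon u"]) simp

lemma var_in_range: "x i \<in> range (leval x)"
  using meval_in_range[of x "basis_vec i"] by simp

lemma inverse_var_in_range: "inverse (x i) \<in> range (leval x)"
  using meval_in_range[of x "Poly_Mapping.single i (-1)"] by (simp add: power_int_minus)

section \<open>Upper bounds in rank two\<close>

text \<open>Matrix mutation on one column v, with w the column of direction k. The last term
  reverses the sign of the entry at k, given that w is zero there.\<close>

definition mutate_col :: "nat \<Rightarrow> (nat \<Rightarrow>\<^sub>0 int) \<Rightarrow> (nat \<Rightarrow>\<^sub>0 int) \<Rightarrow> nat \<Rightarrow>\<^sub>0 int" where
  "mutate_col k w v = v + frag_cmul (max (Poly_Mapping.lookup v k) 0) (pos_vec w)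
     - frag_cmul (max (- Poly_Mapping.lookup v k) 0) (pos_vec (- w))
     - Poly_Mapping.single k (2 * Poly_Mapping.lookup v k)"

lemma lookup_mutate_col:
  "Poly_Mapping.lookup (mutate_col k w v) i =
     Poly_Mapping.lookup v i + max (Poly_Mapping.lookup v k) 0 * max (Poly_Mapping.lookup w i) 0
     - max (- Poly_Mapping.lookup v k) 0 * max (- Poly_Mapping.lookup w i) 0
     - (if i = k then 2 * Poly_Mapping.lookup v k else 0)"
  by (simp add: mutate_col_def lookup_add lookup_minus lookup_single when_def)

lemma mutate_col_uminus: "mutate_col k (- w) (- v) = - mutate_col k w v"
  by (rule poly_mapping_eqI) (simp add: lookup_mutate_col)

text \<open>
  If \<open>v\<close> involves \<open>x\<^sub>k\<close>, substituting \<open>x\<^sub>k = p / x\<^sub>k'\<close> in the exchange relation for \<open>x\<^sub>j\<close> and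
  reducing modulo \<open>x\<^sub>j\<close> gives the exchange relation for \<open>x\<^sub>j\<close> after mutation at \<open>k\<close>, because
  \<open>p\<close> is a monomial modulo \<open>x\<^sub>j\<close>.
\<close>

lemma adjacent_mutation_mem_pos:
  fixes x :: "nat \<Rightarrow> 'a::field"
  assumes x: "free_vars x" and jk: "j \<noteq> k"
    and v: "Poly_Mapping.lookup v j = 0" and w: "Poly_Mapping.lookup w k = 0"
    and vk: "Poly_Mapping.lookup v k > 0" and wj: "Poly_Mapping.lookup w j < 0"
    and x1: "x1 = mutate_vars k w x" and x2: "x2 = mutate_vars j (mutate_col k w v) x1"
    and W: "is_subring W"
    and mem: "\<And>i. x2 i \<in> W" "\<And>i. i \<noteq> j \<Longrightarrow> inverse (x2 i) \<in> W" "x j \<in> W"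
  shows "mutate_vars j v x j \<in> W"
proof -
  note ring = subring_add[OF W] subring_mult[OF W] subring_power[OF W] subring_sum[OF W]
  have nz: "x i \<noteq> 0" "x1 i \<noteq> 0" for i
    using free_varsD[OF x] free_varsD[OF free_vars_mutate[OF x w]] by (simp_all add: x1)
  have x2_eq: "x2 i = x1 i" if "i \<noteq> j" for i using that by (simp add: x2 mutate_vars_def)
  have x1_eq: "x1 i = x i" if "i \<noteq> k" for i using that by (simp add: x1 mutate_vars_def)
  define b where "b = nat (Poly_Mapping.lookup v k)"
  have b: "Poly_Mapping.lookup v k = int b" "b > 0" using vk by (auto simp: b_def)
  have unit1: "meval x1 u \<in> W" if "Poly_Mapping.lookup u j = 0" for u
  proof (rule subring_meval[OF W])
    fix i
    show "x1 i \<in> W" if "Poly_Mapping.lookup u i > 0"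
      using that \<open>Poly_Mapping.lookup u j = 0\<close> mem(1)[of i] x2_eq[of i] by (cases "i = j") auto
    show "inverse (x1 i) \<in> W" if "Poly_Mapping.lookup u i < 0"
      using that \<open>Poly_Mapping.lookup u j = 0\<close> mem(2)[of i] x2_eq[of i] by (cases "i = j") auto
  qed
  have nonneg: "meval x u \<in> W" if "Poly_Mapping.lookup u k = 0" "Poly_Mapping.lookup u j \<ge> 0" for u
  proof (rule subring_meval[OF W])
    fix i
    show "x i \<in> W" if "Poly_Mapping.lookup u i > 0"
      using that \<open>Poly_Mapping.lookup u k = 0\<close> mem(1)[of i] mem(3) x2_eq[of i] x1_eq[of i]
      by (cases "i = j"; cases "i = k") auto
    show "inverse (x i) \<in> W" if "Poly_Mapping.lookup u i < 0"
      using that \<open>Poly_Mapping.lookup u k = 0\<close> \<open>Poly_Mapping.lookup u j \<ge> 0\<close>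
        mem(2)[of i] x2_eq[of i] x1_eq[of i]
      by (cases "i = j"; cases "i = k") auto
  qed
  have free1: "meval x1 u = meval x u" if "Poly_Mapping.lookup u k = 0" for u
    by (rule meval_cong, rule x1_eq) (use that in \<open>auto simp: in_keys_iff\<close>)
  \<comment> \<open>The positive exchange monomial splits as x_k^b times a part free of x_k.\<close>
  define u where "u = pos_vec v - Poly_Mapping.single k (int b)"
  define q where "q = pos_vec (- v)"
  define s where "s = meval x (pos_vec w)"
  \<comment> \<open>Since w is negative at j, the second monomial of p contains x_j; dividing one
    x_j out gives p = s + x_j \<rho>.\<close>
  define \<rho> where "\<rho> = meval x (pos_vec (- w) - basis_vec j)"
  have u: "Poly_Mapping.lookup u k = 0" "Poly_Mapping.lookup u j = 0"
    using jk v b by (auto simp: u_def lookup_minus lookup_single when_def)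
  have q: "Poly_Mapping.lookup q k = 0" "Poly_Mapping.lookup q j = 0"
    using v b by (auto simp: q_def)
  have sW: "s \<in> W" unfolding s_def by (rule nonneg) (use w in auto)
  have \<rho>W: "\<rho> \<in> W" unfolding \<rho>_def
    by (rule nonneg) (use w wj jk in \<open>auto simp: lookup_minus lookup_single when_def\<close>)
  define p where "p = leval x (exch w)"
  have "pos_vec (- w) = (pos_vec (- w) - basis_vec j) + basis_vec j" by simp
  then have "meval x (pos_vec (- w)) = \<rho> * x j"
    unfolding \<rho>_def using meval_add[of x "pos_vec (- w) - basis_vec j" "basis_vec j"] nz by simp
  then have p: "p = s + x j * \<rho>" by (simp add: p_def exch_def s_def)
  have pW: "p \<in> W" unfolding p by (intro ring sW \<rho>W mem)
  \<comment> \<open>Powers of p agree with powers of the monomial s modulo x_j, with remainder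
    inside W.\<close>
  have "\<exists>\<tau>\<in>W. p ^ r = s ^ r + x j * \<tau>" for r
  proof (induction r)
    case 0
    then show ?case using subring_zero[OF W] by auto
  next
    case (Suc r)
    then obtain \<tau> where \<tau>: "\<tau> \<in> W" "p ^ r = s ^ r + x j * \<tau>" by blast
    have "p ^ Suc r = s * p ^ r + x j * (\<rho> * p ^ r)" by (simp add: p algebra_simps)
    also have "s * p ^ r = s * (s ^ r + x j * \<tau>)" by (simp only: \<tau>(2))
    finally have "p ^ Suc r = s ^ Suc r + x j * (s * \<tau> + \<rho> * p ^ r)"
      by (simp only: power_Suc distrib_left ac_simps)
    moreover have "s * \<tau> + \<rho> * p ^ r \<in> W" by (intro ring sW \<rho>W pW \<tau>)
    ultimately show ?case by blast
  qed
  then obtain \<tau> where \<tau>: "\<tau> \<in> W" "p ^ b = s ^ b + x j * \<tau>" by blast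
  have x1k: "x k = p / x1 k"
    using nz[of k] leval_exch_neq_0[OF x, of w] by (simp add: x1 mutate_vars_def p_def)
  define v1 where "v1 = mutate_col k w v"
  have v1: "v1 = u - q + frag_cmul (int b) (pos_vec w) - Poly_Mapping.single k (int b)"
  proof (rule poly_mapping_eqI)
    fix i
    show "Poly_Mapping.lookup v1 i
        = Poly_Mapping.lookup (u - q + frag_cmul (int b) (pos_vec w) - Poly_Mapping.single k (int b)) i"
      unfolding v1_def lookup_mutate_col u_def q_def lookup_add lookup_minus lookup_frag_cmul
        lookup_pos_vec lookup_uminus lookup_single when_def
      using b w by (auto simp: max_def)
  qed
  have v1j: "Poly_Mapping.lookup v1 j = 0"
    using v wj b by (simp add: v1_def lookup_mutate_col jk)
  have frag: "meval x1 (frag_cmul (int b) (pos_vec w)) = s ^ b"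
  proof -
    have "meval x1 (frag_cmul (int r) (pos_vec w)) = s ^ r" for r
      by (induction r)
         (use w free1[of "pos_vec w"] in \<open>auto simp: frag_cmul_distrib meval_add nz s_def\<close>)
    then show ?thesis .
  qed
  have m1: "meval x1 v1 = meval x1 u / meval x1 q * s ^ b / x1 k ^ b"
    unfolding v1 by (simp add: meval_add meval_diff nz frag)
  have x2j: "x2 j = meval x1 (pos_vec (- v1)) * (1 + meval x1 v1) / x j"
    using jk unfolding x2 mutate_vars_def v1_def[symmetric]
    by (simp add: exch_factor leval_mult nz x1_eq)
  have "meval x (pos_vec v) = meval x u * x k ^ b"
  proof -
    have "pos_vec v = u + Poly_Mapping.single k (int b)" by (simp add: u_def)
    then show ?thesis by (simp add: meval_add nz)
  qed
  then have "mutate_vars j v x j = (meval x1 u * x k ^ b + meval x1 q) / x j"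
    using u q by (simp add: mutate_vars_def exch_def q_def free1)
  also have "x k ^ b = (s ^ b + x j * \<tau>) / x1 k ^ b"
    unfolding x1k by (simp add: power_divide \<tau>(2))
  \<comment> \<open>The part with s^b is the exchange polynomial of j after mutation at k, up to a
    unit, so over x_j it gives \<open>x2 j\<close>; in the remainder x_j cancels.\<close>
  also have "(meval x1 u * ((s ^ b + x j * \<tau>) / x1 k ^ b) + meval x1 q) / x j
      = meval x1 q * (1 + meval x1 v1) / x j + meval x1 u * inverse (x1 k) ^ b * \<tau>"
    unfolding m1 using nz meval_nonzero[OF nz(2)] by (simp add: field_simps)
  also have "meval x1 q * (1 + meval x1 v1) / x j
      = meval x1 q * meval x1 (- pos_vec (- v1)) * x2 j"
    unfolding x2j using meval_nonzero[OF nz(2)] by (simp add: meval_uminus)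
  finally have "mutate_vars j v x j = meval x1 q * meval x1 (- pos_vec (- v1)) * x2 j
      + meval x1 u * inverse (x1 k) ^ b * \<tau>" .
  moreover have "inverse (x1 k) \<in> W" using mem(2)[of k] jk x2_eq[of k] by simp
  ultimately show ?thesis
    using u q v1j by (auto intro!: ring unit1 mem \<tau>)
qed

text \<open>If both entries vanish, the mutations commute. Otherwise the signs are opposite, and
  negating both columns, which leaves the exchange polynomials unchanged, reduces one sign pattern
  to the other.\<close>

lemma adjacent_mutation_mem:
  fixes x :: "nat \<Rightarrow> 'a::field"
  assumes x: "free_vars x" and jk: "j \<noteq> k"
    and v: "Poly_Mapping.lookup v j = 0" and w: "Poly_Mapping.lookup w k = 0"
    and sign: "Poly_Mapping.lookup v k = 0 \<and> Poly_Mapping.lookup w j = 0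
       \<or> Poly_Mapping.lookup v k * Poly_Mapping.lookup w j < 0"
    and x1: "x1 = mutate_vars k w x" and x2: "x2 = mutate_vars j (mutate_col k w v) x1"
    and W: "is_subring W"
    and mem: "\<And>i. x2 i \<in> W" "\<And>i. i \<noteq> j \<Longrightarrow> inverse (x2 i) \<in> W" "x j \<in> W"
  shows "mutate_vars j v x j \<in> W"
proof -
  consider "Poly_Mapping.lookup v k = 0" "Poly_Mapping.lookup w j = 0"
    | "Poly_Mapping.lookup v k > 0" "Poly_Mapping.lookup w j < 0"
    | "Poly_Mapping.lookup v k < 0" "Poly_Mapping.lookup w j > 0"
    using sign by (auto simp: mult_less_0_iff)
  then show ?thesis
  proof cases
    case 1
    have "mutate_col k w v = v" by (rule poly_mapping_eqI) (simp add: 1 lookup_mutate_col)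
    moreover have "leval x1 (exch v) = leval x (exch v)"
      unfolding x1 mutate_vars_def[of k] by (rule leval_update_free[OF homogeneous_exch[OF 1(1)]])
    ultimately have "mutate_vars j v x j = x2 j"
      using jk by (simp add: x2 mutate_vars_def) (simp add: x1 mutate_vars_def)
    then show ?thesis using mem by simp
  next
    case 2
    then show ?thesis by (rule adjacent_mutation_mem_pos[OF x jk v w _ _ x1 x2 W mem])
  next
    case 3
    have "mutate_vars j (- v) x j \<in> W"
    proof (rule adjacent_mutation_mem_pos[OF x jk _ _ _ _ _ _ W mem])
      show "x1 = mutate_vars k (- w) x" by (simp add: x1 mutate_vars_def)
      show "x2 = mutate_vars j (mutate_col k (- w) (- v)) x1"
        by (simp add: x2 mutate_col_uminus mutate_vars_def)
    qed (use 3 v w in auto)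
    then show ?thesis by (simp add: mutate_vars_def)
  qed
qed

text \<open>As w involves x_j, its exchange polynomial is a monomial free of x_j plus one of
  positive degree in x_j. The lowest part is thus a unit, and the degree in x_j serves as the
  grading for cancellation.\<close>

lemma dvd_gparts_exch_cancel:
  assumes w: "Poly_Mapping.lookup w j \<noteq> 0"
    and dvd: "\<And>r. q ^ r dvd gpart (coord j) (- int r) (exch w * f)"
  shows "q ^ r dvd gpart (coord j) (- int r) f"
proof -
  obtain w' where w': "exch w = exch w'" "Poly_Mapping.lookup w' j < 0"
  proof (cases "Poly_Mapping.lookup w j < 0")
    case True
    then show ?thesis using that by blast
  next
    case False
    then show ?thesis using that[of "- w"] w by simp
  qed
  \<comment> \<open>Using \<open>nat (- r)\<close> imposes the divisor 1 in nonnegative degrees, so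
    the induction can run over all integers.\<close>
  have "q ^ nat (- r) dvd gpart (coord j) r f" for r
  proof (rule dvd_gparts_cancel[where D = "\<lambda>r. q ^ nat (- r)" and e = "mon (pos_vec w')"
        and m = "mon (pos_vec (- w'))" and c = "- Poly_Mapping.lookup w' j"])
    fix r
    show "q ^ nat (- r) dvd gpart (coord j) r ((mon (pos_vec w') + mon (pos_vec (- w'))) * f)"
      unfolding exch_def[of w', symmetric] w'(1)[symmetric]
      using dvd[of "nat (- r)"] by (cases "r \<le> 0") auto
  qed (use w' in \<open>auto simp: homogeneous_def dvd_mon_mult intro!: le_imp_power_dvd\<close>)
  from this[of "- int r"] show ?thesis by simp
qed

text \<open>Being Laurent in x and in its j-neighbour places y in the target ring after inverting
  the exchange polynomial p of direction k. Being Laurent in the k-neighbour lets the powers of p be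
  cancelled.\<close>

lemma rank_two_mutation:
  fixes x :: "nat \<Rightarrow> 'a::field"
  assumes x: "free_vars x" and jk: "j \<noteq> k"
    and v: "Poly_Mapping.lookup v j = 0" and w: "Poly_Mapping.lookup w k = 0"
    and sign: "Poly_Mapping.lookup v k = 0 \<and> Poly_Mapping.lookup w j = 0
       \<or> Poly_Mapping.lookup v k * Poly_Mapping.lookup w j < 0"
    and g: "weight g v = 0" "weight g w > 0"
    and y: "y \<in> range (leval x)" "y \<in> range (leval (mutate_vars j v x))"
      "y \<in> range (leval (mutate_vars k w x))"
  shows "y \<in> range (leval (mutate_vars j (mutate_col k w v) (mutate_vars k w x)))"
proof -
  define x1 where "x1 = mutate_vars k w x"
  define v1 where "v1 = mutate_col k w v"
  define x2 where "x2 = mutate_vars j v1 x1"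
  define W where "W = range (leval x2)"
  define p where "p = leval x (exch w)"
  have v1j: "Poly_Mapping.lookup v1 j = 0"
    using v sign jk by (auto simp: v1_def lookup_mutate_col max_def mult_less_0_iff)
  have x1: "free_vars x1" unfolding x1_def by (rule free_vars_mutate[OF x w])
  have x2: "free_vars x2" unfolding x2_def by (rule free_vars_mutate[OF x1 v1j])
  note nz = free_varsD(1)[OF x] free_varsD(1)[OF x1] free_varsD(1)[OF x2]
  have W: "is_subring W" unfolding W_def by (rule is_subring_range_leval) (rule nz)
  note ring = subring_add[OF W] subring_mult[OF W] subring_power[OF W]
  have x2W: "x2 i \<in> W" "inverse (x2 i) \<in> W" for i
    unfolding W_def by (rule var_in_range inverse_var_in_range)+
  have x2_eq: "x2 i = x1 i" if "i \<noteq> j" for i using that by (simp add: x2_def mutate_vars_def)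
  have x1_eq: "x1 i = x i" if "i \<noteq> k" for i using that by (simp add: x1_def mutate_vars_def)
  have "x j = leval x2 (exch v1) * inverse (x2 j)"
  proof -
    have "leval x2 (exch v1) = leval x1 (exch v1)"
      unfolding x2_def mutate_vars_def by (rule leval_update_free[OF homogeneous_exch[OF v1j]])
    then show ?thesis
      using nz(3)[of j] leval_exch_neq_0[OF x1, of v1] jk
      by (simp add: x2_def mutate_vars_def x1_eq divide_simps)
  qed
  then have xj: "x j \<in> W" using ring(2)[OF _ x2W(2)] by (simp add: W_def)
  have xW: "x i \<in> W" if "i \<noteq> k" for i
    using that xj x2W(1)[of i] x2_eq[of i] x1_eq[of i] by (cases "i = j") auto
  have pW: "p \<in> W"
    unfolding p_def exch_def leval_add leval_single
    by (intro ring subring_of_int[OF W] subring_meval[OF W] xW) (use w in \<open>auto split: if_splits\<close>)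
  \<comment> \<open>Inverting p makes x_k invertible as well; among the old variables only x_j may
    still fail to be a unit.\<close>
  define WL where "WL = {y. \<exists>N. p ^ N * y \<in> W}"
  have WL: "is_subring WL" unfolding WL_def by (rule subring_localization[OF W pW])
  note ringL = subring_add[OF WL] subring_mult[OF WL] subring_power[OF WL] subring_sum[OF WL]
  have W_WL: "a \<in> WL" if "a \<in> W" for a
    using that unfolding WL_def by (auto intro!: exI[of _ 0])
  have x2k: "x2 k = p / x k"
    using jk x2_eq[of k] by (simp add: x1_def mutate_vars_def p_def)
  have xk: "x k = p * inverse (x2 k)" "p * inverse (x k) = x2 k"
    using nz(1)[of k] nz(3)[of k] unfolding x2k by (auto simp: field_simps)
  have x_WL: "x i \<in> WL" for i
  proof (cases "i = k")
    case True
    then show ?thesis using xk(1) ring(2)[OF pW x2W(2)[of k]] by (auto intro: W_WL)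
  qed (auto intro: W_WL xW)
  have inv_WL: "inverse (x i) \<in> WL" if "i \<noteq> j" for i
  proof (cases "i = k")
    case True
    have "p ^ 1 * inverse (x k) \<in> W" using xk(2) x2W(1)[of k] by simp
    then show ?thesis unfolding WL_def True by blast
  next
    case False
    then show ?thesis using that x2W(2)[of i] x2_eq[of i] x1_eq[of i] W_WL by simp
  qed
  have nonneg: "meval x u \<in> WL" if "Poly_Mapping.lookup u j \<ge> 0" for u
  proof (rule subring_meval[OF WL])
    fix i
    show "x i \<in> WL" by (rule x_WL)
    show "inverse (x i) \<in> WL" if "Poly_Mapping.lookup u i < 0"
      by (rule inv_WL) (use that \<open>Poly_Mapping.lookup u j \<ge> 0\<close> in auto)
  qed
  have "mutate_vars j v x j \<in> W"
    by (rule adjacent_mutation_mem[OF x jk v w sign x1_def _ W _ _ xj])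
       (auto simp: x2_def v1_def[symmetric] intro: x2W[unfolded x2_def])
  then have xj': "leval x (exch v) / x j \<in> WL"
    using W_WL by (simp add: mutate_vars_def)
  obtain f where f: "y = leval x f" using y(1) by blast
  have dvd: "exch v ^ r dvd gpart (coord j) (- int r) f" for r
    using y(2) unfolding f in_mutate_range_iff[OF x v] by blast
  have part: "leval x (gpart (coord j) r f) \<in> WL" for r
  proof (cases "r \<ge> 0")
    case True
    then show ?thesis
      by (intro subring_leval[OF WL] nonneg) (simp add: keys_gpart)
  next
    case False
    define s where "s = nat (- r)"
    have r: "r = - int s" using False by (simp add: s_def)
    obtain h where h: "gpart (coord j) r f = exch v ^ s * h" using dvd r by auto
    have hom: "homogeneous (coord j) 0 (exch v ^ s)"
      by (intro homogeneous_power_zero homogeneous_exch v)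
    have "gpart (coord j) r f = gpart (coord j) r (gpart (coord j) r f)"
      using homogeneous_gpart homogeneous_iff_gpart by metis
    also have "\<dots> = exch v ^ s * gpart (coord j) r h"
      unfolding h gpart_homogeneous_mult[OF hom] by simp
    finally have eq: "gpart (coord j) r f = exch v ^ s * gpart (coord j) r h" .
    \<comment> \<open>Multiplying by x_j^s raises the degree -s to 0; the compensating factor is the
      s-th power of the mutated x_j, already in \<open>WL\<close>.\<close>
    have "leval x (mon (Poly_Mapping.single j (int s)) * gpart (coord j) r h) \<in> WL"
    proof (intro subring_leval[OF WL] nonneg)
      fix u
      assume "u \<in> Poly_Mapping.keys (mon (Poly_Mapping.single j (int s)) * gpart (coord j) r h)"
      then have "Poly_Mapping.lookup u j = int s + r"
        using keys_mult[of "mon (Poly_Mapping.single j (int s))" "gpart (coord j) r h"]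
        by (auto simp: keys_gpart lookup_add)
      then show "0 \<le> Poly_Mapping.lookup u j" using r by simp
    qed
    then have "(leval x (exch v) / x j) ^ s
        * leval x (mon (Poly_Mapping.single j (int s)) * gpart (coord j) r h) \<in> WL"
      by (intro ringL xj')
    also have "(leval x (exch v) / x j) ^ s
        * leval x (mon (Poly_Mapping.single j (int s)) * gpart (coord j) r h)
        = leval x (gpart (coord j) r f)"
      unfolding eq by (simp add: leval_mult leval_power nz power_divide)
    finally show ?thesis .
  qed
  have "leval x f = (\<Sum>r\<in>weight (coord j) ` Poly_Mapping.keys f. leval x (gpart (coord j) r f))"
    by (subst sum_gpart[of "weight (coord j) ` Poly_Mapping.keys f" "coord j" f])
       (auto simp: leval_sum)
  then have "y \<in> WL" unfolding f by (simp add: ringL part)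
  then obtain N where N: "p ^ N * y \<in> W" unfolding WL_def by blast
  obtain f1 where f1: "y = leval x1 f1" using y(3) unfolding x1_def by blast
  have p1: "p = leval x1 (exch w)"
    unfolding p_def x1_def mutate_vars_def by (rule leval_update_free[OF homogeneous_exch[OF w], symmetric])
  have W_iff: "leval x1 f \<in> W \<longleftrightarrow> (\<forall>r. exch v1 ^ r dvd gpart (coord j) (- int r) f)" for f
    unfolding W_def x2_def by (rule in_mutate_range_iff[OF x1 v1j])
  have step: "leval x1 f \<in> W" if "p * leval x1 f \<in> W" for f
  proof -
    have "leval x1 (exch w * f) \<in> W" using that by (simp add: p1 leval_mult nz)
    then have d: "exch v1 ^ r dvd gpart (coord j) (- int r) (exch w * f)" for r
      unfolding W_iff by blast
    \<comment> \<open>If w involves x_j, the degree in x_j separates the exchange polynomials; if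
      not, the directions commute and the grading g separates them.\<close>
    show ?thesis
    proof (cases "Poly_Mapping.lookup w j = 0")
      case False
      then show ?thesis unfolding W_iff using dvd_gparts_exch_cancel[OF _ d] by blast
    next
      case True
      then have "Poly_Mapping.lookup v k = 0" using sign by simp
      then have "v1 = v" by (intro poly_mapping_eqI) (simp add: v1_def lookup_mutate_col)
      have "exch v ^ r dvd gpart (coord j) (- int r) f" for r
      proof -
        have "exch v ^ r dvd exch w * gpart (coord j) (- int r) f"
          using d[of r] \<open>v1 = v\<close> by (simp add: gpart_homogeneous_mult[OF homogeneous_exch[OF True]])
        then have "(1 + mon v) ^ r dvd (1 + mon w) * gpart (coord j) (- int r) f"
          by (simp add: exch_factor power_mult_distrib mon_power mon_mult_dvd dvd_mon_mult mult.assoc)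
        then have "(1 + mon v) ^ r dvd gpart (coord j) (- int r) f"
          by (rule binomial_cancel[OF g])
        then show ?thesis
          by (simp add: exch_factor power_mult_distrib mon_power mon_mult_dvd)
      qed
      then show ?thesis unfolding W_iff \<open>v1 = v\<close> by blast
    qed
  qed
  have "p ^ N * leval x1 h \<in> W \<Longrightarrow> leval x1 h \<in> W" for h
  proof (induction N arbitrary: h)
    case (Suc N)
    have "p ^ N * leval x1 (exch w * h) \<in> W"
      using Suc.prems by (simp add: leval_mult nz p1 ac_simps)
    then have "leval x1 (exch w * h) \<in> W" by (rule Suc.IH)
    then show ?case by (intro step) (simp add: leval_mult nz p1)
  qed simp
  then have "y \<in> W" using N f1 by blast
  then show ?thesis unfolding W_def x2_def x1_def v1_def .
qed

section \<open>Seeds and the Laurent phenomenon\<close>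

type_synonym 'a col_seed = "(nat \<Rightarrow> 'a) \<times> (nat \<Rightarrow> nat \<Rightarrow>\<^sub>0 int)"

definition mutate_cols :: "nat \<Rightarrow> (nat \<Rightarrow> nat \<Rightarrow>\<^sub>0 int) \<Rightarrow> nat \<Rightarrow> nat \<Rightarrow>\<^sub>0 int" where
  "mutate_cols k b = (\<lambda>j. if j = k then - b k else mutate_col k (b k) (b j))"

definition mutate :: "nat \<Rightarrow> 'a::field col_seed \<Rightarrow> 'a col_seed" where
  "mutate k s = (mutate_vars k (snd s k) (fst s), mutate_cols k (snd s))"

definition sign_skew :: "nat \<Rightarrow> (nat \<Rightarrow> nat \<Rightarrow>\<^sub>0 int) \<Rightarrow> bool" where
  "sign_skew n b \<longleftrightarrow> (\<forall>i<n. \<forall>j<n.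
     (Poly_Mapping.lookup (b j) i = 0 \<and> Poly_Mapping.lookup (b i) j = 0)
     \<or> Poly_Mapping.lookup (b j) i * Poly_Mapping.lookup (b i) j < 0)"

definition totally_sign_skew :: "nat \<Rightarrow> (nat \<Rightarrow> nat \<Rightarrow>\<^sub>0 int) \<Rightarrow> bool" where
  "totally_sign_skew n b \<longleftrightarrow> (\<forall>ks. set ks \<subseteq> {..<n} \<longrightarrow> sign_skew n (fold mutate_cols ks b))"

text \<open>
  Equivalently, the columns extend to a basis of the lattice of exponents; this replaces the
  coprimality of the exchange polynomials.
\<close>

definition unimodular_cols :: "nat \<Rightarrow> (nat \<Rightarrow> nat \<Rightarrow>\<^sub>0 int) \<Rightarrow> bool" where
  "unimodular_cols n b \<longleftrightarrow> (\<forall>d. \<exists>g. \<forall>j<n. weight g (b j) = d j)"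

definition good_seed :: "nat \<Rightarrow> 'a::field col_seed \<Rightarrow> bool" where
  "good_seed n s \<longleftrightarrow> free_vars (fst s) \<and> totally_sign_skew n (snd s) \<and> unimodular_cols n (snd s)"

definition upper_bound :: "nat \<Rightarrow> 'a::field col_seed \<Rightarrow> 'a set" where
  "upper_bound n s = range (leval (fst s)) \<inter>
     (\<Inter>j\<in>{..<n}. range (leval (mutate_vars j (snd s j) (fst s))))"

lemma sign_skew_diag: "sign_skew n b \<Longrightarrow> k < n \<Longrightarrow> Poly_Mapping.lookup (b k) k = 0"
  unfolding sign_skew_def by (metis not_square_less_zero)

lemma totally_sign_skewD: "totally_sign_skew n b \<Longrightarrow> sign_skew n b"
  unfolding totally_sign_skew_def by (metis empty_subsetI fold_simps(1) list.set(1))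

lemma good_seed_diag: "good_seed n s \<Longrightarrow> k < n \<Longrightarrow> Poly_Mapping.lookup (snd s k) k = 0"
  by (auto simp: good_seed_def intro: sign_skew_diag totally_sign_skewD)

lemma totally_sign_skew_mutate:
  "totally_sign_skew n b \<Longrightarrow> k < n \<Longrightarrow> totally_sign_skew n (mutate_cols k b)"
  unfolding totally_sign_skew_def
proof (intro allI impI)
  fix ks
  assume "\<forall>ks. set ks \<subseteq> {..<n} \<longrightarrow> sign_skew n (fold mutate_cols ks b)" "k < n" "set ks \<subseteq> {..<n}"
  then have "sign_skew n (fold mutate_cols (k # ks) b)" by (metis insert_subset lessThan_iff list.set(2))
  then show "sign_skew n (fold mutate_cols ks (mutate_cols k b))" by simp
qed

lemma mutate_cols_involutive:
  assumes "Poly_Mapping.lookup (b k) k = 0"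
  shows "mutate_cols k (mutate_cols k b) = b"
proof (intro ext poly_mapping_eqI)
  fix j i
  show "Poly_Mapping.lookup (mutate_cols k (mutate_cols k b) j) i = Poly_Mapping.lookup (b j) i"
    using assms by (auto simp: mutate_cols_def lookup_mutate_col max_def)
qed

lemma weight_frag_cmul [simp]: "weight g (frag_cmul c v) = c * weight g v"
proof -
  have "weight g (frag_cmul c v) = (\<Sum>i\<in>Poly_Mapping.keys v. g i * Poly_Mapping.lookup (frag_cmul c v) i)"
    by (rule weight_superset) (auto simp: in_keys_iff)
  then show ?thesis by (simp add: weight_def sum_distrib_left ac_simps)
qed

lemma weight_fun_upd: "weight (g(k := c)) v = weight g v + (c - g k) * Poly_Mapping.lookup v k"
proof -
  have "g(k := c) = (\<lambda>i. g i + (c - g k) * coord k i)" by auto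
  then show ?thesis using weight_lin[of g "c - g k" "coord k" v] by simp
qed

text \<open>Mutation transforms functionals by a triangular integer substitution, so a prescription
  for the new columns can be pulled back to one for the old columns.\<close>

lemma unimodular_cols_mutate:
  assumes b: "unimodular_cols n b" and k: "k < n" "Poly_Mapping.lookup (b k) k = 0"
  shows "unimodular_cols n (mutate_cols k b)"
  unfolding unimodular_cols_def
proof
  fix d :: "nat \<Rightarrow> int"
  \<comment> \<open>The functional \<open>g'\<close> below gives mutated column j the weight of the
    old one minus [-b_kj]_+ times d k, and reverses the sign of column k; \<open>d0\<close> undoes
    both.\<close>
  define d0 where "d0 j = (if j = k then - d k else d j + max (- Poly_Mapping.lookup (b j) k) 0 * d k)" for j
  obtain g where g: "\<And>j. j < n \<Longrightarrow> weight g (b j) = d0 j"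
    using spec[OF b[unfolded unimodular_cols_def], of d0] by blast
  \<comment> \<open>The value at k is the weight of one exchange monomial over x_k: the tropical
    exchange rule without the maximum, hence linear in g.\<close>
  define g' where "g' = g(k := - g k + weight g (pos_vec (b k)))"
  have "weight g' (mutate_cols k b j) = d j" if j: "j < n" for j
  proof (cases "j = k")
    case True
    then show ?thesis using g[OF k(1)] k by (simp add: mutate_cols_def g'_def weight_fun_upd d0_def)
  next
    case False
    have "weight g (pos_vec (b k)) - weight g (pos_vec (- b k)) = weight g (b k)"
      by (metis pos_vec_diff weight_diff)
    then have 1: "weight g (pos_vec (b k)) = weight g (pos_vec (- b k)) - d k"
      using g[OF k(1)] by (simp add: d0_def)
    show ?thesis
      using False k g[OF j]
      by (simp add: mutate_cols_def mutate_col_def g'_def weight_fun_upd d0_def 1 max_def algebra_simps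
          split: if_splits)
  qed
  then show "\<exists>g. \<forall>j<n. weight g (mutate_cols k b j) = d j" by blast
qed

lemma good_seed_mutate: "good_seed n s \<Longrightarrow> k < n \<Longrightarrow> good_seed n (mutate k s)"
  using good_seed_diag[of n s k]
  by (simp add: good_seed_def mutate_def free_vars_mutate totally_sign_skew_mutate unimodular_cols_mutate)

lemma good_seed_fold: "good_seed n s \<Longrightarrow> set ks \<subseteq> {..<n} \<Longrightarrow> good_seed n (fold mutate ks s)"
  by (induction ks arbitrary: s) (simp_all add: good_seed_mutate)

lemma mutate_involutive: "good_seed n s \<Longrightarrow> k < n \<Longrightarrow> mutate k (mutate k s) = s"
  using good_seed_diag[of n s k]
  by (simp add: mutate_def mutate_cols_involutive good_seed_def)
     (simp add: mutate_cols_def mutate_vars_involutive)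

lemma mutate_fold_rev:
  "good_seed n s \<Longrightarrow> set ks \<subseteq> {..<n} \<Longrightarrow> fold mutate (rev ks) (fold mutate ks s) = s"
  by (induction ks arbitrary: s) (auto simp: good_seed_mutate mutate_involutive)

text \<open>Direction k leads back to the original cluster. For any other direction the rank two
  statement applies, with g chosen of weight 1 on column k and 0 on the other columns.\<close>

lemma upper_bound_mutate:
  assumes s: "good_seed n s" and k: "k < n" and y: "y \<in> upper_bound n s"
  shows "y \<in> upper_bound n (mutate k s)"
proof -
  let ?x = "fst s" and ?b = "snd s"
  have x: "free_vars ?x" using s by (simp add: good_seed_def)
  have yj: "y \<in> range (leval (mutate_vars j (?b j) ?x))" if "j < n" for j
    using y that by (simp add: upper_bound_def)
  have yx: "y \<in> range (leval ?x)" using y by (simp add: upper_bound_def)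
  have "y \<in> range (leval (mutate_vars j (snd (mutate k s) j) (fst (mutate k s))))" if j: "j < n" for j
  proof (cases "j = k")
    case True
    then show ?thesis
      using yx mutate_vars_involutive[OF x good_seed_diag[OF s k]] by (simp add: mutate_def mutate_cols_def)
  next
    case False
    have "\<forall>d. \<exists>g. \<forall>j<n. weight g (?b j) = d j"
      using s by (simp add: good_seed_def unimodular_cols_def)
    from spec[OF this, of "coord k"] obtain g where g: "\<forall>i<n. weight g (?b i) = coord k i" ..
    have "y \<in> range (leval (mutate_vars j (mutate_col k (?b k) (?b j)) (mutate_vars k (?b k) ?x)))"
    proof (rule rank_two_mutation[where g = g, OF x False _ _ _ _ _ yx yj[OF j] yj[OF k]])
      have "sign_skew n ?b" using s by (simp add: good_seed_def totally_sign_skewD)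
      then show "Poly_Mapping.lookup (?b j) k = 0 \<and> Poly_Mapping.lookup (?b k) j = 0 \<or>
          Poly_Mapping.lookup (?b j) k * Poly_Mapping.lookup (?b k) j < 0"
        using j k by (simp add: sign_skew_def)
    qed (use g j k False good_seed_diag[OF s] in simp_all)
    then show ?thesis using False by (simp add: mutate_def mutate_cols_def)
  qed
  moreover have "y \<in> range (leval (fst (mutate k s)))" using yj[OF k] by (simp add: mutate_def)
  ultimately show ?thesis by (simp add: upper_bound_def)
qed

lemma upper_bound_fold:
  "good_seed n s \<Longrightarrow> set ks \<subseteq> {..<n} \<Longrightarrow> y \<in> upper_bound n s \<Longrightarrow> y \<in> upper_bound n (fold mutate ks s)"
  by (induction ks arbitrary: s) (simp_all add: good_seed_mutate upper_bound_mutate)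

lemma var_in_upper_bound:
  assumes "good_seed n s"
  shows "fst s i \<in> upper_bound n s"
proof -
  have x: "free_vars (fst s)" using assms by (simp add: good_seed_def)
  have "leval (fst s) (mon (basis_vec i)) \<in> range (leval (mutate_vars j (snd s j) (fst s)))" if "j < n" for j
    unfolding in_mutate_range_iff[OF x good_seed_diag[OF assms that]]
    by (auto simp: gpart_single)
  then show ?thesis by (simp add: upper_bound_def var_in_range)
qed

text \<open>A variable lies in the upper bound of its own seed, and the reversed word carries it
  into the upper bound of s.\<close>

theorem laurent_phenomenon:
  assumes "good_seed n s" "set ks \<subseteq> {..<n}"
  shows "fst (fold mutate ks s) i \<in> range (leval (fst s))"
proof -
  have "fst (fold mutate ks s) i \<in> upper_bound n (fold mutate (rev ks) (fold mutate ks s))"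
    using assms by (intro upper_bound_fold var_in_upper_bound good_seed_fold) auto
  then show ?thesis using assms by (simp add: mutate_fold_rev upper_bound_def)
qed

section \<open>Tropical evaluation of subtraction-free Laurent polynomials\<close>

definition nonneg_coeffs :: "laurent \<Rightarrow> bool" where
  "nonneg_coeffs p \<longleftrightarrow> (\<forall>v. Poly_Mapping.lookup p v \<ge> 0)"

text \<open>
  Cluster variables are only known to be quotients of polynomials with nonnegative coefficients;
  positivity of their Laurent expansions is neither available nor needed.
\<close>

definition subtraction_free :: "laurent \<Rightarrow> bool" where
  "subtraction_free f \<longleftrightarrow>
     (\<exists>p q. nonneg_coeffs p \<and> nonneg_coeffs q \<and> p \<noteq> 0 \<and> q \<noteq> 0 \<and> f * q = p)"

text \<open>Meaningful for nonzero f only, as the maximum of the empty set is unspecified.\<close>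

definition top_weight :: "(nat \<Rightarrow> int) \<Rightarrow> laurent \<Rightarrow> int" where
  "top_weight g f = Max (weight g ` Poly_Mapping.keys f)"

text \<open>A relation, since it also asserts that y has a subtraction-free Laurent expansion; over
  free variables the value is unique.\<close>

definition trop_val :: "(nat \<Rightarrow> 'a::field) \<Rightarrow> (nat \<Rightarrow> int) \<Rightarrow> 'a \<Rightarrow> int \<Rightarrow> bool" where
  "trop_val x g y r \<longleftrightarrow> (\<exists>f. leval x f = y \<and> subtraction_free f \<and> top_weight g f = r)"

text \<open>The exchange relation in the max-plus semifield. The columns travel along because later
  steps need the mutated ones.\<close>

definition trop_mutate :: "nat \<Rightarrow> (nat \<Rightarrow> nat \<Rightarrow>\<^sub>0 int) \<times> (nat \<Rightarrow> int) \<Rightarrow>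
    (nat \<Rightarrow> nat \<Rightarrow>\<^sub>0 int) \<times> (nat \<Rightarrow> int)" where
  "trop_mutate k t = (case t of (b, g) \<Rightarrow> (mutate_cols k b,
     g(k := max (weight g (pos_vec (b k))) (weight g (pos_vec (- b k))) - g k)))"

lemma trop_mutate_apply:
  "trop_mutate k (b, g) = (mutate_cols k b,
     g(k := max (weight g (pos_vec (b k))) (weight g (pos_vec (- b k))) - g k))"
  by (simp add: trop_mutate_def)

lemma fst_mutate:
  "fst (mutate k s) i = (if i = k then leval (fst s) (exch (snd s k)) / fst s k else fst s i)"
  by (simp add: mutate_def mutate_vars_def)

section \<open>Nonnegative coefficients and leading weights\<close>

lemma lookup_single_mult:
  "Poly_Mapping.lookup (Poly_Mapping.single v c * q) u = c * Poly_Mapping.lookup q (u - v)"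
  for q :: laurent
proof -
  have "Poly_Mapping.lookup (Poly_Mapping.single v c *
        (\<Sum>w\<in>Poly_Mapping.keys q. Poly_Mapping.single w (Poly_Mapping.lookup q w))) u
      = (\<Sum>w\<in>Poly_Mapping.keys q. if w = u - v then c * Poly_Mapping.lookup q w else 0)"
    unfolding sum_distrib_left lookup_sum
    by (intro sum.cong) (auto simp: mult_single lookup_single when_def algebra_simps)
  also have "\<dots> = c * Poly_Mapping.lookup q (u - v)" by (simp add: in_keys_iff)
  finally show ?thesis by (simp flip: laurent_sum_monomials)
qed

lemma nonneg_coeffs_add: "nonneg_coeffs p \<Longrightarrow> nonneg_coeffs q \<Longrightarrow> nonneg_coeffs (p + q)"
  by (simp add: nonneg_coeffs_def lookup_add)

lemma nonneg_coeffs_mult: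
  assumes "nonneg_coeffs p" "nonneg_coeffs q"
  shows "nonneg_coeffs (p * q)"
proof -
  have "nonneg_coeffs ((\<Sum>w\<in>Poly_Mapping.keys p. Poly_Mapping.single w (Poly_Mapping.lookup p w)) * q)"
    unfolding nonneg_coeffs_def sum_distrib_right lookup_sum
    using assms by (auto intro!: sum_nonneg simp: lookup_single_mult nonneg_coeffs_def)
  then show ?thesis by (simp flip: laurent_sum_monomials)
qed

lemma keys_add_nonneg:
  assumes "nonneg_coeffs p" "nonneg_coeffs q"
  shows "Poly_Mapping.keys (p + q) = Poly_Mapping.keys p \<union> Poly_Mapping.keys q"
proof -
  have "Poly_Mapping.lookup p v + Poly_Mapping.lookup q v \<noteq> 0 \<longleftrightarrow>
      Poly_Mapping.lookup p v \<noteq> 0 \<or> Poly_Mapping.lookup q v \<noteq> 0" for v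
    using assms by (simp add: nonneg_coeffs_def add_nonneg_eq_0_iff)
  then show ?thesis by (auto simp: in_keys_iff lookup_add)
qed

lemma add_nonneg_neq_0:
  "nonneg_coeffs p \<Longrightarrow> nonneg_coeffs q \<Longrightarrow> p \<noteq> 0 \<Longrightarrow> p + q \<noteq> 0"
  by (metis Un_empty keys_add_nonneg keys_eq_empty)

lemma weight_le_top_weight: "v \<in> Poly_Mapping.keys f \<Longrightarrow> weight g v \<le> top_weight g f"
  by (simp add: top_weight_def)

lemma gpart_top_weight_neq_0:
  assumes "f \<noteq> 0"
  shows "gpart g (top_weight g f) f \<noteq> 0"
proof -
  have "top_weight g f \<in> weight g ` Poly_Mapping.keys f"
    unfolding top_weight_def using assms by (intro Max_in) auto
  then have "Poly_Mapping.keys (gpart g (top_weight g f) f) \<noteq> {}" by (auto simp: keys_gpart)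
  then show ?thesis by auto
qed

lemma gpart_above: "top_weight g f < r \<Longrightarrow> gpart g r f = 0"
proof -
  assume "top_weight g f < r"
  then have "Poly_Mapping.keys (gpart g r f) = {}"
    by (auto simp: keys_gpart dest: weight_le_top_weight[of _ f g])
  then show ?thesis by simp
qed

text \<open>The component of degree d + e is the product of the two leading components, nonzero
  because the Laurent ring is a domain.\<close>

lemma top_weight_mult:
  assumes "f \<noteq> 0" "h \<noteq> 0"
  shows "top_weight g (f * h) = top_weight g f + top_weight g h"
proof -
  define d e where "d = top_weight g f" and "e = top_weight g h"
  define R where "R = weight g ` Poly_Mapping.keys f"
  have "gpart g (d + e) (f * h) = (\<Sum>r\<in>insert d R. gpart g (d + e) (gpart g r f * h))"
    by (subst sum_gpart[of "insert d R" g f])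
       (auto simp: R_def sum_distrib_right gpart_sum)
  also have "\<dots> = (\<Sum>r\<in>insert d R. gpart g r f * gpart g (d + e - r) h)"
    by (intro sum.cong refl gpart_homogeneous_mult homogeneous_gpart)
  also have "\<dots> = (\<Sum>r\<in>insert d R. if r = d then gpart g d f * gpart g e h else 0)"
  proof (intro sum.cong refl)
    fix r
    consider "r = d" | "r < d" | "d < r" by linarith
    then show "gpart g r f * gpart g (d + e - r) h = (if r = d then gpart g d f * gpart g e h else 0)"
    proof cases
      case 2
      then have "gpart g (d + e - r) h = 0" by (intro gpart_above) (simp add: e_def)
      then show ?thesis using 2 by simp
    next
      case 3
      then have "gpart g r f = 0" by (intro gpart_above) (simp add: d_def)
      then show ?thesis using 3 by simp
    qed simp
  qed
  also have "\<dots> = gpart g d f * gpart g e h" by (simp add: R_def)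
  finally have "gpart g (d + e) (f * h) \<noteq> 0"
    using gpart_top_weight_neq_0 assms by (simp add: d_def e_def)
  then have "Poly_Mapping.keys (gpart g (d + e) (f * h)) \<noteq> {}" by simp
  then obtain v where "v \<in> Poly_Mapping.keys (f * h)" "weight g v = d + e"
    unfolding keys_gpart by blast
  moreover have "weight g u \<le> d + e" if u: "u \<in> Poly_Mapping.keys (f * h)" for u
  proof -
    obtain a b where "u = a + b" "a \<in> Poly_Mapping.keys f" "b \<in> Poly_Mapping.keys h"
      using u keys_mult[of f h] by blast
    then show ?thesis unfolding d_def e_def by (simp add: add_mono weight_le_top_weight)
  qed
  ultimately show ?thesis
    unfolding top_weight_def[of g "f * h"] d_def[symmetric] e_def[symmetric]
    by (intro Max_eqI) (auto intro!: image_eqI[of _ _ v])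
qed

lemma subtraction_free_neq_0: "subtraction_free f \<Longrightarrow> f \<noteq> 0"
  by (auto simp: subtraction_free_def)

lemma subtraction_free_mult:
  assumes "subtraction_free f" "subtraction_free h"
  shows "subtraction_free (f * h)"
proof -
  obtain p q where 1: "nonneg_coeffs p" "nonneg_coeffs q" "p \<noteq> 0" "q \<noteq> 0" "f * q = p"
    using assms(1) by (auto simp: subtraction_free_def)
  obtain p' q' where 2: "nonneg_coeffs p'" "nonneg_coeffs q'" "p' \<noteq> 0" "q' \<noteq> 0" "h * q' = p'"
    using assms(2) by (auto simp: subtraction_free_def)
  have "f * h * (q * q') = p * p'" unfolding 1(5)[symmetric] 2(5)[symmetric] by (simp add: ac_simps)
  then show ?thesis
    unfolding subtraction_free_def using 1 2
    by (intro exI[of _ "p * p'"] exI[of _ "q * q'"]) (auto intro: nonneg_coeffs_mult)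
qed

text \<open>Over a common denominator both numerators have nonnegative coefficients, so no leading
  term cancels; the weight of the denominator then drops out.\<close>

lemma subtraction_free_add:
  assumes "subtraction_free f" "subtraction_free h"
  shows "subtraction_free (f + h)" "top_weight g (f + h) = max (top_weight g f) (top_weight g h)"
proof -
  obtain p q where 1: "nonneg_coeffs p" "nonneg_coeffs q" "p \<noteq> 0" "q \<noteq> 0" "f * q = p"
    using assms(1) by (auto simp: subtraction_free_def)
  obtain p' q' where 2: "nonneg_coeffs p'" "nonneg_coeffs q'" "p' \<noteq> 0" "q' \<noteq> 0" "h * q' = p'"
    using assms(2) by (auto simp: subtraction_free_def)
  have eq: "(f + h) * (q * q') = p * q' + p' * q"
    unfolding 1(5)[symmetric] 2(5)[symmetric] by (simp add: algebra_simps)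
  have nn: "nonneg_coeffs (p * q')" "nonneg_coeffs (p' * q)" "nonneg_coeffs (q * q')"
    using 1 2 by (auto intro: nonneg_coeffs_mult)
  have nz: "p * q' \<noteq> 0" "p' * q \<noteq> 0" "q * q' \<noteq> 0" using 1 2 by auto
  have sum_nz: "p * q' + p' * q \<noteq> 0" by (rule add_nonneg_neq_0) (use nn nz in auto)
  then show "subtraction_free (f + h)"
    unfolding subtraction_free_def using nn nz eq
    by (intro exI[of _ "p * q' + p' * q"] exI[of _ "q * q'"]) (auto intro: nonneg_coeffs_add)
  then have fh: "f + h \<noteq> 0" by (rule subtraction_free_neq_0)
  have "top_weight g (f + h) + (top_weight g q + top_weight g q') = top_weight g (p * q' + p' * q)"
    unfolding eq[symmetric] using fh 1(4) 2(4) by (simp add: top_weight_mult)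
  also have "\<dots> = max (top_weight g (p * q')) (top_weight g (p' * q))"
    unfolding top_weight_def keys_add_nonneg[OF nn(1,2)] image_Un
    using nz by (intro Max_Un) auto
  also have "top_weight g (p * q') = top_weight g f + top_weight g q + top_weight g q'"
    unfolding 1(5)[symmetric] using 1(4) 2(4) subtraction_free_neq_0[OF assms(1)]
    by (simp add: top_weight_mult)
  also have "top_weight g (p' * q) = top_weight g h + top_weight g q + top_weight g q'"
    unfolding 2(5)[symmetric] using 1(4) 2(4) subtraction_free_neq_0[OF assms(2)]
    by (simp add: top_weight_mult)
  finally show "top_weight g (f + h) = max (top_weight g f) (top_weight g h)" by simp
qed

lemma subtraction_free_cancel:
  assumes "subtraction_free f" "subtraction_free (f * h)"
  shows "subtraction_free h"
proof -
  obtain p q where 1: "nonneg_coeffs p" "nonneg_coeffs q" "p \<noteq> 0" "q \<noteq> 0" "f * q = p"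
    using assms(1) by (auto simp: subtraction_free_def)
  obtain p' q' where 2: "nonneg_coeffs p'" "nonneg_coeffs q'" "p' \<noteq> 0" "q' \<noteq> 0" "f * h * q' = p'"
    using assms(2) by (auto simp: subtraction_free_def)
  have "h * (p * q') = p' * q" unfolding 1(5)[symmetric] 2(5)[symmetric] by (simp add: ac_simps)
  then show ?thesis
    unfolding subtraction_free_def using 1 2
    by (intro exI[of _ "p' * q"] exI[of _ "p * q'"]) (auto intro: nonneg_coeffs_mult)
qed

lemma subtraction_free_mon: "subtraction_free (mon v)" and top_weight_mon: "top_weight g (mon v) = weight g v"
proof -
  have "nonneg_coeffs (mon v)" "nonneg_coeffs 1"
    by (auto simp: nonneg_coeffs_def lookup_single when_def lookup_one)
  then show "subtraction_free (mon v)"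
    unfolding subtraction_free_def by (intro exI[of _ "mon v"] exI[of _ 1]) simp
qed (simp add: top_weight_def)

section \<open>Tropical values of field elements\<close>

lemma trop_val_meval_var: "trop_val x g (meval x v) (weight g v)"
  unfolding trop_val_def by (rule exI[of _ "mon v"]) (simp add: subtraction_free_mon top_weight_mon)

lemma trop_val_one: "trop_val x g 1 0"
  using trop_val_meval_var[of x g 0] by simp

lemma trop_val_var: "trop_val x g (x i) (g i)"
  using trop_val_meval_var[of x g "basis_vec i"] by simp

context
  fixes x :: "nat \<Rightarrow> 'a::field"
  assumes x: "free_vars x"
begin

lemma trop_val_unique: "trop_val x g y r \<Longrightarrow> trop_val x g y r' \<Longrightarrow> r = r'"
  by (auto simp: trop_val_def free_varsD(2)[OF x])

lemma trop_val_mult: "trop_val x g a r \<Longrightarrow> trop_val x g c s \<Longrightarrow> trop_val x g (a * c) (r + s)"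
proof -
  assume "trop_val x g a r" "trop_val x g c s"
  then obtain f h where *: "leval x f = a" "subtraction_free f" "top_weight g f = r"
      "leval x h = c" "subtraction_free h" "top_weight g h = s"
    unfolding trop_val_def by blast
  then show ?thesis
    unfolding trop_val_def
    by (intro exI[of _ "f * h"])
       (simp add: leval_mult free_varsD[OF x] subtraction_free_mult top_weight_mult subtraction_free_neq_0)
qed

lemma trop_val_add: "trop_val x g a r \<Longrightarrow> trop_val x g c s \<Longrightarrow> trop_val x g (a + c) (max r s)"
proof -
  assume "trop_val x g a r" "trop_val x g c s"
  then obtain f h where *: "leval x f = a" "subtraction_free f" "top_weight g f = r"
      "leval x h = c" "subtraction_free h" "top_weight g h = s"
    unfolding trop_val_def by blast
  then show ?thesis
    unfolding trop_val_def by (intro exI[of _ "f + h"]) (simp add: subtraction_free_add)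
qed

text \<open>Division is allowed only when the quotient is known to be a Laurent polynomial; this is
  where the Laurent phenomenon enters tropical evaluation.\<close>

lemma trop_val_cancel:
  assumes "trop_val x g a r" "trop_val x g (a * c) s" "c \<in> range (leval x)"
  shows "trop_val x g c (s - r)"
proof -
  obtain f where f: "leval x f = a" "subtraction_free f" "top_weight g f = r"
    using assms(1) by (auto simp: trop_val_def)
  obtain f' where f': "leval x f' = a * c" "subtraction_free f'" "top_weight g f' = s"
    using assms(2) by (auto simp: trop_val_def)
  obtain h where h: "c = leval x h" using assms(3) by blast
  have "leval x (f * h) = leval x f'" using f f' h by (simp add: leval_mult free_varsD[OF x])
  then have "f * h = f'" using free_varsD(2)[OF x] by blast
  then have "subtraction_free h" using f f' subtraction_free_cancel by blast
  moreover have "top_weight g f' = top_weight g f + top_weight g h"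
    unfolding \<open>f * h = f'\<close>[symmetric]
    by (intro top_weight_mult subtraction_free_neq_0 f(2) \<open>subtraction_free h\<close>)
  ultimately show ?thesis unfolding trop_val_def using h f f' by auto
qed

lemma trop_val_power: "trop_val x g a r \<Longrightarrow> trop_val x g (a ^ N) (int N * r)"
proof (induction N)
  case (Suc N)
  then have "trop_val x g (a * a ^ N) (r + int N * r)" by (intro trop_val_mult)
  then show ?case by (simp add: algebra_simps)
qed (simp add: trop_val_one)

lemma trop_val_prod:
  "finite I \<Longrightarrow> (\<And>i. i \<in> I \<Longrightarrow> trop_val x g (F i) (d i)) \<Longrightarrow> trop_val x g (prod F I) (sum d I)"
  by (induction I rule: finite_induct) (auto simp: trop_val_one trop_val_mult)

lemma trop_val_meval:
  assumes "\<And>i. trop_val x g (y i) (d i)" "\<And>i. Poly_Mapping.lookup u i \<ge> 0"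
  shows "trop_val x g (meval y u) (weight d u)"
  unfolding meval_def weight_def
proof (rule trop_val_prod)
  fix i
  show "trop_val x g (y i powi Poly_Mapping.lookup u i) (d i * Poly_Mapping.lookup u i)"
    using trop_val_power[OF assms(1)[of i], of "nat (Poly_Mapping.lookup u i)"] assms(2)[of i]
    by (simp add: power_int_def mult.commute)
qed simp

end

lemma trop_val_neq_0: "trop_val x g y r \<Longrightarrow> free_vars x \<Longrightarrow> y \<noteq> 0"
  by (auto simp: trop_val_def free_varsD(3) dest: subtraction_free_neq_0)

lemma fst_fold_trop_mutate:
  "fst (fold trop_mutate ks (snd s, g)) = snd (fold mutate ks s)"
proof (induction ks arbitrary: s g)
  case (Cons k ks)
  have eq: "trop_mutate k (snd s, g) = (snd (mutate k s), snd (trop_mutate k (snd s, g)))"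
    by (simp add: trop_mutate_apply mutate_def)
  have "fst (fold trop_mutate (k # ks) (snd s, g)) = fst (fold trop_mutate ks (trop_mutate k (snd s, g)))"
    by simp
  also have "\<dots> = snd (fold mutate ks (mutate k s))" by (subst eq) (rule Cons.IH)
  finally show ?case by simp
qed simp

text \<open>In the exchange relation the old variable times the new one is a sum of two monomials;
  its tropical value is their maximum, and cancelling the old variable gives the tropical exchange
  rule.\<close>

theorem trop_val_fold_mutate:
  assumes s: "good_seed n s" and ks: "set ks \<subseteq> {..<n}"
  shows "trop_val (fst s) g (fst (fold mutate ks s) i) (snd (fold trop_mutate ks (snd s, g)) i)"
  using ks
proof (induction ks arbitrary: i rule: rev_induct)
  case Nil
  then show ?case by (simp add: trop_val_var)
next
  case (snoc k ks)
  let ?s = "fold mutate ks s"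
  define g' where "g' = snd (fold trop_mutate ks (snd s, g))"
  have IH: "trop_val (fst s) g (fst ?s i) (g' i)" for i using snoc by (simp add: g'_def)
  have x: "free_vars (fst s)" using s by (simp add: good_seed_def)
  have eq: "fold trop_mutate ks (snd s, g) = (snd ?s, g')"
    by (simp add: prod_eq_iff fst_fold_trop_mutate g'_def)
  show ?case
  proof (cases "i = k")
    case False
    then show ?thesis using IH[of i] by (simp add: eq trop_mutate_apply fst_mutate)
  next
    case True
    define z where "z = fst (mutate k ?s) k"
    have z: "z = leval (fst ?s) (exch (snd ?s k)) / fst ?s k"
      by (simp add: z_def fst_mutate)
    have "z \<in> range (leval (fst s))"
      using laurent_phenomenon[OF s snoc.prems, of k] by (simp add: z_def)
    moreover have "fst ?s k * z = meval (fst ?s) (pos_vec (snd ?s k)) + meval (fst ?s) (pos_vec (- snd ?s k))"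
      using trop_val_neq_0[OF IH x, of k] by (simp add: z exch_def)
    moreover have "trop_val (fst s) g
        (meval (fst ?s) (pos_vec (snd ?s k)) + meval (fst ?s) (pos_vec (- snd ?s k)))
        (max (weight g' (pos_vec (snd ?s k))) (weight g' (pos_vec (- snd ?s k))))"
      by (intro trop_val_add[OF x] trop_val_meval[OF x] IH) auto
    ultimately have "trop_val (fst s) g z
        (max (weight g' (pos_vec (snd ?s k))) (weight g' (pos_vec (- snd ?s k))) - g' k)"
      using trop_val_cancel[OF x IH[of k]] by simp
    then show ?thesis using True by (simp add: eq trop_mutate_apply z_def)
  qed
qed

lemma weight_pos_vec_fun_upd:
  "Poly_Mapping.lookup v k = 0 \<Longrightarrow> weight (g(k := c)) (pos_vec v) = weight g (pos_vec v)"
  by (simp add: weight_fun_upd)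

lemma trop_mutate_involutive:
  assumes "Poly_Mapping.lookup (b k) k = 0"
  shows "trop_mutate k (trop_mutate k (b, g)) = (b, g)"
proof -
  have "mutate_cols k b k = - b k" by (simp add: mutate_cols_def)
  then show ?thesis
    using assms by (simp add: trop_mutate_apply mutate_cols_involutive weight_pos_vec_fun_upd max.commute fun_eq_iff)
qed

lemma trop_mutate_fold_rev:
  "totally_sign_skew n b \<Longrightarrow> set ks \<subseteq> {..<n} \<Longrightarrow>
   fold trop_mutate (rev ks) (fold trop_mutate ks (b, g)) = (b, g)"
proof (induction ks arbitrary: b g)
  case (Cons k ks)
  obtain g' where g': "trop_mutate k (b, g) = (mutate_cols k b, g')" by (simp add: trop_mutate_apply)
  have "fold trop_mutate (rev (k # ks)) (fold trop_mutate (k # ks) (b, g)) = trop_mutate k (mutate_cols k b, g')"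
    using Cons.IH[of "mutate_cols k b" g'] Cons.prems by (simp add: g' totally_sign_skew_mutate)
  also have "\<dots> = (b, g)"
    using Cons.prems unfolding g'[symmetric]
    by (intro trop_mutate_involutive) (auto intro: sign_skew_diag totally_sign_skewD)
  finally show ?case .
qed simp

text \<open>A column entry at l has one sign, so one of the two exchange monomials is free of x_l
  and the maximum is 0. Unfrozen values therefore stay 0: no unfrozen cluster variable has a factor
  or a pole along x_l.\<close>

lemma fold_trop_mutate_frozen:
  assumes "n \<le> l" "set ks \<subseteq> {..<n}"
  shows "snd (fold trop_mutate ks (b, \<lambda>i. - coord l i)) = (\<lambda>i. - coord l i)"
  using assms(2)
proof (induction ks arbitrary: b)
  case (Cons k ks)
  have w: "weight (\<lambda>i. - coord l i) v = - Poly_Mapping.lookup v l" for v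
    using weight_lin[of "\<lambda>_. 0" "-1" "coord l" v] weight_coord[of l v]
    by (simp add: weight_def)
  have "trop_mutate k (b, \<lambda>i. - coord l i) = (mutate_cols k b, \<lambda>i. - coord l i)"
    using Cons.prems assms(1) by (auto simp: trop_mutate_apply w fun_eq_iff)
  then show ?case using Cons by simp
qed simp

section \<open>Denominators of cluster variables\<close>

text \<open>For every functional the spread between highest and lowest weight is nonnegative and
  adds up to 0 over f and h, so all exponents of f have equal coordinates.\<close>

lemma laurent_unit_single:
  assumes "f * h = (1 :: laurent)"
  obtains v c where "f = Poly_Mapping.single v c"
proof -
  have nz: "f \<noteq> 0" "h \<noteq> 0" using assms by auto
  have one: "top_weight g (1 :: laurent) = 0" for g using top_weight_mon[of g 0] by simp
  have sum: "top_weight g f + top_weight g h = 0" for g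
    using top_weight_mult[OF nz, of g] assms one[of g] by simp
  have neg: "weight (\<lambda>i. - g i) v = - weight g v" for g v
    by (simp add: weight_def sum_negf)
  obtain v where v: "v \<in> Poly_Mapping.keys f" using nz(1) keys_eq_empty by blast
  have ge: "0 \<le> top_weight g p + top_weight (\<lambda>i. - g i) p" if p: "p \<noteq> 0" for g p
  proof -
    obtain u where "u \<in> Poly_Mapping.keys p" using p keys_eq_empty by blast
    then show ?thesis
      using weight_le_top_weight[of u p g] weight_le_top_weight[of u p "\<lambda>i. - g i"] by (simp add: neg)
  qed
  have "weight g u = weight g v" if u: "u \<in> Poly_Mapping.keys f" for g u
  proof -
    have "top_weight g f + top_weight (\<lambda>i. - g i) f = 0"
      using ge[OF nz(1), of g] ge[OF nz(2), of g] sum[of g] sum[of "\<lambda>i. - g i"] by linarith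
    then show ?thesis
      using weight_le_top_weight[OF u, of g] weight_le_top_weight[OF u, of "\<lambda>i. - g i"]
        weight_le_top_weight[OF v, of g] weight_le_top_weight[OF v, of "\<lambda>i. - g i"]
      by (simp add: neg)
  qed
  from this[of _ "coord _"] have "u = v" if "u \<in> Poly_Mapping.keys f" for u
    using that by (intro poly_mapping_eqI) (metis weight_coord)
  then have "Poly_Mapping.keys f = {v}" using v by blast
  then have "f = Poly_Mapping.single v (Poly_Mapping.lookup f v)"
    using laurent_sum_monomials[of f] by simp
  then show thesis by (rule that)
qed

text \<open>The coefficient of the monomial is an integer unit, and -1 is excluded by comparing
  coefficients of numerator and denominator.\<close>

lemma subtraction_free_unit:
  assumes "f * h = 1" "subtraction_free f"
  obtains v where "f = mon v"
proof -
  obtain v c where f: "f = Poly_Mapping.single v c" using laurent_unit_single[OF assms(1)] .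
  have "h * f = 1" using assms(1) by (simp add: mult.commute)
  then obtain w d where h: "h = Poly_Mapping.single w d" using laurent_unit_single by blast
  have "Poly_Mapping.single (v + w) (c * d) = Poly_Mapping.single 0 1"
    using assms(1) by (simp add: f h mult_single)
  then have "Poly_Mapping.lookup (Poly_Mapping.single (v + w) (c * d)) 0 = 1" by simp
  then have cd: "c * d = 1" by (auto simp: lookup_single when_def split: if_splits)
  obtain p q where pq: "nonneg_coeffs p" "nonneg_coeffs q" "q \<noteq> 0" "f * q = p"
    using assms(2) by (auto simp: subtraction_free_def)
  obtain u where u: "u \<in> Poly_Mapping.keys q" using pq(3) keys_eq_empty by blast
  have "c * Poly_Mapping.lookup q u = Poly_Mapping.lookup p (u + v)"
    unfolding pq(4)[symmetric] f by (simp add: lookup_single_mult)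
  moreover have "Poly_Mapping.lookup q u > 0" "Poly_Mapping.lookup p (u + v) \<ge> 0"
    using pq u by (simp_all add: nonneg_coeffs_def in_keys_iff less_le)
  ultimately have "c \<ge> 0" by (metis mult_neg_pos not_le)
  then have "c = 1" using cd zmult_eq_1_iff by force
  then show thesis using that f by blast
qed

lemma trop_val_unit:
  assumes x: "free_vars x" and y: "trop_val x g y r" and inv: "inverse y \<in> range (leval x)"
  obtains v where "y = meval x v"
proof -
  obtain f where f: "leval x f = y" "subtraction_free f" using y by (auto simp: trop_val_def)
  obtain h where h: "inverse y = leval x h" using inv by (elim rangeE)
  have "leval x (f * h) = leval x 1"
    using trop_val_neq_0[OF y x] by (simp add: leval_mult free_varsD[OF x] f(1) flip: h)
  then have "f * h = 1" by (simp only: free_varsD(2)[OF x])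
  then obtain v where "f = mon v" using f(2) by (rule subtraction_free_unit)
  then have "y = meval x v" using f(1) by simp
  then show thesis by (rule that)
qed

lemma meval_inject: "free_vars x \<Longrightarrow> meval x u = meval x v \<longleftrightarrow> u = v"
proof -
  assume x: "free_vars x"
  have "meval x u = meval x v \<longleftrightarrow> leval x (mon u) = leval x (mon v)" by simp
  also have "\<dots> \<longleftrightarrow> mon u = mon v" by (rule free_varsD(2)[OF x])
  also have "\<dots> \<longleftrightarrow> u = v"
  proof
    assume "mon u = mon v"
    then have "Poly_Mapping.keys (mon u) = Poly_Mapping.keys (mon v)" by simp
    then show "u = v" by simp
  qed simp
  finally show ?thesis .
qed

lemma meval_frag_cmul_nat:
  assumes "\<And>i. x i \<noteq> 0"
  shows "meval x (frag_cmul (int N) v) = meval x v ^ N"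
  by (induction N) (simp_all add: frag_cmul_distrib meval_add[OF assms])

lemma meval_sum:
  assumes "\<And>i. x i \<noteq> 0"
  shows "meval x (sum u I) = (\<Prod>i\<in>I. meval x (u i))"
  by (induction I rule: infinite_finite_induct) (simp_all add: meval_add[OF assms])

lemma exch_not_unit:
  assumes "w \<noteq> 0" "exch w * h = mon v"
  shows False
proof -
  have "exch w * (h * mon (- v)) = exch w * h * mon (- v)" by (simp only: mult.assoc)
  then have "exch w * (h * mon (- v)) = 1" by (simp add: assms(2))
  then obtain u c where "exch w = Poly_Mapping.single u c" by (rule laurent_unit_single)
  then have "Poly_Mapping.keys (exch w) \<subseteq> {u}" by simp
  moreover have "nonneg_coeffs (mon a)" for a
    by (simp add: nonneg_coeffs_def lookup_single when_def)
  then have "Poly_Mapping.keys (exch w) = {pos_vec w, pos_vec (- w)}"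
    unfolding exch_def by (subst keys_add_nonneg) auto
  ultimately have "pos_vec w = pos_vec (- w)" by auto
  then show False using assms(1) pos_vec_diff[of w] by simp
qed

text \<open>
  Negative exponents at unfrozen indices are excluded by expanding in the neighbouring cluster,
  nonzero exponents at frozen indices by the tropical point \<open>- coord l\<close>, which every mutation fixes.
\<close>

lemma unit_cluster_variable:
  assumes s: "good_seed n s" and ks: "set ks \<subseteq> {..<n}" and k: "k < n"
    and inv: "inverse (fst (fold mutate ks s) k) \<in> range (leval (fst s))"
  obtains v where "fst (fold mutate ks s) k = meval (fst s) v"
    and "\<And>i. Poly_Mapping.lookup v i \<ge> 0" and "Poly_Mapping.keys v \<subseteq> {..<n}"
proof -
  have x: "free_vars (fst s)" using s by (simp add: good_seed_def)
  obtain v where v: "fst (fold mutate ks s) k = meval (fst s) v"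
    using trop_val_unit[OF x trop_val_fold_mutate[OF s ks] inv] .
  have frozen: "Poly_Mapping.lookup v l = 0" if l: "n \<le> l" for l
  proof -
    have "trop_val (fst s) (\<lambda>i. - coord l i) (meval (fst s) v) 0"
      using trop_val_fold_mutate[OF s ks, of "\<lambda>i. - coord l i" k] fold_trop_mutate_frozen[OF l ks, of "snd s"]
        k l v by simp
    then have "weight (\<lambda>i. - coord l i) v = 0"
      using trop_val_unique[OF x] trop_val_meval_var by blast
    moreover have "weight (\<lambda>i. - coord l i) v = - Poly_Mapping.lookup v l"
      using weight_lin[of "\<lambda>_. 0" "-1" "coord l" v] weight_coord[of l v] by (simp add: weight_def)
    ultimately show ?thesis by simp
  qed
  have unfrozen: "Poly_Mapping.lookup v i \<ge> 0" if i: "i < n" for i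
  proof (rule ccontr)
    assume neg: "\<not> Poly_Mapping.lookup v i \<ge> 0"
    define r where "r = nat (- Poly_Mapping.lookup v i)"
    have r: "Poly_Mapping.lookup v i = - int r" "r > 0" using neg by (simp_all add: r_def)
    \<comment> \<open>Mutating twice at i exhibits the same cluster variable as reached from the
      neighbour of s in direction i.\<close>
    have "fold mutate (i # ks) (mutate i s) = fold mutate ks s"
      using mutate_involutive[OF s i] by simp
    then have "leval (fst s) (mon v) \<in> range (leval (fst (mutate i s)))"
      using laurent_phenomenon[OF good_seed_mutate[OF s i], of "i # ks" k] ks i v by simp
    then have "leval (fst s) (mon v) \<in> range (leval (mutate_vars i (snd s i) (fst s)))"
      by (simp only: mutate_def fst_conv)
    then have "exch (snd s i) ^ r dvd gpart (coord i) (- int r) (mon v)"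
      unfolding in_mutate_range_iff[OF x good_seed_diag[OF s i]] by blast
    then have "exch (snd s i) dvd mon v"
      using r dvd_trans[OF dvd_power[of r "exch (snd s i)"]] by (simp add: gpart_single)
    then obtain h where "exch (snd s i) * h = mon v" by (metis dvd_def)
    \<comment> \<open>A zero column could not be given weight 1, so the exchange polynomial really
      has two terms.\<close>
    moreover have "snd s i \<noteq> 0"
    proof
      assume "snd s i = 0"
      moreover have "\<forall>d. \<exists>g. \<forall>j<n. weight g (snd s j) = d j"
        using s by (simp add: good_seed_def unimodular_cols_def)
      from spec[OF this, of "\<lambda>_. 1"] obtain g where "\<forall>j<n. weight g (snd s j) = 1" ..
      ultimately show False using i by force
    qed
    ultimately show False using exch_not_unit by blast
  qed
  show thesis
  proof (rule that[OF v])
    show "Poly_Mapping.lookup v i \<ge> 0" for i using frozen[of i] unfrozen[of i] by (cases "i < n") auto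
    show "Poly_Mapping.keys v \<subseteq> {..<n}" using frozen by (auto simp: in_keys_iff) (meson not_le)
  qed
qed

text \<open>The variable is a monomial in its own factors, which are monomials in turn; compare exponents.\<close>

lemma unit_cluster_variable_common:
  assumes s: "good_seed n s" and ks: "set ks \<subseteq> {..<n}" and k: "k < n"
    and inv: "inverse (fst (fold mutate ks s) k) \<in> range (leval (fst s))"
  shows "\<exists>j<n. fst (fold mutate ks s) k = fst s j"
proof -
  define s' where "s' = fold mutate ks s"
  have s': "good_seed n s'" unfolding s'_def by (rule good_seed_fold[OF s ks])
  have x: "free_vars (fst s)" and x': "free_vars (fst s')" using s s' by (simp_all add: good_seed_def)
  have reverse: "fold mutate (rev ks) s' = s" unfolding s'_def by (rule mutate_fold_rev[OF s ks])
  have ks': "set (rev ks) \<subseteq> {..<n}" using ks by simp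
  have xs: "fst s i \<in> range (leval (fst s'))" for i
    using laurent_phenomenon[OF s' ks', of i] by (simp add: reverse)
  note W = is_subring_range_leval[of "fst s'", OF free_varsD(1)[OF x']]
  obtain v where v: "fst s' k = meval (fst s) v" "\<And>i. Poly_Mapping.lookup v i \<ge> 0"
      "Poly_Mapping.keys v \<subseteq> {..<n}"
    using unit_cluster_variable[OF s ks k inv] unfolding s'_def by metis
  have "\<exists>w. fst s j = meval (fst s') w \<and> (\<forall>i. Poly_Mapping.lookup w i \<ge> 0)"
    if j: "j \<in> Poly_Mapping.keys v" for j
  proof -
    have vj: "Poly_Mapping.lookup v j > 0" using j v(2)[of j] by (simp add: in_keys_iff less_le)
    \<comment> \<open>A factor of a unit is a unit: removing one x_j from the monomial leaves
      nonnegative exponents, hence an element of the ring.\<close>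
    have "meval (fst s) v = meval (fst s) (v - basis_vec j) * fst s j"
      using meval_add[of "fst s" "v - basis_vec j" "basis_vec j"] free_varsD(1)[OF x] by simp
    then have "inverse (fst s j) = meval (fst s) (v - basis_vec j) * inverse (fst s' k)"
      using free_varsD(1)[OF x] free_varsD(1)[OF x'] meval_nonzero[OF free_varsD(1)[OF x]]
      by (simp add: v(1) field_simps)
    moreover have "meval (fst s) (v - basis_vec j) \<in> range (leval (fst s'))"
    proof (rule subring_meval[OF W])
      fix i
      have "Poly_Mapping.lookup (v - basis_vec j) i \<ge> 0"
        using v(2)[of i] vj by (auto simp: lookup_minus lookup_single when_def)
      then show "inverse (fst s i) \<in> range (leval (fst s'))"
        if "Poly_Mapping.lookup (v - basis_vec j) i < 0" using that by simp
    qed (rule xs)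
    ultimately have "inverse (fst (fold mutate (rev ks) s') j) \<in> range (leval (fst s'))"
      unfolding reverse using subring_mult[OF W _ inverse_var_in_range] by simp
    moreover have "j < n" using j v(3) by auto
    ultimately obtain w where "fst s j = meval (fst s') w" "\<And>i. Poly_Mapping.lookup w i \<ge> 0"
      using unit_cluster_variable[OF s' ks'] unfolding reverse by metis
    then show ?thesis by blast
  qed
  then obtain w where w: "\<And>j. j \<in> Poly_Mapping.keys v \<Longrightarrow> fst s j = meval (fst s') (w j)"
      "\<And>j i. j \<in> Poly_Mapping.keys v \<Longrightarrow> Poly_Mapping.lookup (w j) i \<ge> 0"
    by metis
  define u where "u = (\<Sum>j\<in>Poly_Mapping.keys v. frag_cmul (Poly_Mapping.lookup v j) (w j))"
  have "meval (fst s') (basis_vec k) = fst s' k" by simp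
  also have "\<dots> = (\<Prod>j\<in>Poly_Mapping.keys v. meval (fst s') (frag_cmul (Poly_Mapping.lookup v j) (w j)))"
    unfolding v(1) meval_def[of "fst s"]
  proof (rule prod.cong[OF refl])
    fix j assume j: "j \<in> Poly_Mapping.keys v"
    have "meval (fst s') (frag_cmul (int (nat (Poly_Mapping.lookup v j))) (w j))
        = meval (fst s') (w j) ^ nat (Poly_Mapping.lookup v j)"
      by (rule meval_frag_cmul_nat) (rule free_varsD(1)[OF x'])
    then show "fst s j powi Poly_Mapping.lookup v j = meval (fst s') (frag_cmul (Poly_Mapping.lookup v j) (w j))"
      using v(2)[of j] w(1)[OF j] by (simp add: power_int_def)
  qed
  also have "\<dots> = meval (fst s') u"
    unfolding u_def by (rule meval_sum[symmetric]) (rule free_varsD(1)[OF x'])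
  finally have "basis_vec k = u" using meval_inject[OF x'] by blast
  then have eq: "Poly_Mapping.lookup (basis_vec k) l
      = (\<Sum>j\<in>Poly_Mapping.keys v. Poly_Mapping.lookup v j * Poly_Mapping.lookup (w j) l)" for l
    by (simp add: u_def lookup_sum)
  have "\<exists>j\<in>Poly_Mapping.keys v. Poly_Mapping.lookup (w j) k \<noteq> 0"
  proof (rule ccontr)
    assume "\<not> ?thesis"
    then show False using eq[of k] by simp
  qed
  then obtain j where j: "j \<in> Poly_Mapping.keys v" "Poly_Mapping.lookup (w j) k \<noteq> 0" by blast
  have vj: "Poly_Mapping.lookup v j > 0" using j(1) v(2)[of j] by (simp add: in_keys_iff less_le)
  \<comment> \<open>All summands are nonnegative and their sum is a basis vector, so a factor
    involving index k must be that basis vector itself.\<close>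
  have le: "Poly_Mapping.lookup v j * Poly_Mapping.lookup (w j) l \<le> Poly_Mapping.lookup (basis_vec k) l" for l
    unfolding eq
    by (rule member_le_sum[OF j(1)]) (use v(2) w(2) in auto)
  have "w j = basis_vec k"
  proof (rule poly_mapping_eqI)
    fix l
    have "Poly_Mapping.lookup (w j) l \<le> Poly_Mapping.lookup v j * Poly_Mapping.lookup (w j) l"
      using vj w(2)[OF j(1), of l] by (simp add: mult_le_cancel_right1)
    then have "Poly_Mapping.lookup (w j) l \<le> Poly_Mapping.lookup (basis_vec k) l"
      using le[of l] by linarith
    then show "Poly_Mapping.lookup (w j) l = Poly_Mapping.lookup (basis_vec k) l"
      using w(2)[OF j(1), of l] j(2) by (cases "l = k") (auto simp: lookup_single when_def)
  qed
  then have "fst s' k = fst s j" using w(1)[OF j(1)] by simp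
  moreover have "j < n" using j(1) v(3) by auto
  ultimately show ?thesis unfolding s'_def by blast
qed

text \<open>
  If a cluster variable \<open>z\<close> of \<open>s\<close> is divisible by \<open>x\<^sub>k\<close> in the cluster of \<open>s'\<close>, then \<open>z / x\<^sub>k\<close> lies
  in the upper bound at \<open>s'\<close>, hence is a Laurent polynomial in the cluster of \<open>s\<close>, where \<open>z\<close> is
  invertible; so \<open>x\<^sub>k\<close> is invertible there.
\<close>

lemma denominator_exponent_nonneg:
  assumes s: "good_seed n s" and ks: "set ks \<subseteq> {..<n}" and k: "k < n" and i: "i < n"
    and s': "s' = fold mutate ks s"
    and notin: "\<And>j. j < n \<Longrightarrow> fst s' k \<noteq> fst s j"
  shows "snd (fold trop_mutate (rev ks) (snd s', \<lambda>i. - coord k i)) i \<ge> 0"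
proof (rule ccontr)
  define d where "d = snd (fold trop_mutate (rev ks) (snd s', \<lambda>i. - coord k i)) i"
  assume "\<not> ?thesis"
  then have d: "d < 0" by (simp add: d_def)
  have gs': "good_seed n s'" unfolding s' by (rule good_seed_fold[OF s ks])
  have x: "free_vars (fst s)" and x': "free_vars (fst s')" using s gs' by (simp_all add: good_seed_def)
  have reverse: "fold mutate (rev ks) s' = s" unfolding s' by (rule mutate_fold_rev[OF s ks])
  have ks': "set (rev ks) \<subseteq> {..<n}" using ks by simp
  define z where "z = fst s i"
  have z: "z \<in> upper_bound n s'"
    using upper_bound_fold[OF s ks var_in_upper_bound[OF s]] by (simp add: z_def s')
  have "trop_val (fst s') (\<lambda>i. - coord k i) z d"
    using trop_val_fold_mutate[OF gs' ks', of "\<lambda>i. - coord k i" i] by (simp add: reverse z_def d_def)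
  then obtain f where f: "leval (fst s') f = z" "top_weight (\<lambda>i. - coord k i) f = d"
    unfolding trop_val_def by blast
  \<comment> \<open>A negative maximum of the negated degree means that x_k divides every monomial
    of z.\<close>
  have pos: "Poly_Mapping.lookup v k > 0" if "v \<in> Poly_Mapping.keys f" for v
  proof -
    have "weight (\<lambda>i. - coord k i) v = - Poly_Mapping.lookup v k"
      using weight_lin[of "\<lambda>_. 0" "-1" "coord k" v] weight_coord[of k v] by (simp add: weight_def)
    then show ?thesis
      using weight_le_top_weight[OF that, of "\<lambda>i. - coord k i"] f(2) d by simp
  qed
  define f' where "f' = mon (Poly_Mapping.single k (- 1)) * f"
  define e where "e = z * inverse (fst s' k)"
  have e: "e = leval (fst s') f'"
    by (simp add: f'_def e_def leval_mult free_varsD(1)[OF x'] f(1) power_int_minus)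
  have "e \<in> upper_bound n s'"
    unfolding upper_bound_def
  proof (intro IntI INT_I)
    show "e \<in> range (leval (fst s'))" unfolding e by (rule rangeI)
    fix j assume "j \<in> {..<n}"
    then have j: "j < n" by simp
    show "e \<in> range (leval (mutate_vars j (snd s' j) (fst s')))"
    proof (cases "j = k")
      case True
      \<comment> \<open>After division by x_k all degrees in x_k are still nonnegative, so the
        criterion in direction k is vacuous for r > 0.\<close>
      have "gpart (coord k) (- int r) f' = 0" if "r > 0" for r
      proof -
        have "gpart (coord k) (1 - int r) f = 0"
        proof (rule poly_mapping_eqI)
          fix v
          show "Poly_Mapping.lookup (gpart (coord k) (1 - int r) f) v = Poly_Mapping.lookup 0 v"
            using pos[of v] that by (cases "Poly_Mapping.lookup f v = 0") (auto simp: lookup_gpart in_keys_iff)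
        qed
        then show ?thesis by (simp add: f'_def gpart_single_mult)
      qed
      then have "exch (snd s' k) ^ r dvd gpart (coord k) (- int r) f'" for r
        by (cases "r = 0") auto
      then show ?thesis
        unfolding e True in_mutate_range_iff[OF x' good_seed_diag[OF gs' k]] by blast
    next
      case False
      let ?y = "mutate_vars j (snd s' j) (fst s')"
      have y: "free_vars ?y" by (rule free_vars_mutate[OF x' good_seed_diag[OF gs' j]])
      \<comment> \<open>In the other neighbouring clusters x_k survives, and there it is
        invertible.\<close>
      have "?y k = fst s' k" using False by (simp add: mutate_vars_def)
      then have "inverse (fst s' k) \<in> range (leval ?y)" using inverse_var_in_range[of ?y k] by simp
      moreover have "z \<in> range (leval ?y)" using z j by (simp add: upper_bound_def)
      ultimately show ?thesis
        unfolding e_def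
        by (intro subring_mult[OF is_subring_range_leval[of ?y, OF free_varsD(1)[OF y]]])
    qed
  qed
  then have "e \<in> range (leval (fst s))"
    using upper_bound_fold[OF gs' ks'] by (simp add: reverse upper_bound_def)
  then have "inverse z * e \<in> range (leval (fst s))"
    unfolding z_def
    by (intro subring_mult[OF is_subring_range_leval[of "fst s", OF free_varsD(1)[OF x]]] inverse_var_in_range)
  moreover have "inverse z * e = inverse (fst s' k)"
    using free_varsD(1)[OF x, of i] by (simp add: e_def z_def)
  ultimately have "\<exists>j<n. fst s' k = fst s j"
    unfolding s' by (intro unit_cluster_variable_common[OF s ks k]) simp
  then show False using notin by blast
qed

lemma snd_fold_trop_mutate_frozen:
  "set ks \<subseteq> {..<n} \<Longrightarrow> n \<le> l \<Longrightarrow> snd (fold trop_mutate ks (b, g)) l = g l"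
  by (induction ks arbitrary: b g) (auto simp: trop_mutate_apply)

text \<open>The transported point d is nonnegative at unfrozen indices and 0 elsewhere. Hence the
  negative exponent sits at an index below n and survives setting the added coefficients to
  1.\<close>

theorem cluster_monomial_proper:
  assumes s: "good_seed n s" and ks: "set ks \<subseteq> {..<n}" and s': "s' = fold mutate ks s"
    and h: "\<And>i. Poly_Mapping.lookup h i \<ge> 0"
    and k: "k < n" "Poly_Mapping.lookup h k > 0"
    and notin: "\<And>j. j < n \<Longrightarrow> fst s' k \<noteq> fst s j"
  obtains f where "leval (fst s) f = meval (fst s') h"
    and "\<And>v. v \<in> Poly_Mapping.keys f \<Longrightarrow> \<exists>i<n. Poly_Mapping.lookup v i < 0"
proof -
  have x: "free_vars (fst s)" using s by (simp add: good_seed_def)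
  have gs': "good_seed n s'" unfolding s' by (rule good_seed_fold[OF s ks])
  define T where "T = fold trop_mutate (rev ks) (snd s', \<lambda>i. - coord k i)"
  define d where "d = snd T"
  have nonneg: "d i \<ge> 0" if "i < n" for i
    unfolding d_def T_def by (rule denominator_exponent_nonneg[OF s ks k(1) that s' notin])
  have frozen: "d i = 0" if "n \<le> i" for i
    unfolding d_def T_def using snd_fold_trop_mutate_frozen[of "rev ks" n i] ks that k(1) by simp
  have "fst T = snd s"
    unfolding T_def by (simp add: fst_fold_trop_mutate s' mutate_fold_rev[OF s ks])
  then have T: "T = (snd s, d)" by (simp add: d_def prod_eq_iff)
  have "fold trop_mutate ks T = (snd s', \<lambda>i. - coord k i)"
    using trop_mutate_fold_rev[of n "snd s'" "rev ks"] gs' ks by (simp add: T_def good_seed_def)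
  then have "trop_val (fst s) d (fst s' i) (- coord k i)" for i
    using trop_val_fold_mutate[OF s ks, of d i] by (simp add: T s')
  then have "trop_val (fst s) d (meval (fst s') h) (weight (\<lambda>i. - coord k i) h)"
    by (intro trop_val_meval[OF x] h)
  moreover have "weight (\<lambda>i. - coord k i) h = - Poly_Mapping.lookup h k"
    using weight_lin[of "\<lambda>_. 0" "-1" "coord k" h] weight_coord[of k h] by (simp add: weight_def)
  ultimately obtain f where f: "leval (fst s) f = meval (fst s') h" "top_weight d f < 0"
    unfolding trop_val_def using k(2) by auto
  show thesis
  proof (rule that[OF f(1)])
    fix v assume v: "v \<in> Poly_Mapping.keys f"
    show "\<exists>i<n. Poly_Mapping.lookup v i < 0"
    proof (rule ccontr)
      assume "\<not> ?thesis"
      then have "weight d v \<ge> 0"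
        unfolding weight_def
        by (intro sum_nonneg) (metis frozen le_less_linear mult_eq_0_iff mult_nonneg_nonneg nonneg order_refl)
      then show False using weight_le_top_weight[OF v, of d] f(2) by simp
    qed
  qed
qed

section \<open>The pattern with principal coefficients\<close>

definition generic_var :: "nat \<Rightarrow> laurent fract" where
  "generic_var i = Fract (mon (basis_vec i)) 1"

definition principal_cols :: "nat \<Rightarrow> int mat \<Rightarrow> nat \<Rightarrow> nat \<Rightarrow>\<^sub>0 int" where
  "principal_cols m B j = (\<Sum>i<m. Poly_Mapping.single i (B $$ (i, j))) + basis_vec (m + j)"

text \<open>A homomorphism from exponents to the multiplicative group is determined by the basis
  vectors.\<close>

lemma meval_hom:
  fixes E :: "(nat \<Rightarrow>\<^sub>0 int) \<Rightarrow> 'a::field"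
  assumes zero: "E 0 = 1" and add: "\<And>u v. E (u + v) = E u * E v"
  shows "meval (\<lambda>i. E (basis_vec i)) v = E v"
proof -
  have inv: "E (- u) = inverse (E u)" for u
    using inverse_unique[of "E u" "E (- u)"] add[of u "- u"] zero by simp
  have pow: "E (Poly_Mapping.single i (int N)) = E (basis_vec i) ^ N" for i N
  proof (induction N)
    case (Suc N)
    have "Poly_Mapping.single i (int (Suc N)) = basis_vec i + Poly_Mapping.single i (int N)"
      by (simp flip: single_add)
    then show ?case using Suc by (simp add: add)
  qed (simp add: zero)
  have single: "E (Poly_Mapping.single i c) = E (basis_vec i) powi c" for i c
  proof (cases "c \<ge> 0")
    case True
    then show ?thesis using pow[of i "nat c"] by (simp add: power_int_def)
  next
    case False
    then have "Poly_Mapping.single i c = - Poly_Mapping.single i (int (nat (- c)))"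
      by (simp flip: single_uminus)
    then show ?thesis using False pow[of i "nat (- c)"] by (simp add: inv power_int_def power_inverse)
  qed
  have sum: "E (sum u I) = (\<Prod>i\<in>I. E (u i))" for u :: "nat \<Rightarrow> nat \<Rightarrow>\<^sub>0 int" and I
    by (induction I rule: infinite_finite_induct) (simp_all add: zero add)
  have "v = (\<Sum>i\<in>Poly_Mapping.keys v. Poly_Mapping.single i (Poly_Mapping.lookup v i))"
    by (rule poly_mapping_eqI) (auto simp: lookup_sum lookup_single when_def in_keys_iff)
  then have "E v = E (\<Sum>i\<in>Poly_Mapping.keys v. Poly_Mapping.single i (Poly_Mapping.lookup v i))"
    by (rule arg_cong)
  also have "\<dots> = (\<Prod>i\<in>Poly_Mapping.keys v. E (basis_vec i) powi Poly_Mapping.lookup v i)"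
    unfolding sum by (intro prod.cong refl single)
  finally show ?thesis by (simp only: meval_def)
qed

lemma of_int_fract: "of_int c = Fract (of_int c) 1"
  by (cases c rule: int_cases2) (simp_all add: of_nat_fract)

lemma leval_generic_var: "leval generic_var f = Fract f 1"
proof -
  have "meval generic_var v = Fract (mon v) 1" for v
    using meval_hom[of "\<lambda>v. Fract (mon v) 1" v]
    by (simp add: generic_var_def[abs_def] mult_single One_fract_def)
  then have "of_int c * meval generic_var v = Fract (Poly_Mapping.single v c) 1" for c v
    unfolding of_int_fract by (simp add: mult_single flip: single_of_int)
  moreover have add: "Fract (f + h) 1 = Fract f 1 + Fract h 1" for f h :: laurent by simp
  have "Fract (sum F I) 1 = (\<Sum>i\<in>I. Fract (F i) 1)" for F :: "(nat \<Rightarrow>\<^sub>0 int) \<Rightarrow> laurent" and I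
    by (induction I rule: infinite_finite_induct) (simp_all add: Zero_fract_def add del: add_fract)
  ultimately have "leval generic_var f
      = Fract (\<Sum>v\<in>Poly_Mapping.keys f. Poly_Mapping.single v (Poly_Mapping.lookup f v)) 1"
    by (simp add: leval_def)
  then show ?thesis by (simp flip: laurent_sum_monomials)
qed

lemma free_vars_generic: "free_vars generic_var"
  unfolding free_vars_def
  by (auto simp: inj_def leval_generic_var eq_fract generic_var_def Zero_fract_def)

section \<open>Columns with principal coefficients\<close>

lemma lookup_principal_cols:
  "Poly_Mapping.lookup (principal_cols m B j) i = (if i < m then B $$ (i, j) else if i = m + j then 1 else 0)"
  by (simp add: principal_cols_def lookup_add lookup_sum lookup_single when_def)

lemma weight_sum: "weight g (sum u I) = (\<Sum>i\<in>I. weight g (u i))"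
  by (induction I rule: infinite_finite_induct) simp_all

text \<open>A functional supported on the added rows, which form an identity block, prescribes the
  weights freely.\<close>

lemma unimodular_principal_cols: "unimodular_cols n (principal_cols m B)"
  unfolding unimodular_cols_def
proof
  fix d :: "nat \<Rightarrow> int"
  have "weight (\<lambda>i. if i < m then 0 else d (i - m)) (principal_cols m B j) = d j" for j
    by (simp add: principal_cols_def weight_sum)
  then show "\<exists>g. \<forall>j<n. weight g (principal_cols m B j) = d j" by blast
qed

definition cols_match :: "nat \<Rightarrow> nat \<Rightarrow> int mat \<Rightarrow> (nat \<Rightarrow> nat \<Rightarrow>\<^sub>0 int) \<Rightarrow> bool" where
  "cols_match p n M b \<longleftrightarrow> M \<in> carrier_mat p n \<and>
     (\<forall>i<p. \<forall>j<n. Poly_Mapping.lookup (b j) i = M $$ (i, j))"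

text \<open>The matrix rule negates row k outright, while the column rule subtracts twice the entry;
  these agree because the diagonal entry is zero.\<close>

lemma cols_match_mutate:
  assumes M: "cols_match p n M b" and k: "k < n" "n \<le> p" "M $$ (k, k) = 0"
  shows "cols_match p n (mat_mutation k M) (mutate_cols k b)"
proof -
  have dim: "dim_row M = p" "dim_col M = n" and eq: "\<And>i j. i < p \<Longrightarrow> j < n \<Longrightarrow> Poly_Mapping.lookup (b j) i = M $$ (i, j)"
    using M by (auto simp: cols_match_def)
  have "k < p" using k by simp
  then show ?thesis
    using k unfolding cols_match_def
    by (auto simp: mat_mutation_def dim eq mutate_cols_def lookup_mutate_col)
qed

text \<open>The top square part mutates independently of the rows below it.\<close>

lemma totally_sign_skew_of_mat:
  assumes B: "totally_sign_skew_symmetric n B" and match: "cols_match n n B b"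
  shows "totally_sign_skew n b"
  unfolding totally_sign_skew_def
proof (intro allI impI)
  fix ks assume ks: "set ks \<subseteq> {..<n}"
  then have "cols_match n n (fold mat_mutation ks B) (fold mutate_cols ks b)"
  proof (induction ks rule: rev_induct)
    case (snoc k ks)
    then have "sign_skew_symmetric n (fold mat_mutation ks B)"
      using B by (simp add: totally_sign_skew_symmetric_def)
    then have "fold mat_mutation ks B $$ (k, k) = 0"
      using snoc.prems unfolding sign_skew_symmetric_def
      by (metis lessThan_iff not_square_less_zero set_append subset_iff Un_iff list.set_intros(1))
    then show ?case using snoc by (simp add: cols_match_mutate)
  qed (simp add: match)
  moreover have "sign_skew_symmetric n (fold mat_mutation ks B)"
    using B ks by (simp add: totally_sign_skew_symmetric_def)
  ultimately show "sign_skew n (fold mutate_cols ks b)"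
    by (simp add: sign_skew_def sign_skew_symmetric_def cols_match_def)
qed

section \<open>Algebraic independence and Laurent monomials\<close>

text \<open>The padding value 1 makes ordinary evaluation perform the specialization of the added
  coefficients.\<close>

definition extend_vec :: "'f::field vec \<Rightarrow> nat \<Rightarrow> 'f" where
  "extend_vec x i = (if i < dim_vec x then x $ i else 1)"

lemma meval_extend_vec:
  "meval (extend_vec x) v = (\<Prod>i<dim_vec x. (x $ i) powi Poly_Mapping.lookup v i)"
proof -
  have "meval (extend_vec x) v
      = (\<Prod>i\<in>Poly_Mapping.keys v \<union> {..<dim_vec x}. extend_vec x i powi Poly_Mapping.lookup v i)"
    by (rule meval_superset) auto
  also have "\<dots> = (\<Prod>i<dim_vec x. (x $ i) powi Poly_Mapping.lookup v i)"
    by (rule prod.mono_neutral_cong_right) (auto simp: extend_vec_def)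
  finally show ?thesis .
qed

lemma laurent_monomial_eq_meval: "laurent_monomial x v = meval (extend_vec x) v"
  by (simp add: laurent_monomial_def meval_extend_vec)

lemma laurent_expansion_iff:
  "laurent_expansion x u c \<longleftrightarrow>
     (\<forall>h\<in>Poly_Mapping.keys c. Poly_Mapping.keys h \<subseteq> {..<dim_vec x}) \<and> u = leval (extend_vec x) c"
  by (simp add: laurent_expansion_def leval_def laurent_monomial_eq_meval)

definition nat_exponent :: "(nat \<Rightarrow>\<^sub>0 nat) \<Rightarrow> nat \<Rightarrow>\<^sub>0 int" where
  "nat_exponent h = Poly_Mapping.map int h"

lemma lookup_nat_exponent [simp]: "Poly_Mapping.lookup (nat_exponent h) i = int (Poly_Mapping.lookup h i)"
  by (simp add: nat_exponent_def map.rep_eq when_def)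

lemma keys_nat_exponent [simp]: "Poly_Mapping.keys (nat_exponent h) = Poly_Mapping.keys h"
  by (auto simp: in_keys_iff)

lemma monomial_eq_meval: "monomial x h = meval (extend_vec x) (nat_exponent h)"
  by (simp add: monomial_def meval_extend_vec)

lemma poly_value_superset:
  assumes "finite I" "Poly_Mapping.keys p \<subseteq> I"
  shows "poly_value x p = (\<Sum>h\<in>I. of_rat (Poly_Mapping.lookup p h) * monomial x h)"
  unfolding poly_value_def
  by (rule sum.mono_neutral_left) (use assms in \<open>auto simp: in_keys_iff\<close>)

lemma algebraically_independent_nonzero:
  assumes "algebraically_independent x" "i < dim_vec x"
  shows "x $ i \<noteq> 0"
proof
  assume 0: "x $ i = 0"
  define p :: "(nat \<Rightarrow>\<^sub>0 nat) \<Rightarrow>\<^sub>0 rat" where "p = Poly_Mapping.single (Poly_Mapping.single i 1) 1"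
  have "monomial x (Poly_Mapping.single i 1) = 0"
    unfolding monomial_def using assms(2) 0 by (intro prod_zero) auto
  then have "poly_value x p = 0" by (simp add: poly_value_def p_def)
  moreover have "poly_in_vars (dim_vec x) p" using assms(2) by (simp add: poly_in_vars_def p_def)
  ultimately have "p = 0" using assms(1) by (simp add: algebraically_independent_def)
  then have "Poly_Mapping.lookup p (Poly_Mapping.single i 1) = 0" by simp
  then show False by (simp add: p_def)
qed

text \<open>Multiplication by the N-th power of the product of all variables turns a Laurent
  relation into a polynomial one, to which algebraic independence applies.\<close>

lemma leval_extend_vec_eq_0:
  fixes x :: "'f::field_char_0 vec"
  assumes x: "algebraically_independent x"
    and keys: "\<And>v. v \<in> Poly_Mapping.keys c \<Longrightarrow> Poly_Mapping.keys v \<subseteq> {..<dim_vec x}"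
    and zero: "leval (extend_vec x) c = 0"
  shows "c = 0"
proof -
  let ?m = "dim_vec x"
  \<comment> \<open>A crude common bound for all exponents: the sum of their absolute
    values.\<close>
  define N where "N = (\<Sum>v\<in>Poly_Mapping.keys c. \<Sum>i<?m. nat \<bar>Poly_Mapping.lookup v i\<bar>)"
  have N: "Poly_Mapping.lookup v i + int N \<ge> 0" if v: "v \<in> Poly_Mapping.keys c" and i: "i < ?m" for v i
  proof -
    have "nat \<bar>Poly_Mapping.lookup v i\<bar> \<le> (\<Sum>i<?m. nat \<bar>Poly_Mapping.lookup v i\<bar>)"
      by (rule member_le_sum) (use i in auto)
    also have "\<dots> \<le> N"
      unfolding N_def by (rule member_le_sum[where f = "\<lambda>v. \<Sum>i<?m. nat \<bar>Poly_Mapping.lookup v i\<bar>"]) (use v in auto)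
    finally show ?thesis by linarith
  qed
  define e :: "(nat \<Rightarrow>\<^sub>0 int) \<Rightarrow> nat \<Rightarrow>\<^sub>0 nat"
    where "e v = (\<Sum>i<?m. Poly_Mapping.single i (nat (Poly_Mapping.lookup v i + int N)))" for v
  have e: "Poly_Mapping.lookup (e v) i = (if i < ?m then nat (Poly_Mapping.lookup v i + int N) else 0)" for v i
    by (simp add: e_def lookup_sum lookup_single when_def)
  have inj: "inj_on e (Poly_Mapping.keys c)"
  proof (rule inj_onI, rule poly_mapping_eqI)
    fix u v i
    assume u: "u \<in> Poly_Mapping.keys c" and v: "v \<in> Poly_Mapping.keys c" and "e u = e v"
    then have eq: "Poly_Mapping.lookup (e u) i = Poly_Mapping.lookup (e v) i" by simp
    show "Poly_Mapping.lookup u i = Poly_Mapping.lookup v i"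
    proof (cases "i < ?m")
      case True
      then show ?thesis using eq N[OF u True] N[OF v True] by (simp add: e)
    next
      case False
      then have "i \<notin> Poly_Mapping.keys u" "i \<notin> Poly_Mapping.keys v" using keys[OF u] keys[OF v] by auto
      then show ?thesis by (simp add: in_keys_iff)
    qed
  qed
  have nz: "x $ i \<noteq> 0" if "i < ?m" for i by (rule algebraically_independent_nonzero[OF x that])
  have mono: "monomial x (e v) = (\<Prod>i<?m. (x $ i) ^ N) * meval (extend_vec x) v"
    if v: "v \<in> Poly_Mapping.keys c" for v
  proof -
    have "(x $ i) ^ Poly_Mapping.lookup (e v) i = (x $ i) ^ N * (x $ i) powi Poly_Mapping.lookup v i"
      if i: "i < ?m" for i
    proof -
      have "(x $ i) ^ Poly_Mapping.lookup (e v) i = (x $ i) powi (Poly_Mapping.lookup v i + int N)"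
        using N[OF v i] i by (simp add: e power_int_def)
      then show ?thesis using nz[OF i] by (simp add: power_int_add)
    qed
    then show ?thesis by (simp add: monomial_def meval_extend_vec flip: prod.distrib)
  qed
  define p :: "(nat \<Rightarrow>\<^sub>0 nat) \<Rightarrow>\<^sub>0 rat"
    where "p = (\<Sum>v\<in>Poly_Mapping.keys c. Poly_Mapping.single (e v) (of_int (Poly_Mapping.lookup c v)))"
  have lookup_p: "Poly_Mapping.lookup p (e v) = of_int (Poly_Mapping.lookup c v)"
    if v: "v \<in> Poly_Mapping.keys c" for v
  proof -
    have "Poly_Mapping.lookup p (e v)
        = (\<Sum>u\<in>Poly_Mapping.keys c. if u = v then of_int (Poly_Mapping.lookup c u) else 0)"
      unfolding p_def lookup_sum
      by (rule sum.cong[OF refl]) (use inj v in \<open>auto simp: lookup_single when_def dest: inj_onD\<close>)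
    then show ?thesis using v by simp
  qed
  have keys_p: "Poly_Mapping.keys p \<subseteq> e ` Poly_Mapping.keys c"
    unfolding p_def by (rule order.trans[OF keys_sum]) auto
  have "poly_value x p = (\<Sum>h\<in>e ` Poly_Mapping.keys c. of_rat (Poly_Mapping.lookup p h) * monomial x h)"
    by (rule poly_value_superset) (use keys_p in auto)
  also have "\<dots> = (\<Sum>v\<in>Poly_Mapping.keys c. of_rat (Poly_Mapping.lookup p (e v)) * monomial x (e v))"
    by (rule sum.reindex_cong[OF inj]) auto
  also have "\<dots> = (\<Prod>i<?m. (x $ i) ^ N) * leval (extend_vec x) c"
    by (simp add: leval_def sum_distrib_left lookup_p mono ac_simps)
  finally have "poly_value x p = 0" using zero by simp
  moreover have "poly_in_vars ?m p"
    unfolding poly_in_vars_def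
  proof
    fix h assume "h \<in> Poly_Mapping.keys p"
    then obtain v where "h = e v" using keys_p by blast
    then show "Poly_Mapping.keys h \<subseteq> {..<?m}" by (auto simp: in_keys_iff e split: if_splits)
  qed
  ultimately have "p = 0" using x by (simp add: algebraically_independent_def)
  then have "Poly_Mapping.lookup c v = 0" for v
    using lookup_p[of v] by (cases "v \<in> Poly_Mapping.keys c") (auto simp: in_keys_iff)
  then show ?thesis by (intro poly_mapping_eqI) simp
qed

section \<open>Transfer to an arbitrary pattern\<close>

lemma tree_induct:
  assumes tree: "is_tree V adj" and V: "s \<in> V" "t \<in> V" and base: "P s"
    and step: "\<And>a b. a \<in> V \<Longrightarrow> b \<in> V \<Longrightarrow> adj a b \<Longrightarrow> P a \<Longrightarrow> P b"
  shows "P t"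
proof -
  obtain p where p: "simple_path V adj s p t" using tree V unfolding is_tree_def by blast
  have "P (last q)" if "q \<noteq> []" "set q \<subseteq> V" "successively adj q" "P (hd q)" for q
    using that
  proof (induction q rule: induct_list012)
    case (3 a b q)
    then have "P b" using step[of a b] by simp
    then show ?case using 3 by simp
  qed simp_all
  then show ?thesis using p base unfolding simple_path_def by blast
qed

lemma meval_nonneg_prod:
  assumes "\<And>i. Poly_Mapping.lookup u i \<ge> 0"
  shows "meval x u = (\<Prod>i\<in>Poly_Mapping.keys u. x i ^ nat (Poly_Mapping.lookup u i))"
  unfolding meval_def by (rule prod.cong) (use assms in \<open>auto simp: power_int_def\<close>)

text \<open>
  \<open>s\<close> is a seed of the pattern with principal coefficients, \<open>t\<close> one of the given pattern, \<open>y\<close> the initial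
  cluster of the latter. Substituting \<open>y\<close> for the initial variables and 1 for the coefficients in the
  Laurent expansions of the variables of \<open>s\<close> gives the cluster of \<open>t\<close>.
\<close>

definition lifts :: "nat \<Rightarrow> 'f::field vec \<Rightarrow> laurent fract col_seed \<Rightarrow> 'f seed \<Rightarrow> bool" where
  "lifts n y s t \<longleftrightarrow> cols_match (dim_vec (fst t)) n (snd t) (snd s) \<and>
     (\<forall>i. \<exists>f. leval generic_var f = fst s i \<and> leval (extend_vec y) f = extend_vec (fst t) i)"

text \<open>Restricted to nonnegative exponents because Laurent expansions can be multiplied but not
  inverted.\<close>

lemma lifts_meval:
  assumes l: "lifts n y s t" and y: "\<And>i. extend_vec y i \<noteq> 0" and u: "\<And>i. Poly_Mapping.lookup u i \<ge> 0"
  shows "\<exists>f. leval generic_var f = meval (fst s) u \<and> leval (extend_vec y) f = meval (extend_vec (fst t)) u"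
proof -
  note gv = free_varsD(1)[OF free_vars_generic]
  obtain F where F: "\<And>i. leval generic_var (F i) = fst s i"
      "\<And>i. leval (extend_vec y) (F i) = extend_vec (fst t) i"
    using l unfolding lifts_def by metis
  show ?thesis
    by (rule exI[of _ "\<Prod>i\<in>Poly_Mapping.keys u. F i ^ nat (Poly_Mapping.lookup u i)"])
       (simp add: leval_prod leval_power gv y F meval_nonneg_prod[OF u])
qed

lemma extend_vec_nonzero: "algebraically_independent x \<Longrightarrow> extend_vec x i \<noteq> 0"
  by (simp add: extend_vec_def algebraically_independent_nonzero)

text \<open>Multiplied out, the exchange relation is an identity of Laurent polynomials in the
  generic cluster and survives specialization. Dividing afterwards is legitimate, as the specialized
  old variable is nonzero.\<close>

lemma lifts_mutate:
  fixes t :: "'f::field_char_0 seed"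
  assumes l: "lifts n y s t" and y: "\<And>i. extend_vec y i \<noteq> 0"
    and t: "algebraically_independent (fst t)"
    and k: "k < n" "n \<le> dim_vec (fst t)" and diag: "snd t $$ (k, k) = 0"
    and z: "fst (mutate k s) k \<in> range (leval generic_var)" and sk: "fst s k \<noteq> 0"
  shows "lifts n y (mutate k s) (seed_mutation k t)"
proof -
  obtain x B where tx: "t = (x, B)" by (cases t)
  note gv = free_varsD(1)[OF free_vars_generic]
  have dim: "dim_vec (cluster_mutation k t) = dim_vec x" by (simp add: tx cluster_mutation_def)
  have match: "cols_match (dim_vec x) n B (snd s)" using l by (simp add: lifts_def tx)
  have "\<exists>f. leval generic_var f = fst (mutate k s) i \<and>
      leval (extend_vec y) f = extend_vec (cluster_mutation k t) i" for i
  proof (cases "i = k")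
    case False
    then have "fst (mutate k s) i = fst s i" "extend_vec (cluster_mutation k t) i = extend_vec x i"
      by (simp_all add: fst_mutate extend_vec_def dim) (simp add: cluster_mutation_def tx)
    then show ?thesis using l by (simp add: lifts_def tx)
  next
    case True
    let ?b = "snd s k"
    obtain f where f: "fst (mutate k s) k = leval generic_var f" using z by (elim rangeE)
    obtain fk where fk: "leval generic_var fk = fst s k" "leval (extend_vec y) fk = extend_vec x k"
      using l unfolding lifts_def tx by auto
    obtain p where p: "leval generic_var p = meval (fst s) (pos_vec ?b)"
        "leval (extend_vec y) p = meval (extend_vec x) (pos_vec ?b)"
      using lifts_meval[OF l y, of "pos_vec ?b"] by (auto simp: tx)
    obtain q where q: "leval generic_var q = meval (fst s) (pos_vec (- ?b))"
        "leval (extend_vec y) q = meval (extend_vec x) (pos_vec (- ?b))"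
      using lifts_meval[OF l y, of "pos_vec (- ?b)"] by (auto simp: tx)
    have "leval generic_var (f * fk) = leval generic_var (p + q)"
      using sk by (simp add: leval_mult gv fk p q flip: f) (simp add: fst_mutate exch_def)
    then have "f * fk = p + q" by (simp only: free_varsD(2)[OF free_vars_generic])
    then have "leval (extend_vec y) (f * fk) = leval (extend_vec y) (p + q)" by simp
    then have eq: "leval (extend_vec y) f * extend_vec x k
        = meval (extend_vec x) (pos_vec ?b) + meval (extend_vec x) (pos_vec (- ?b))"
      by (simp add: leval_mult y fk p q)
    have kx: "k < dim_vec x" using k by (simp add: tx)
    have prods: "meval (extend_vec x) (pos_vec ?b) = (\<Prod>j<dim_vec x. (x $ j) powi pos_part (B $$ (j, k)))"
      "meval (extend_vec x) (pos_vec (- ?b)) = (\<Prod>j<dim_vec x. (x $ j) powi pos_part (- B $$ (j, k)))"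
      using match k(1) by (simp_all add: meval_extend_vec cols_match_def)
    have "extend_vec (cluster_mutation k t) k
        = inverse (extend_vec x k) * (meval (extend_vec x) (pos_vec ?b) + meval (extend_vec x) (pos_vec (- ?b)))"
      unfolding prods using kx by (simp add: extend_vec_def dim) (simp add: cluster_mutation_def tx)
    also have "\<dots> = leval (extend_vec y) f"
      unfolding eq[symmetric] using extend_vec_nonzero[OF t, of k] by (simp add: tx)
    finally show ?thesis using f True by metis
  qed
  moreover have "cols_match (dim_vec x) n (mat_mutation k B) (mutate_cols k (snd s))"
    using cols_match_mutate[OF match k(1)] k(2) diag by (simp add: tx)
  ultimately show ?thesis
    unfolding lifts_def by (simp add: seed_mutation_def dim) (simp add: tx mutate_def)
qed

lemma sign_skew_mat_diag:
  assumes "totally_sign_skew_symmetric n (top_submatrix n B)" "k < n"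
  shows "B $$ (k, k) = 0"
proof -
  have "sign_skew_symmetric n (fold mat_mutation [] (top_submatrix n B))"
    using assms(1) unfolding totally_sign_skew_symmetric_def by (metis empty_subsetI list.set(1))
  then have "B $$ (k, k) * B $$ (k, k) < 0 \<or> B $$ (k, k) = 0"
    using assms(2) unfolding sign_skew_symmetric_def top_submatrix_def by fastforce
  then show ?thesis using not_square_less_zero[of "B $$ (k, k)"] by blast
qed

lemma good_seed_principal:
  assumes B: "B \<in> carrier_mat m n" "totally_sign_skew_symmetric n (top_submatrix n B)" and "n \<le> m"
  shows "good_seed n (generic_var, principal_cols m B)"
proof -
  have "cols_match n n (top_submatrix n B) (principal_cols m B)"
    using \<open>n \<le> m\<close> by (simp add: cols_match_def top_submatrix_def lookup_principal_cols)
  then show ?thesis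
    using B(2) by (simp add: good_seed_def free_vars_generic unimodular_principal_cols totally_sign_skew_of_mat)
qed

lemma lift_pattern:
  fixes S :: "'v \<Rightarrow> 'f::field_char_0 seed"
  assumes nm: "n \<le> m" and tree: "labeled_regular_tree n V adj lab"
    and pat: "cluster_pattern n m F V adj lab S" and V: "t0 \<in> V" "t \<in> V"
    and s0: "s0 = (generic_var, principal_cols m (snd (S t0)))"
  shows "\<exists>ks. set ks \<subseteq> {..<n} \<and> lifts n (cluster S t0) (fold mutate ks s0) (S t)"
proof -
  have seed: "is_seed n m F (S t)" if "t \<in> V" for t using pat that by (simp add: cluster_pattern_def)
  have ind: "algebraically_independent (cluster S t)" and dim: "dim_vec (cluster S t) = m"
    and mat: "snd (S t) \<in> carrier_mat m n" "totally_sign_skew_symmetric n (top_submatrix n (snd (S t)))"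
    if "t \<in> V" for t
    using seed[OF that] by (auto simp: is_seed_def free_generators_def)
  have good: "good_seed n s0" unfolding s0 by (rule good_seed_principal[OF mat[OF V(1)] nm])
  note y = extend_vec_nonzero[OF ind[OF V(1)]]
  show ?thesis
  proof (rule tree_induct[where P = "\<lambda>t. \<exists>ks. set ks \<subseteq> {..<n} \<and> lifts n (cluster S t0) (fold mutate ks s0) (S t)"])
    show "is_tree V adj" using tree by (simp add: labeled_regular_tree_def)
    have "\<exists>f. leval generic_var f = generic_var i \<and> leval (extend_vec (cluster S t0)) f = extend_vec (cluster S t0) i" for i
      by (rule exI[of _ "mon (basis_vec i)"]) simp
    moreover have "cols_match m n (snd (S t0)) (principal_cols m (snd (S t0)))"
      using mat(1)[OF V(1)] by (simp add: cols_match_def lookup_principal_cols)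
    ultimately have "lifts n (cluster S t0) s0 (S t0)"
      by (simp add: lifts_def s0 dim[OF V(1)])
    then show "\<exists>ks. set ks \<subseteq> {..<n} \<and> lifts n (cluster S t0) (fold mutate ks s0) (S t0)"
      by (intro exI[of _ "[]"]) simp
  next
    fix a b assume ab: "a \<in> V" "b \<in> V" "adj a b"
      and "\<exists>ks. set ks \<subseteq> {..<n} \<and> lifts n (cluster S t0) (fold mutate ks s0) (S a)"
    then obtain ks where ks: "set ks \<subseteq> {..<n}" "lifts n (cluster S t0) (fold mutate ks s0) (S a)" by blast
    define k where "k = lab a b"
    have "bij_betw (lab a) {s \<in> V. adj a s} {..<n}" using tree ab by (simp add: labeled_regular_tree_def)
    then have k: "k < n" using ab bij_betwE unfolding k_def by fastforce
    have Sb: "S b = seed_mutation k (S a)" using pat ab by (simp add: cluster_pattern_def k_def)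
    have kk: "set (ks @ [k]) \<subseteq> {..<n}" using ks(1) k by simp
    have "lifts n (cluster S t0) (mutate k (fold mutate ks s0)) (S b)"
      unfolding Sb
    proof (rule lifts_mutate[OF ks(2) y ind[OF ab(1)] k])
      show "n \<le> dim_vec (cluster S a)" using nm dim[OF ab(1)] by simp
      show "snd (S a) $$ (k, k) = 0" using sign_skew_mat_diag[OF mat(2)[OF ab(1)] k] .
      show "fst (mutate k (fold mutate ks s0)) k \<in> range (leval generic_var)"
        using laurent_phenomenon[OF good kk, of k] by (simp add: s0)
      show "fst (fold mutate ks s0) k \<noteq> 0"
        using good_seed_fold[OF good ks(1)] by (simp add: good_seed_def free_varsD)
    qed
    then show "\<exists>ks. set ks \<subseteq> {..<n} \<and> lifts n (cluster S t0) (fold mutate ks s0) (S b)"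
      using kk by (intro exI[of _ "ks @ [k]"]) simp
  qed (rule V)+
qed

section \<open>Monomials in a single cluster\<close>

lemma monomials_in_one: "1 \<in> monomials_in x"
  unfolding monomials_in_def monomial_def by (auto intro!: exI[of _ 0])

lemma monomials_in_mult: "a \<in> monomials_in x \<Longrightarrow> b \<in> monomials_in x \<Longrightarrow> a * b \<in> monomials_in x"
proof -
  assume "a \<in> monomials_in x" "b \<in> monomials_in x"
  then obtain g h where "a = monomial x g" "Poly_Mapping.keys g \<subseteq> {..<dim_vec x}"
      "b = monomial x h" "Poly_Mapping.keys h \<subseteq> {..<dim_vec x}"
    unfolding monomials_in_def by blast
  then show ?thesis
    unfolding monomials_in_def using keys_add[of g h]
    by (auto simp: monomial_def lookup_add power_add prod.distrib intro!: exI[of _ "g + h"])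
qed

lemma monomials_in_prod: "(\<And>i. i \<in> I \<Longrightarrow> F i \<in> monomials_in x) \<Longrightarrow> prod F I \<in> monomials_in x"
  by (induction I rule: infinite_finite_induct) (auto simp: monomials_in_one monomials_in_mult)

lemma monomials_in_power: "a \<in> monomials_in x \<Longrightarrow> a ^ N \<in> monomials_in x"
  by (induction N) (auto simp: monomials_in_one monomials_in_mult)

lemma monomials_in_var:
  assumes "i < dim_vec x"
  shows "x $ i \<in> monomials_in x"
proof -
  have "monomial x (Poly_Mapping.single i 1) = (\<Prod>j<dim_vec x. if j = i then x $ j else 1)"
    unfolding monomial_def by (rule prod.cong) (auto simp: lookup_single when_def)
  also have "\<dots> = x $ i" using assms by simp
  finally show ?thesis
    unfolding monomials_in_def using assms by (auto intro!: exI[of _ "Poly_Mapping.single i 1"])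
qed

lemma fst_fold_mutate_frozen: "set ks \<subseteq> {..<n} \<Longrightarrow> n \<le> i \<Longrightarrow> fst (fold mutate ks s) i = fst s i"
proof (induction ks arbitrary: s)
  case (Cons k ks)
  then show ?case using Cons.IH[of "mutate k s"] by (auto simp: fst_mutate)
qed simp

text \<open>Setting the extra variables to 1 preserves the exponents of the original ones.\<close>

lemma laurent_expansion_truncate:
  assumes "leval (extend_vec x) f = u"
    and proper: "\<And>v. v \<in> Poly_Mapping.keys f \<Longrightarrow> \<exists>i<dim_vec x. Poly_Mapping.lookup v i < 0"
  obtains c where "laurent_expansion x u c" "\<And>v. v \<in> Poly_Mapping.keys c \<Longrightarrow> proper_exponent (dim_vec x) v"
proof -
  define tr :: "(nat \<Rightarrow>\<^sub>0 int) \<Rightarrow> nat \<Rightarrow>\<^sub>0 int"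
    where "tr v = (\<Sum>i<dim_vec x. Poly_Mapping.single i (Poly_Mapping.lookup v i))" for v
  have tr: "Poly_Mapping.lookup (tr v) i = (if i < dim_vec x then Poly_Mapping.lookup v i else 0)" for v i
    by (simp add: tr_def lookup_sum lookup_single when_def)
  \<comment> \<open>Several exponents may collapse to the same truncation; coefficients then add up
    or cancel, but no new exponent arises.\<close>
  define c where "c = (\<Sum>v\<in>Poly_Mapping.keys f. Poly_Mapping.single (tr v) (Poly_Mapping.lookup f v))"
  have keys_c: "Poly_Mapping.keys c \<subseteq> tr ` Poly_Mapping.keys f"
    unfolding c_def by (rule order.trans[OF keys_sum]) auto
  have "meval (extend_vec x) (tr v) = meval (extend_vec x) v" for v
    by (simp add: meval_extend_vec tr)
  then have "leval (extend_vec x) c = leval (extend_vec x) f"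
    by (simp add: c_def leval_sum leval_def[of _ f])
  moreover have "Poly_Mapping.keys (tr v) \<subseteq> {..<dim_vec x}" for v
    by (auto simp: in_keys_iff tr split: if_splits)
  ultimately have "laurent_expansion x u c"
    unfolding laurent_expansion_iff using keys_c assms(1) by (metis (no_types, lifting) imageE subsetD)
  moreover have "proper_exponent (dim_vec x) v" if "v \<in> Poly_Mapping.keys c" for v
    using that keys_c proper by (force simp: proper_exponent_def tr)
  ultimately show thesis by (rule that)
qed

lemma proper_laurent_expansion:
  fixes S :: "'v \<Rightarrow> 'f::field_char_0 seed"
  assumes nm: "n \<le> m" and tree: "labeled_regular_tree n V adj lab"
    and pat: "cluster_pattern n m F V adj lab S" and t0: "t0 \<in> V"
    and u: "u \<in> cluster_monomials V S" "u \<notin> monomials_in (cluster S t0)"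
  obtains c where "laurent_expansion (cluster S t0) u c"
    and "\<And>h. h \<in> Poly_Mapping.keys c \<Longrightarrow> proper_exponent m h"
proof -
  obtain t h where t: "t \<in> V" and h: "u = monomial (cluster S t) h"
      "Poly_Mapping.keys h \<subseteq> {..<dim_vec (cluster S t)}"
    using u(1) by (auto simp: cluster_monomials_def monomials_in_def)
  have ind: "algebraically_independent (cluster S t)" and dim: "dim_vec (cluster S t) = m"
    and mat: "snd (S t) \<in> carrier_mat m n" "totally_sign_skew_symmetric n (top_submatrix n (snd (S t)))"
    if "t \<in> V" for t
    using pat that by (auto simp: cluster_pattern_def is_seed_def free_generators_def)
  define s0 where "s0 = (generic_var, principal_cols m (snd (S t0)))"
  have good: "good_seed n s0" unfolding s0_def by (rule good_seed_principal[OF mat[OF t0] nm])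
  let ?y = "extend_vec (cluster S t0)"
  note y = extend_vec_nonzero[OF ind[OF t0]]
  obtain ks where ks: "set ks \<subseteq> {..<n}" and l: "lifts n (cluster S t0) (fold mutate ks s0) (S t)"
    using lift_pattern[OF nm tree pat t0 t s0_def] by blast
  define s' where "s' = fold mutate ks s0"
  obtain G where G: "leval generic_var G = meval (fst s') (nat_exponent h)"
      "leval ?y G = meval (extend_vec (cluster S t)) (nat_exponent h)"
    using lifts_meval[OF l y, of "nat_exponent h"] by (auto simp: s'_def)
  \<comment> \<open>Newness is argued in the auxiliary pattern: if every factor of u were an initial
    variable there, specialization would make u a monomial in the cluster at
    \<open>t0\<close>.\<close>
  have "\<exists>k<n. Poly_Mapping.lookup h k > 0 \<and> (\<forall>j<n. fst s' k \<noteq> fst s0 j)"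
  proof (rule ccontr)
    assume "\<not> ?thesis"
    then have common: "\<exists>j<n. fst s' k = fst s0 j" if "k < n" "Poly_Mapping.lookup h k > 0" for k
      using that by blast
    have "cluster S t $ k \<in> monomials_in (cluster S t0)" if k: "k < m" "Poly_Mapping.lookup h k > 0" for k
    proof -
      obtain j where j: "j < m" "fst s' k = fst s0 j"
      proof (cases "k < n")
        case True
        then show ?thesis using common[OF True k(2)] nm that by (meson less_le_trans)
      next
        case False
        then show ?thesis using that[of k] k fst_fold_mutate_frozen[OF ks, of k s0] by (simp add: s'_def)
      qed
      obtain f where f: "leval generic_var f = fst s' k" "leval ?y f = extend_vec (cluster S t) k"
        using l by (auto simp: lifts_def s'_def)
      have "leval generic_var f = leval generic_var (mon (basis_vec j))"
        using f(1) j(2) by (simp add: s0_def)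
      then have "f = mon (basis_vec j)" by (simp only: free_varsD(2)[OF free_vars_generic])
      then have "cluster S t $ k = cluster S t0 $ j"
        using f(2) k j by (simp add: extend_vec_def dim t t0)
      then show ?thesis using monomials_in_var[of j "cluster S t0"] j by (simp add: dim t0)
    qed
    then have "(cluster S t $ k) ^ Poly_Mapping.lookup h k \<in> monomials_in (cluster S t0)" if "k < m" for k
      using that by (cases "Poly_Mapping.lookup h k = 0") (auto simp: monomials_in_one intro: monomials_in_power)
    then have "u \<in> monomials_in (cluster S t0)"
      unfolding h(1) monomial_def by (intro monomials_in_prod) (simp add: dim t)
    then show False using u(2) by blast
  qed
  then obtain k where k: "k < n" "Poly_Mapping.lookup h k > 0" "\<And>j. j < n \<Longrightarrow> fst s' k \<noteq> fst s0 j" by blast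
  obtain f where f: "leval (fst s0) f = meval (fst s') (nat_exponent h)"
      "\<And>v. v \<in> Poly_Mapping.keys f \<Longrightarrow> \<exists>i<n. Poly_Mapping.lookup v i < 0"
    by (rule cluster_monomial_proper[OF good ks s'_def, of "nat_exponent h" k]) (use k in auto)
  have "leval generic_var f = leval generic_var G" using f(1) G(1) by (simp add: s0_def)
  \<comment> \<open>Uniqueness of generic expansions gives one Laurent polynomial both properness
    and the specialization u.\<close>
  then have "f = G" by (simp only: free_varsD(2)[OF free_vars_generic])
  then have "leval ?y f = u" using G(2) h(1) by (simp add: monomial_eq_meval)
  moreover have "\<exists>i<dim_vec (cluster S t0). Poly_Mapping.lookup v i < 0" if "v \<in> Poly_Mapping.keys f" for v
    using f(2)[OF that] nm dim[OF t0] by (metis less_le_trans)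
  ultimately obtain c where "laurent_expansion (cluster S t0) u c"
      "\<And>v. v \<in> Poly_Mapping.keys c \<Longrightarrow> proper_exponent (dim_vec (cluster S t0)) v"
    using laurent_expansion_truncate by blast
  then show thesis using that dim[OF t0] by simp
qed

section \<open>Linear independence\<close>

lemma leval_frag_cmul: "leval x (frag_cmul a f) = of_int a * leval x f"
proof -
  have "leval x (frag_cmul a f)
      = (\<Sum>v\<in>Poly_Mapping.keys f. of_int (Poly_Mapping.lookup (frag_cmul a f) v) * meval x v)"
    by (rule leval_superset) (auto simp: in_keys_iff)
  then show ?thesis by (simp add: leval_def sum_distrib_left ac_simps)
qed

lemma cluster_monomials_subset:
  assumes "\<And>t. t \<in> V \<Longrightarrow> dim_vec (cluster S t) = m"
  shows "cluster_monomials V S \<subseteq> cluster_algebra n m V S"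
proof
  fix u assume "u \<in> cluster_monomials V S"
  then obtain t h where t: "t \<in> V" "u = monomial (cluster S t) h"
    by (auto simp: cluster_monomials_def monomials_in_def)
  show "u \<in> cluster_algebra n m V S"
    unfolding cluster_algebra_def hull_def
  proof (intro InterI, clarify)
    fix R assume R: "is_subring R"
      and sub: "{cluster S t $ i |t i. t \<in> V \<and> i < m} \<union>
        {inverse (cluster S t $ i) |t i. t \<in> V \<and> n \<le> i \<and> i < m} \<subseteq> R"
    have "cluster S t $ i \<in> R" if "i < dim_vec (cluster S t)" for i
      using sub t(1) that assms by blast
    then show "u \<in> R"
      unfolding t(2) monomial_def by (intro subring_prod[OF R] subring_power[OF R]) simp
  qed
qed

text \<open>
  Expand a relation in the cluster of one of its monomials: that monomial is the only one contributing
  to its own exponent, since the others are distinct monomials or have proper expansions.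
\<close>

lemma cluster_monomials_independent:
  fixes S :: "'v \<Rightarrow> 'f::field_char_0 seed"
  assumes nm: "n \<le> m" and tree: "labeled_regular_tree n V adj lab"
    and pat: "cluster_pattern n m F V adj lab S"
    and T: "finite T" "T \<subseteq> cluster_monomials V S" and rel: "(\<Sum>v\<in>T. of_int (a v) * v) = 0"
    and w: "w \<in> T"
  shows "a w = (0 :: int)"
proof -
  have ind: "algebraically_independent (cluster S t)" and dim: "dim_vec (cluster S t) = m" if "t \<in> V" for t
    using pat that by (auto simp: cluster_pattern_def is_seed_def free_generators_def)
  obtain t0 h where t0: "t0 \<in> V" and h: "w = monomial (cluster S t0) h"
      "Poly_Mapping.keys h \<subseteq> {..<dim_vec (cluster S t0)}"
    using w T(2) by (auto simp: cluster_monomials_def monomials_in_def)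
  let ?y = "extend_vec (cluster S t0)" and ?h = "nat_exponent h"
  have "\<exists>c. (\<forall>v\<in>Poly_Mapping.keys c. Poly_Mapping.keys v \<subseteq> {..<m}) \<and> leval ?y c = u
      \<and> Poly_Mapping.lookup c ?h = (if u = w then 1 else 0)" if u: "u \<in> T" for u
  proof (cases "u \<in> monomials_in (cluster S t0)")
    case True
    then obtain h' where h': "u = monomial (cluster S t0) h'" "Poly_Mapping.keys h' \<subseteq> {..<m}"
      "u = w \<Longrightarrow> h' = h"
      using h unfolding monomials_in_def dim[OF t0] by (cases "u = w") auto
    have "Poly_Mapping.lookup (mon (nat_exponent h')) ?h = (if u = w then 1 else 0)"
    proof (cases "u = w")
      case True
      then show ?thesis using h'(3) by simp
    next
      case False
      then have "nat_exponent h' \<noteq> ?h" using h(1) h'(1) by (auto simp: monomial_eq_meval)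
      then show ?thesis using False by (simp add: lookup_single when_def)
    qed
    then show ?thesis
      using h' by (intro exI[of _ "mon (nat_exponent h')"]) (simp add: monomial_eq_meval)
  next
    case False
    obtain c where c: "laurent_expansion (cluster S t0) u c"
        "\<And>h. h \<in> Poly_Mapping.keys c \<Longrightarrow> proper_exponent m h"
      using proper_laurent_expansion[OF nm tree pat t0 subsetD[OF T(2) u] False] by blast
    have "u \<noteq> w" using False h by (auto simp: monomials_in_def)
    \<comment> \<open>The exponent of w has no negative entry, so it cannot occur in a proper
      expansion.\<close>
    moreover have "?h \<notin> Poly_Mapping.keys c" using c(2)[of ?h] by (auto simp: proper_exponent_def)
    ultimately show ?thesis
      using c(1) by (intro exI[of _ c]) (simp add: laurent_expansion_iff dim t0 in_keys_iff)
  qed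
  then obtain C where C: "\<And>u v. u \<in> T \<Longrightarrow> v \<in> Poly_Mapping.keys (C u) \<Longrightarrow> Poly_Mapping.keys v \<subseteq> {..<m}"
      "\<And>u. u \<in> T \<Longrightarrow> leval ?y (C u) = u"
      "\<And>u. u \<in> T \<Longrightarrow> Poly_Mapping.lookup (C u) ?h = (if u = w then 1 else 0)"
    by metis
  define c where "c = (\<Sum>u\<in>T. frag_cmul (a u) (C u))"
  have "leval ?y c = 0" using rel by (simp add: c_def leval_sum leval_frag_cmul C(2))
  moreover have "Poly_Mapping.keys v \<subseteq> {..<m}" if "v \<in> Poly_Mapping.keys c" for v
  proof -
    have "v \<in> (\<Union>u\<in>T. Poly_Mapping.keys (frag_cmul (a u) (C u)))"
      using subsetD[OF keys_sum that[unfolded c_def]] .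
    then show ?thesis using C(1) by auto
  qed
  ultimately have "c = 0"
    by (intro leval_extend_vec_eq_0[OF ind[OF t0]]) (simp_all add: dim t0)
  then have "(\<Sum>u\<in>T. a u * Poly_Mapping.lookup (C u) ?h) = 0"
    by (metis (no_types, lifting) c_def lookup_frag_cmul lookup_sum lookup_zero sum.cong)
  moreover have "(\<Sum>u\<in>T. a u * Poly_Mapping.lookup (C u) ?h) = (\<Sum>u\<in>T. if u = w then a u else 0)"
    by (rule sum.cong) (auto simp: C(3))
  ultimately show ?thesis using w T(1) by simp
qed

theorem corollary3p7:
  fixes n m :: nat
    and F :: "'f::field_char_0 set"
    and V :: "'v set" and adj :: "'v \<Rightarrow> 'v \<Rightarrow> bool" and lab :: "'v \<Rightarrow> 'v \<Rightarrow> nat"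
    and S :: "'v \<Rightarrow> 'f seed"
    and t0 :: 'v
  assumes "0 < n" and "n \<le> m"
    and "rational_function_field m F"
    and "labeled_regular_tree n V adj lab"
    and "cluster_pattern n m F V adj lab S"
    and "t0 \<in> V"
  shows "(\<forall>u\<in>cluster_monomials V S. u \<notin> monomials_in (cluster S t0) \<longrightarrow>
            (\<exists>c. laurent_expansion (cluster S t0) u c \<and>
                 (\<forall>h\<in>Poly_Mapping.keys c. proper_exponent m h))) \<and>
         int_linearly_independent_in (cluster_algebra n m V S) (cluster_monomials V S)"
proof (intro conjI ballI impI)
  fix u assume u: "u \<in> cluster_monomials V S" "u \<notin> monomials_in (cluster S t0)"
  obtain c where "laurent_expansion (cluster S t0) u c"
      "\<And>h. h \<in> Poly_Mapping.keys c \<Longrightarrow> proper_exponent m h"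
    using proper_laurent_expansion[OF assms(2,4,5,6) u] by blast
  then show "\<exists>c. laurent_expansion (cluster S t0) u c \<and> (\<forall>h\<in>Poly_Mapping.keys c. proper_exponent m h)"
    by blast
next
  interpret Modules.module "\<lambda>(c::int) v::'f. of_int c * v"
    by unfold_locales (simp_all add: algebra_simps)
  have "dim_vec (cluster S t) = m" if "t \<in> V" for t
    using assms(5) that by (auto simp: cluster_pattern_def is_seed_def free_generators_def)
  moreover have "\<not> dependent (cluster_monomials V S)"
    unfolding dependent_explicit using cluster_monomials_independent[OF assms(2,4,5)] by metis
  ultimately show "int_linearly_independent_in (cluster_algebra n m V S) (cluster_monomials V S)"
    unfolding int_linearly_independent_in_def using cluster_monomials_subset by blast
qed

end
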